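(* Let $A_0=\mathrm{diag}(\lambda_1,\dots,\lambda_n)$ with pairwise distinct $\lambda_i\in\mathbb C$, let $A_1$ be a complex $n\times n$ matrix with diagonal entries $\lambda'_1,\dots,\lambda'_n$, and let $\eta$ be admissible. Consider the system $(A_0-\lambda)\frac{d\Psi}{d\lambda}=(A_1+I)\Psi$, its matrix solution $\Psi(\lambda)=[\vec\Psi_1|\cdots|\vec\Psi_n]$, the monodromy matrices $M_1,\dots,M_n$ of $\Psi$, and the matrix $C=(c_{jk})$ of connection coefficients. If $A_1$ has no integer eigenvalues, then $\Psi(\lambda)$ is a fundamental matrix and $M_1,\dots,M_n$ generate the monodromy group of the system. Moreover, $C$ is invertible if and only if $A_1$ has no integer eigenvalues.
   Context: System (F): $(A_0-\lambda)\frac{d\Psi}{d\lambda}=(A_1+I)\Psi$. $\mathbb N=\{0,1,2,\dots\}$, $\mathbb Z_-=\{-1,-2,\dots\}$, $\vec e_k$ is the $k$-th unit column vector; $\mathrm{reg}(\lambda-\lambda_j)$ denotes any vector function analytic in a neighbourhood of $\lambda_j$. Cuts. $\eta\in\mathbb R$ is admissible if $\eta\neq\arg(\lambda_j-\lambda_k)$ mod $2\pi$ for all $j\ne k$. For admissible $\eta$, $L_k$ is the ray from $\lambda_k$ to $\infty$ in direction $\eta$, and $\mathcal P_\eta$ is the plane cut along $L_1,\dots,L_n$, with the branches $\eta-2\pi<\arg(\lambda-\lambda_k)<\eta$ used for all powers and logarithms of $\lambda-\lambda_k$. Solutions of (F) are single valued on $\mathcal P_\eta$. Solutions $\vec\Psi_k$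 of (F) on $\mathcal P_\eta$, defined by their behaviour near $\lambda_k$: - if $\lambda'_k\notin\mathbb Z$: the unique solution $\vec\Psi_k=\bigl(\Gamma(\lambda'_k+1)\vec e_k+\sum_{l\ge1}\vec b_l(\lambda-\lambda_k)^l\bigr)(\lambda-\lambda_k)^{-\lambda'_k-1}$; - if $\lambda'_k=N_k\in\mathbb Z_-$: the unique solution $\vec\Psi_k=\bigl(\frac{(-1)^{N_k}}{(-N_k-1)!}\vec e_k+\sum_{l\ge1}\vec b_l(\lambda-\lambda_k)^l\bigr)(\lambda-\lambda_k)^{-N_k-1}$; - if $\lambda'_k=N_k\in\mathbb N$: the unique solution $\vec\Psi_k$, analytic at $\lambda_k$ (possibly $\equiv0$), such that (F) has a solution of the form $\vec\Psi_k\ln(\lambda-\lambda_k)+\frac{P^{(k)}_{N_k}(\lambda)}{(\lambda-\lambda_k)^{N_k+1}}+\mathrm{reg}(\lambda-\lambda_k)$, where $P^{(k)}_{N_k}$ is a vector polynomial in $\lambda-\lambda_k$ of degree at most $N_k$ with $P^{(k)}_{N_k}(\lambda_k)=N_k!\,\vec e_k$. Singular solutions: $\vec\Psi_k^{(sing)}=\vec\Psi_k$ if $\lambda'_k\notin\mathbb Z$; if $\lambda'_k\in\mathbb N$, $\vec\Psi_k^{(sing)}$ is the solution of the form just displayed; if $\lambda'_k\in\mathbb Z_-$, $\vec\Psi_k^{(sing)}$ is a solution of the form $\vec\Psi_k\ln(\lambda-\lambda_k)+\mathrm{reg}(\lambda-\lambda_k)$ if one exists, and $\vec\Psi_k^{(sing)}\equiv0$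 otherwise. For $\lambda'_k\in\mathbb Z$ it is determined modulo solutions analytic at $\lambda_k$. Connection coefficients $c_{jk}$ ($1\le j,k\le n$) are the unique numbers with $\vec\Psi_k(\lambda)=\vec\Psi_j^{(sing)}(\lambda)\,c_{jk}+\mathrm{reg}(\lambda-\lambda_j)$ near $\lambda_j$ in $\mathcal P_\eta$, with $c_{jk}:=0$ for all $k$ if $\vec\Psi_j^{(sing)}\equiv0$. Put $\alpha_k=e^{-2\pi i\lambda'_k}-1$ if $\lambda'_k\notin\mathbb Z$ and $\alpha_k=2\pi i$ if $\lambda'_k\in\mathbb Z$. Monodromy matrices. $M_k$ is the matrix describing the analytic continuation $\Psi\mapsto\Psi M_k$ along a small anticlockwise loop around $\lambda_k$ encircling no other $\lambda_j$ (crossing only the cut $L_k$): its diagonal entries are $1$ except the $(k,k)$ entry $e^{-2\pi i\lambda'_k}$, its $(k,j)$ entry is $\alpha_kc_{kj}$ for $j\ne k$, and all other entries vanish. *)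

theory Defs
  imports "HOL-Complex_Analysis.Complex_Analysis" "HOL-Algebra.Generated_Groups"
begin

section \<open>The system and its solutions\<close>

definition diagm :: "('n::finite \<Rightarrow> complex) \<Rightarrow> complex^'n^'n" where
  "diagm lam = (\<chi> i j. if i = j then lam i else 0)"

text \<open>The system \<open>(A\<^sub>0 - z) \<Psi>' = (A\<^sub>1 + I) \<Psi>\<close> on \<open>S\<close>, with \<open>A\<^sub>0 = diagm lam\<close>.
  \<open>D\<close> is the (componentwise) complex derivative of \<open>\<psi>\<close> at \<open>z\<close>.\<close>

definition is_solution ::
  "('n::finite \<Rightarrow> complex) \<Rightarrow> complex^'n^'n \<Rightarrow> complex set \<Rightarrow> (complex \<Rightarrow> complex^'n) \<Rightarrow> bool" where
  "is_solution lam A1 S \<psi> \<longleftrightarrow>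
     (\<forall>z\<in>S. \<exists>D :: complex^'n.
        (\<forall>i. ((\<lambda>w. \<psi> w $ i) has_field_derivative D $ i) (at z)) \<and>
        (diagm lam - mat z) *v D = (A1 + mat 1) *v \<psi> z)"

definition is_fundamental_matrix ::
  "('n::finite \<Rightarrow> complex) \<Rightarrow> complex^'n^'n \<Rightarrow> complex set \<Rightarrow> (complex \<Rightarrow> complex^'n^'n) \<Rightarrow> bool" where
  "is_fundamental_matrix lam A1 S Y \<longleftrightarrow>
     (\<forall>k. is_solution lam A1 S (\<lambda>z. column k (Y z))) \<and> (\<forall>z\<in>S. invertible (Y z))"

definition is_eigenvalue :: "complex^'n^'n \<Rightarrow> complex \<Rightarrow> bool" where
  "is_eigenvalue A \<mu> \<longleftrightarrow> (\<exists>v. v \<noteq> 0 \<and> A *v v = \<mu> *s v)"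


section \<open>The cut plane and the branches\<close>

definition admissible :: "('n::finite \<Rightarrow> complex) \<Rightarrow> real \<Rightarrow> bool" where
  "admissible lam \<eta> \<longleftrightarrow>
     (\<forall>j k. j \<noteq> k \<longrightarrow> (\<forall>m::int. \<eta> \<noteq> Arg (lam j - lam k) + 2 * pi * of_int m))"

definition cut_ray :: "complex \<Rightarrow> real \<Rightarrow> complex set" where
  "cut_ray a \<eta> = {a + of_real t * cis \<eta> | t. t \<ge> 0}"

definition cut_plane :: "('n::finite \<Rightarrow> complex) \<Rightarrow> real \<Rightarrow> complex set" where
  "cut_plane lam \<eta> = - (\<Union>k. cut_ray (lam k) \<eta>)"

text \<open>Rotating by \<open>\<pi> - \<eta>\<close> moves the ray of direction \<open>\<eta>\<close> to the cut of the principal branch,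
  so off that ray \<open>\<eta> - 2\<pi> < Im (cut_ln \<eta> z) < \<eta>\<close>.\<close>

definition cut_ln :: "real \<Rightarrow> complex \<Rightarrow> complex" where
  "cut_ln \<eta> z = Ln (z * cis (pi - \<eta>)) - \<i> * of_real (pi - \<eta>)"

definition cut_pow :: "real \<Rightarrow> complex \<Rightarrow> complex \<Rightarrow> complex" where
  "cut_pow \<eta> z a = exp (a * cut_ln \<eta> z)"


section \<open>Local behaviour at the singular points\<close>

text \<open>\<open>f = reg(z - lam j)\<close> near \<open>lam j\<close> in the cut plane.\<close>

definition is_reg ::
  "('n::finite \<Rightarrow> complex) \<Rightarrow> real \<Rightarrow> 'n \<Rightarrow> (complex \<Rightarrow> complex^'n) \<Rightarrow> bool" where
  "is_reg lam \<eta> j f \<longleftrightarrow>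
     (\<exists>r>0. \<exists>h. (\<forall>i. (\<lambda>z. h z $ i) holomorphic_on ball (lam j) r) \<and>
        (\<forall>z \<in> ball (lam j) r \<inter> cut_plane lam \<eta>. f z = h z))"

text \<open>\<open>\<psi> = (v + \<Sum>\<^bsub>l\<ge>1\<^esub> b\<^sub>l (z - lam k)\<^sup>l) (z - lam k)\<^sup>a\<close> near \<open>lam k\<close> in the cut plane.\<close>

definition has_expansion ::
  "('n::finite \<Rightarrow> complex) \<Rightarrow> real \<Rightarrow> 'n \<Rightarrow> complex^'n \<Rightarrow> complex \<Rightarrow> (complex \<Rightarrow> complex^'n) \<Rightarrow> bool" where
  "has_expansion lam \<eta> k v a \<psi> \<longleftrightarrow>
     (\<exists>r>0. \<exists>b :: nat \<Rightarrow> complex^'n. b 0 = v \<and>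
        (\<forall>z \<in> ball (lam k) r \<inter> cut_plane lam \<eta>.
           \<exists>s. (\<lambda>l. (z - lam k) ^ l *s b l) sums s \<and> \<psi> z = cut_pow \<eta> (z - lam k) a *s s))"

text \<open>\<open>\<phi>\<close> is a solution of the form
  \<open>\<psi> ln(z - lam k) + P(z) / (z - lam k)\<^bsup>N+1\<^esup> + reg(z - lam k)\<close>; the vectors \<open>p l\<close> are the
  coefficients of \<open>P\<close> in powers of \<open>z - lam k\<close>.\<close>

definition is_log_pole_solution ::
  "('n::finite \<Rightarrow> complex) \<Rightarrow> complex^'n^'n \<Rightarrow> real \<Rightarrow> 'n \<Rightarrow> nat \<Rightarrow>
     (complex \<Rightarrow> complex^'n) \<Rightarrow> (complex \<Rightarrow> complex^'n) \<Rightarrow> bool" where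
  "is_log_pole_solution lam A1 \<eta> k N \<psi> \<phi> \<longleftrightarrow>
     is_solution lam A1 (cut_plane lam \<eta>) \<phi> \<and>
     (\<exists>p :: nat \<Rightarrow> complex^'n. p 0 = fact N *s axis k 1 \<and>
        is_reg lam \<eta> k
          (\<lambda>z. \<phi> z - cut_ln \<eta> (z - lam k) *s \<psi> z
                - (1 / (z - lam k) ^ (N + 1)) *s (\<Sum>l\<le>N. (z - lam k) ^ l *s p l)))"

definition is_log_solution ::
  "('n::finite \<Rightarrow> complex) \<Rightarrow> complex^'n^'n \<Rightarrow> real \<Rightarrow> 'n \<Rightarrow>
     (complex \<Rightarrow> complex^'n) \<Rightarrow> (complex \<Rightarrow> complex^'n) \<Rightarrow> bool" where
  "is_log_solution lam A1 \<eta> k \<psi> \<phi> \<longleftrightarrow>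
     is_solution lam A1 (cut_plane lam \<eta>) \<phi> \<and>
     is_reg lam \<eta> k (\<lambda>z. \<phi> z - cut_ln \<eta> (z - lam k) *s \<psi> z)"


section \<open>The distinguished solutions and the connection coefficients\<close>

text \<open>Functions are total and their values on the cuts are irrelevant here, so \<open>\<Psi>\<^sub>k\<close> is unique
  only as a function on the cut plane; hence predicates instead of definite descriptions.\<close>

definition is_Psi ::
  "('n::finite \<Rightarrow> complex) \<Rightarrow> complex^'n^'n \<Rightarrow> real \<Rightarrow> 'n \<Rightarrow> (complex \<Rightarrow> complex^'n) \<Rightarrow> bool" where
  "is_Psi lam A1 \<eta> k \<psi> \<longleftrightarrow>
     is_solution lam A1 (cut_plane lam \<eta>) \<psi> \<and>
     (A1 $ k $ k \<notin> \<int> \<longrightarrow>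
        has_expansion lam \<eta> k (Gamma (A1 $ k $ k + 1) *s axis k 1) (- A1 $ k $ k - 1) \<psi>) \<and>
     (\<forall>N::int. A1 $ k $ k = of_int N \<and> N < 0 \<longrightarrow>
        has_expansion lam \<eta> k
          (((- 1) powi N / fact (nat (- N - 1))) *s axis k 1) (- of_int N - 1) \<psi>) \<and>
     (\<forall>N::nat. A1 $ k $ k = of_nat N \<longrightarrow>
        is_reg lam \<eta> k \<psi> \<and> (\<exists>\<phi>. is_log_pole_solution lam A1 \<eta> k N \<psi> \<phi>))"

definition is_Psi_sing ::
  "('n::finite \<Rightarrow> complex) \<Rightarrow> complex^'n^'n \<Rightarrow> real \<Rightarrow> 'n \<Rightarrow>
     (complex \<Rightarrow> complex^'n) \<Rightarrow> (complex \<Rightarrow> complex^'n) \<Rightarrow> bool" where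
  "is_Psi_sing lam A1 \<eta> k \<psi> \<phi> \<longleftrightarrow>
     (A1 $ k $ k \<notin> \<int> \<longrightarrow> (\<forall>z \<in> cut_plane lam \<eta>. \<phi> z = \<psi> z)) \<and>
     (\<forall>N::nat. A1 $ k $ k = of_nat N \<longrightarrow> is_log_pole_solution lam A1 \<eta> k N \<psi> \<phi>) \<and>
     (\<forall>N::int. A1 $ k $ k = of_int N \<and> N < 0 \<longrightarrow>
        (if \<exists>\<phi>'. is_log_solution lam A1 \<eta> k \<psi> \<phi>'
         then is_log_solution lam A1 \<eta> k \<psi> \<phi>
         else (\<forall>z \<in> cut_plane lam \<eta>. \<phi> z = 0)))"

definition is_connection_matrix ::
  "('n::finite \<Rightarrow> complex) \<Rightarrow> real \<Rightarrow> ('n \<Rightarrow> complex \<Rightarrow> complex^'n) \<Rightarrow>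
     ('n \<Rightarrow> complex \<Rightarrow> complex^'n) \<Rightarrow> complex^'n^'n \<Rightarrow> bool" where
  "is_connection_matrix lam \<eta> Psi Psing C \<longleftrightarrow>
     (\<forall>j k. if \<forall>z \<in> cut_plane lam \<eta>. Psing j z = 0 then C $ j $ k = 0
            else is_reg lam \<eta> j (\<lambda>z. Psi k z - C $ j $ k *s Psing j z))"

definition Psi_matrix :: "('n::finite \<Rightarrow> complex \<Rightarrow> complex^'n) \<Rightarrow> complex \<Rightarrow> complex^'n^'n" where
  "Psi_matrix Psi z = (\<chi> i k. Psi k z $ i)"


section \<open>Monodromy\<close>

definition alpha :: "complex^'n^'n \<Rightarrow> 'n::finite \<Rightarrow> complex" where
  "alpha A1 k = (if A1 $ k $ k \<in> \<int> then 2 * of_real pi * \<i>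
                 else exp (- 2 * of_real pi * \<i> * A1 $ k $ k) - 1)"

definition monodromy_matrix :: "complex^'n^'n \<Rightarrow> complex^'n^'n \<Rightarrow> 'n::finite \<Rightarrow> complex^'n^'n" where
  "monodromy_matrix A1 C k =
     (\<chi> i j. if i = j then (if i = k then exp (- 2 * of_real pi * \<i> * A1 $ k $ k) else 1)
             else if i = k then alpha A1 k * C $ k $ j else 0)"

text \<open>Analytic continuation along a path \<open>\<gamma>\<close> leads from the germ of \<open>Y\<close> at its start to the germ
  of \<open>Z\<close> at its end: there is a family of function elements \<open>F t\<close> at \<open>\<gamma> t\<close> such that for \<open>s\<close>
  close to \<open>t\<close> the germs of \<open>F s\<close> and \<open>F t\<close> at \<open>\<gamma> s\<close> agree.\<close>

definition continues_along ::
  "(real \<Rightarrow> complex) \<Rightarrow> (complex \<Rightarrow> complex^'n^'m) \<Rightarrow> (complex \<Rightarrow> complex^'n^'m) \<Rightarrow> bool" where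
  "continues_along \<gamma> Y Z \<longleftrightarrow>
     (\<exists>F :: real \<Rightarrow> complex \<Rightarrow> complex^'n^'m.
        (\<forall>t\<in>{0..1}. \<forall>i j. (\<lambda>w. F t w $ i $ j) analytic_on {\<gamma> t}) \<and>
        (\<forall>t\<in>{0..1}. \<exists>\<delta>>0. \<forall>s\<in>{0..1}. \<bar>s - t\<bar> < \<delta> \<longrightarrow>
            (\<forall>\<^sub>F w in nhds (\<gamma> s). F s w = F t w)) \<and>
        (\<forall>\<^sub>F w in nhds (\<gamma> 0). F 0 w = Y w) \<and>
        (\<forall>\<^sub>F w in nhds (\<gamma> 1). F 1 w = Z w))"

text \<open>The monodromy group with base point \<open>z0\<close>, relative to a fundamental matrix \<open>Y\<close>.\<close>

definition monodromy_group ::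
  "('n::finite \<Rightarrow> complex) \<Rightarrow> complex \<Rightarrow> (complex \<Rightarrow> complex^'n^'n) \<Rightarrow> (complex^'n^'n) set" where
  "monodromy_group lam z0 Y =
     {M. \<exists>\<gamma>. path \<gamma> \<and> pathstart \<gamma> = z0 \<and> pathfinish \<gamma> = z0 \<and> path_image \<gamma> \<subseteq> - range lam \<and>
         continues_along \<gamma> Y (\<lambda>z. Y z ** M)}"

definition GL :: "(complex^'n^'n) monoid" where
  "GL = \<lparr>carrier = {M. invertible M}, monoid.mult = (**), one = mat 1\<rparr>"

end

theory Submission
  imports Defs
begin

text \<open>Near a singular point the system has \<open>n - 1\<close> independent regular solutions (or regular up to a multiple
  of \<open>\<Psi>\<^sub>k ln (z - lam k)\<close>), so every solution on the cut plane is \<open>c \<Psi>\<^sub>k\<^sup>s\<^sup>i\<^sup>n\<^sup>g + reg\<close> near \<open>lam k\<close>, and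
  continuing any solution across the cut \<open>L\<^sub>k\<close> adds a multiple of \<open>\<Psi>\<^sub>k\<close>.  Continuing across all cuts
  far out therefore changes a solution by an element of the span \<open>W\<close> of the \<open>\<Psi>\<^sub>k\<close>.  A solution fixed by this
  continuation is single-valued near infinity, where the singularity is regular, and its leading coefficient
  is an eigenvector of \<open>A\<^sub>1\<close> for an integer eigenvalue.

  If \<open>W\<close> is a proper subspace, continuation minus identity is not surjective, hence not injective, and such
  a solution exists; if \<open>C v = 0\<close>, then \<open>\<Psi> v\<close> crosses every cut unchanged.  Conversely, the largest integer
  eigenvalue gives a single-valued convergent series at infinity; if \<open>C\<close> is invertible, then \<open>\<Psi>\<close> is
  fundamental, the series is \<open>\<Psi> v\<close> with \<open>v \<noteq> 0\<close>, the multiples of the \<open>\<Psi>\<^sub>k\<close> added at the cuts sum to \<open>0\<close>, so they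
  all vanish and \<open>C v = 0\<close>.

  For the monodromy group, a path is followed in balls meeting at most one cut; each passage through a
  cut multiplies the germ of \<open>\<Psi> N\<close> to \<open>\<Psi> M\<^sub>k N\<close> or \<open>\<Psi> M\<^sub>k\<^sup>-\<^sup>1 N\<close>.\<close>

(* With both meanings of $ in scope, parsing time is exponential in its number of occurrences. *)
no_notation fps_nth (infixl \<open>$\<close> 75)

section \<open>Linear systems in the complex domain\<close>

text \<open>The obstacle is that no single kind of local basis serves all diagonal entries of
  \<open>A1\<close>. \<open>Psi k\<close> may vanish identically when the entry is a natural number,
  and a negative integer entry gives the recursion for regular solutions one resonance, which costs
  a logarithm. What follows therefore relies on two facts common to all cases: near
  \<open>lam k\<close> a solution is regular up to a multiple of \<open>Psing k\<close>, and a
  \<open>Psing k\<close> that is not identically zero jumps by \<open>alpha A1 k\<close> times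
  \<open>Psi k\<close>.

  The cuts are parallel, so far out they form a stack of half-lines ordered by height. Continuation
  across all of them is a solution on a half-plane free of singular points, compared with the
  original one below and above the stack; the multiple picked up at a cut depends on those picked up
  at the lower cuts. Continuation rests on existence and uniqueness on convex sets and on the
  identity theorem.

  Regularity of the singularity at infinity is a growth estimate: the coefficients of the system
  decay like \<open>1 / z\<close>, so solutions grow at most like a power of
  \<open>z\<close>.\<close>

definition vec_holomorphic_on :: "(complex \<Rightarrow> complex^'n) \<Rightarrow> complex set \<Rightarrow> bool"
    (infixl \<open>vec'_holomorphic'_on\<close> 50) where
  "f vec_holomorphic_on S \<longleftrightarrow> (\<forall>i. (\<lambda>z. f z $ i) holomorphic_on S)"

lemma vec_holomorphic_on_subset:
  "f vec_holomorphic_on S \<Longrightarrow> T \<subseteq> S \<Longrightarrow> f vec_holomorphic_on T"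
  unfolding vec_holomorphic_on_def using holomorphic_on_subset by blast

lemma vec_holomorphic_on_const: "(\<lambda>z. c) vec_holomorphic_on S"
  unfolding vec_holomorphic_on_def by simp

lemma vec_holomorphic_on_add:
  "f vec_holomorphic_on S \<Longrightarrow> g vec_holomorphic_on S \<Longrightarrow> (\<lambda>z. f z + g z) vec_holomorphic_on S"
  unfolding vec_holomorphic_on_def by (auto intro: holomorphic_intros)

lemma vec_holomorphic_on_diff:
  "f vec_holomorphic_on S \<Longrightarrow> g vec_holomorphic_on S \<Longrightarrow> (\<lambda>z. f z - g z) vec_holomorphic_on S"
  unfolding vec_holomorphic_on_def by (auto intro: holomorphic_intros)

lemma vec_holomorphic_on_scale:
  "f vec_holomorphic_on S \<Longrightarrow> c holomorphic_on S \<Longrightarrow> (\<lambda>z. c z *s f z) vec_holomorphic_on S"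
  unfolding vec_holomorphic_on_def by (auto intro: holomorphic_intros)

lemma vec_holomorphic_on_sum:
  "(\<And>k. k \<in> K \<Longrightarrow> f k vec_holomorphic_on S) \<Longrightarrow> (\<lambda>z. \<Sum>k\<in>K. f k z) vec_holomorphic_on S"
  unfolding vec_holomorphic_on_def by (auto intro: holomorphic_on_sum)

lemmas vec_holomorphic_intros = vec_holomorphic_on_const vec_holomorphic_on_add
  vec_holomorphic_on_diff vec_holomorphic_on_scale vec_holomorphic_on_sum

lemma vec_holomorphic_on_imp_continuous_on:
  "f vec_holomorphic_on S \<Longrightarrow> continuous_on S f"
  unfolding vec_holomorphic_on_def continuous_on_def
  by (metis vec_tendstoI continuous_on_def holomorphic_on_imp_continuous_on)

lemma vec_analytic_continuation:
  fixes f g :: "complex \<Rightarrow> complex^'n"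
  assumes "open W" "W \<noteq> {}" "W \<subseteq> S" "open S" "connected S"
    and "f vec_holomorphic_on S" "g vec_holomorphic_on S"
    and "\<And>z. z \<in> W \<Longrightarrow> f z = g z" and "z \<in> S"
  shows "f z = g z"
proof -
  have "f z $ i = g z $ i" for i
    by (rule analytic_continuation_open[of W S "\<lambda>z. f z $ i" "\<lambda>z. g z $ i"])
      (use assms in \<open>auto simp: vec_holomorphic_on_def\<close>)
  then show ?thesis by (simp add: vec_eq_iff)
qed

lemma continuous_bounded_above_on_compact:
  fixes f :: "'a::topological_space \<Rightarrow> real"
  assumes "compact K" "continuous_on K f"
  obtains M where "\<And>z. z \<in> K \<Longrightarrow> f z \<le> M"
  using continuous_attains_sup[OF assms(1) _ assms(2)] by (cases "K = {}") auto

text \<open>Picard iteration, with primitives on the convex set in place of integrals. Successive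
  iterates differ by at most \<open>M * (L * cmod (z - p)) ^ n / fact n\<close> on compact sets
  star-shaped about \<open>p\<close>; the factorial makes the solution exist on all of
  \<open>U\<close> and not only near \<open>p\<close>.\<close>

lemma linear_ode_exists_on_convex:
  fixes B :: "'n::finite \<Rightarrow> 'n \<Rightarrow> complex \<Rightarrow> complex" and v :: "complex^'n"
  assumes U: "open U" "convex U" and p: "p \<in> U"
    and B: "\<And>i j. B i j holomorphic_on U"
  obtains f :: "complex \<Rightarrow> complex^'n" where "f p = v"
    "\<And>z i. z \<in> U \<Longrightarrow>
       ((\<lambda>w. f w $ i) has_field_derivative (\<Sum>j\<in>UNIV. B i j z * f z $ j)) (at z)"
proof -
  have prim: "\<exists>G. G p = c \<and> (\<forall>z\<in>U. (G has_field_derivative g z) (at z))"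
    if g: "g holomorphic_on U" for g and c :: complex
  proof -
    obtain G where G: "\<And>x. x \<in> U \<Longrightarrow> (G has_field_derivative g x) (at x within U)"
      using holomorphic_convex_primitive'[OF U(2,1) g] by blast
    show ?thesis
    proof (intro exI[of _ "\<lambda>z. G z - G p + c"] conjI ballI)
      fix z assume z: "z \<in> U"
      have "(G has_field_derivative g z) (at z)" using G[OF z] U(1) z by (metis at_within_open)
      then show "((\<lambda>z. G z - G p + c) has_field_derivative g z) (at z)"
        by (auto intro!: derivative_eq_intros)
    qed simp
  qed
  \<comment> \<open>One Picard step: in each component, the primitive of the right-hand side that
    takes the prescribed value at \<open>p\<close>.\<close>
  define step :: "(complex \<Rightarrow> complex^'n) \<Rightarrow> complex \<Rightarrow> complex^'n" where
    "step f = (\<lambda>z. \<chi> i. (SOME G. G p = v $ i \<and>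
       (\<forall>z\<in>U. (G has_field_derivative (\<Sum>j\<in>UNIV. B i j z * f z $ j)) (at z))) z)" for f
  have step: "step f p = v \<and> (\<forall>z\<in>U. \<forall>i. ((\<lambda>w. step f w $ i) has_field_derivative
        (\<Sum>j\<in>UNIV. B i j z * f z $ j)) (at z))" if f: "f vec_holomorphic_on U" for f
  proof -
    have "(\<lambda>z. \<Sum>j\<in>UNIV. B i j z * f z $ j) holomorphic_on U" for i
      using f B unfolding vec_holomorphic_on_def by (auto intro!: holomorphic_intros)
    from someI_ex[OF prim[OF this]] show ?thesis
      unfolding step_def by (auto simp: vec_eq_iff)
  qed
  define F where "F n = (step ^^ n) (\<lambda>_. v)" for n
  have Fhol: "F n vec_holomorphic_on U" for n
  proof (induction n)
    case 0 show ?case by (simp add: F_def vec_holomorphic_on_const)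
  next
    case (Suc n)
    show ?case using step[OF Suc] U(1) unfolding F_def vec_holomorphic_on_def
      by (auto simp: holomorphic_on_open intro: exI)
  qed
  have Fp: "F n p = v" for n
    by (cases n) (use step[OF Fhol] in \<open>auto simp: F_def\<close>)
  have Fd: "((\<lambda>w. F (Suc n) w $ i) has_field_derivative (\<Sum>j\<in>UNIV. B i j z * F n z $ j)) (at z)"
    if "z \<in> U" for n i z
    using step[OF Fhol, of n] that by (auto simp: F_def)
  have Bc: "continuous_on K (B i j)" and Fc: "continuous_on K (\<lambda>z. F n z $ i)"
    if "K \<subseteq> U" for K i j n
    using that B Fhol[of n] holomorphic_on_imp_continuous_on holomorphic_on_subset
    unfolding vec_holomorphic_on_def by blast+
  \<comment> \<open>Star-shapedness is what the induction for \<open>bd\<close> consumes: it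
    integrates the previous bound along the segment from \<open>p\<close> to \<open>z\<close>, which
    has to stay in \<open>K\<close>.\<close>
  have conv: "\<exists>g. \<forall>i. uniform_limit K (\<lambda>n z. F n z $ i) (\<lambda>z. g z $ i) sequentially"
    if K: "compact K" "K \<subseteq> U" and star: "\<And>z. z \<in> K \<Longrightarrow> closed_segment p z \<subseteq> K" for K
  proof -
    have "continuous_on K (\<lambda>z. \<Sum>i\<in>UNIV. \<Sum>j\<in>UNIV. cmod (B i j z))"
      by (intro continuous_intros Bc K(2))
    from continuous_bounded_above_on_compact[OF K(1) this] obtain L0 where L0: "\<And>z. z \<in> K \<Longrightarrow> (\<Sum>i\<in>UNIV. \<Sum>j\<in>UNIV. cmod (B i j z)) \<le> L0"
      by auto
    define L where "L = max L0 0"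
    have L: "L \<ge> 0" "(\<Sum>j\<in>UNIV. cmod (B i j z)) \<le> L" if "z \<in> K" for z i
    proof -
      have "(\<Sum>j\<in>UNIV. cmod (B i j z)) \<le> (\<Sum>i\<in>UNIV. \<Sum>j\<in>UNIV. cmod (B i j z))"
        by (rule member_le_sum) (auto intro: sum_nonneg)
      then show "(\<Sum>j\<in>UNIV. cmod (B i j z)) \<le> L" using L0[OF that] by (simp add: L_def)
    qed (simp add: L_def)
    have "continuous_on K (\<lambda>z. \<Sum>i\<in>UNIV. cmod (F 1 z $ i - F 0 z $ i))"
      by (intro continuous_intros Fc K(2))
    from continuous_bounded_above_on_compact[OF K(1) this] obtain M where M0: "\<And>z. z \<in> K \<Longrightarrow> (\<Sum>i\<in>UNIV. cmod (F 1 z $ i - F 0 z $ i)) \<le> M"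
      by auto
    have M: "cmod (F 1 z $ i - F 0 z $ i) \<le> M" if "z \<in> K" for z i
      using M0[OF that] member_le_sum[of i UNIV "\<lambda>i. cmod (F 1 z $ i - F 0 z $ i)"] by simp
    have bd: "cmod (F (Suc n) z $ i - F n z $ i) \<le> M * (L * cmod (z - p)) ^ n / fact n"
      if "z \<in> K" for n z i
      using that
    proof (induction n arbitrary: z i)
      case 0 then show ?case using M by simp
    next
      case (Suc n)
      have L0: "L \<ge> 0" using L Suc.prems by blast
      define D where "D = cmod (z - p)"
      define w where "w t = p + of_real t * (z - p)" for t
      have wK: "w t \<in> K" if "t \<in> {0..1}" for t
      proof -
        have "w t \<in> closed_segment p z" unfolding closed_segment_def w_def using that
          by (auto simp: algebra_simps scaleR_conv_of_real intro!: exI[of _ t])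
        then show ?thesis using star Suc.prems by blast
      qed
      define g where "g t = F (Suc (Suc n)) (w t) $ i - F (Suc n) (w t) $ i" for t
      define g' where "g' t = (z - p) * (\<Sum>j\<in>UNIV. B i j (w t) * (F (Suc n) (w t) $ j - F n (w t) $ j))" for t
      have gd: "(g has_vector_derivative g' t) (at t)" if "t \<in> {0..1}" for t
      proof -
        have wd: "(w has_vector_derivative (z - p)) (at t)"
          unfolding w_def by (auto intro!: derivative_eq_intros simp: has_vector_derivative_def scaleR_conv_of_real)
        have "((\<lambda>x. F (Suc (Suc n)) x $ i - F (Suc n) x $ i) has_field_derivative
          (\<Sum>j\<in>UNIV. B i j (w t) * F (Suc n) (w t) $ j) - (\<Sum>j\<in>UNIV. B i j (w t) * F n (w t) $ j)) (at (w t))"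
          using wK[OF that] K by (intro DERIV_diff Fd) auto
        from field_vector_diff_chain_at[OF wd this] show ?thesis
          unfolding g_def g'_def comp_def
          by (simp add: sum_subtractf[symmetric] algebra_simps)
      qed
      \<comment> \<open>\<open>\<phi>\<close> is the primitive of the bound \<open>\<phi>'\<close>
        for the derivative of the difference along the segment, so the mean value inequality yields
        the next power and the next factorial.\<close>
      define \<phi> where "\<phi> t = M * (L * D * t) ^ Suc n / fact (Suc n)" for t
      define \<phi>' where "\<phi>' t = M * (L * D) * (L * D * t) ^ n / fact n" for t
      have phid: "(\<phi> has_vector_derivative \<phi>' t) (at t)" for t
      proof -
        have "(\<phi> has_field_derivative (M * (of_nat (Suc n) * (L * D * t) ^ n * (L * D)) / fact (Suc n))) (at t)"
          unfolding \<phi>_def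
          by (auto intro!: derivative_eq_intros simp del: fact_Suc of_nat_Suc power_Suc)
        also have "(M * (of_nat (Suc n) * (L * D * t) ^ n * (L * D)) / fact (Suc n)) = \<phi>' t"
          unfolding \<phi>'_def by (simp add: field_simps del: of_nat_Suc)
        finally show ?thesis by (simp add: has_real_derivative_iff_has_vector_derivative)
      qed
      have bnd: "cmod (g' t) \<le> \<phi>' t" if "0 < t" "t < 1" for t
      proof -
        have tK: "w t \<in> K" using wK that by auto
        have wt: "cmod (w t - p) = D * t" using that by (simp add: w_def D_def norm_mult)
        have "cmod (\<Sum>j\<in>UNIV. B i j (w t) * (F (Suc n) (w t) $ j - F n (w t) $ j))
           \<le> (\<Sum>j\<in>UNIV. cmod (B i j (w t)) * (M * (L * D * t) ^ n / fact n))"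
        proof (intro order_trans[OF norm_sum] sum_mono)
          fix j
          have "cmod (F (Suc n) (w t) $ j - F n (w t) $ j) \<le> M * (L * (D * t)) ^ n / fact n"
            using Suc.IH[OF tK, of j] by (simp only: wt)
          then have "cmod (F (Suc n) (w t) $ j - F n (w t) $ j) \<le> M * (L * D * t) ^ n / fact n"
            by (simp only: mult.assoc)
          then show "cmod (B i j (w t) * (F (Suc n) (w t) $ j - F n (w t) $ j))
              \<le> cmod (B i j (w t)) * (M * (L * D * t) ^ n / fact n)"
            unfolding norm_mult by (rule mult_left_mono) simp
        qed
        also have "\<dots> = (\<Sum>j\<in>UNIV. cmod (B i j (w t))) * (M * (L * D * t) ^ n / fact n)"
          by (rule sum_distrib_right[symmetric])
        also have "\<dots> \<le> L * (M * (L * D * t) ^ n / fact n)"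
        proof (rule mult_right_mono[OF L(2)[OF tK]])
          have "M \<ge> 0" using M[OF tK, of i] norm_ge_zero order_trans by blast
          then show "0 \<le> M * (L * D * t) ^ n / fact n" using that L0 by (simp add: D_def)
        qed
        finally have "cmod (g' t) \<le> D * (L * (M * (L * D * t) ^ n / fact n))"
          unfolding g'_def norm_mult D_def[symmetric] by (rule mult_left_mono) (simp add: D_def)
        then show ?thesis by (simp add: \<phi>'_def mult_ac)
      qed
      have "norm (g 1 - g 0) \<le> \<phi> 1 - \<phi> 0"
      proof (rule differentiable_bound_general)
        show "continuous_on {0..1} g"
          using gd has_vector_derivative_continuous by (intro continuous_at_imp_continuous_on) blast
        show "continuous_on {0..1} \<phi>" using phid
          has_vector_derivative_continuous by (intro continuous_at_imp_continuous_on) blast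
      qed (use gd phid bnd in auto)
      moreover have "g 0 = 0" by (simp add: g_def w_def Fp)
      moreover have "g 1 = F (Suc (Suc n)) z $ i - F (Suc n) z $ i" by (simp add: g_def w_def)
      moreover have "\<phi> 0 = 0" by (simp add: \<phi>_def)
      moreover have "\<phi> 1 = M * (L * D) ^ Suc n / fact (Suc n)" by (simp add: \<phi>_def)
      ultimately show ?case by (simp add: D_def)
    qed
    have "continuous_on K (\<lambda>z. cmod (z - p))"
      by (intro continuous_intros)
    from continuous_bounded_above_on_compact[OF K(1) this] obtain R where R: "\<And>z. z \<in> K \<Longrightarrow> cmod (z - p) \<le> R"
      by auto
    have sm: "summable (\<lambda>n. M * (L * R) ^ n / fact n)"
      using summable_mult[OF summable_exp_generic[of "L * R"], of M]
      by (simp add: field_simps scaleR_conv_of_real)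
    have ul: "uniform_limit K (\<lambda>n z. \<Sum>k<n. F (Suc k) z $ i - F k z $ i)
        (\<lambda>z. \<Sum>k. F (Suc k) z $ i - F k z $ i) sequentially" for i
    proof (rule Weierstrass_m_test[OF _ sm])
      fix n z assume z: "z \<in> K"
      have "M \<ge> 0" using M[OF z] by (meson norm_ge_zero order_trans)
      then show "cmod (F (Suc n) z $ i - F n z $ i) \<le> M * (L * R) ^ n / fact n"
        using bd[OF z, of n i] R[OF z] L(1)[OF z]
        by (elim order_trans) (auto intro!: divide_right_mono mult_left_mono power_mono)
    qed
    show ?thesis
    proof (intro exI[of _ "\<lambda>z. \<chi> i. (\<Sum>k. F (Suc k) z $ i - F k z $ i) + v $ i"] allI)
      fix i
      have "uniform_limit K (\<lambda>n z. (\<Sum>k<n. F (Suc k) z $ i - F k z $ i) + v $ i)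
        (\<lambda>z. (\<Sum>k. F (Suc k) z $ i - F k z $ i) + v $ i) sequentially"
        by (intro uniform_limit_intros ul)
      moreover have "(\<Sum>k<n. F (Suc k) z $ i - F k z $ i) + v $ i = F n z $ i" for n z
        by (subst sum_lessThan_telescope) (simp add: F_def)
      ultimately show "uniform_limit K (\<lambda>n z. F n z $ i)
        (\<lambda>z. (\<chi> i. (\<Sum>k. F (Suc k) z $ i - F k z $ i) + v $ i) $ i) sequentially" by simp
    qed
  qed
  define f :: "complex \<Rightarrow> complex^'n" where "f z = (\<chi> i. lim (\<lambda>n. F n z $ i))" for z
  have nbd: "\<exists>d>0. cball x d \<subseteq> U \<and> (\<forall>i. uniform_limit (cball x d) (\<lambda>n z. F n z $ i) (\<lambda>z. f z $ i) sequentially)"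
    if x: "x \<in> U" for x
  proof -
    obtain d where d: "d > 0" "cball x d \<subseteq> U" using U(1) x open_contains_cball by blast
    \<comment> \<open>The convex hull of \<open>p\<close> and a small closed ball is a compact
      neighbourhood of \<open>x\<close>, star-shaped about \<open>p\<close>, and inside
      \<open>U\<close> by convexity.\<close>
    define K where "K = convex hull (insert p (cball x d))"
    have K: "compact K" "K \<subseteq> U" "cball x d \<subseteq> K"
    proof -
      show "compact K" unfolding K_def by (intro compact_convex_hull compact_insert compact_cball)
      show "K \<subseteq> U" unfolding K_def by (rule hull_minimal) (use d p U in auto)
      show "cball x d \<subseteq> K" unfolding K_def using hull_subset[of "insert p (cball x d)" convex] by auto
    qed
    have pK: "p \<in> K" unfolding K_def by (simp add: hull_inc)
    have star: "closed_segment p z \<subseteq> K" if "z \<in> K" for z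
      using that pK convex_convex_hull unfolding K_def by (metis closed_segment_subset)
    obtain g where g: "\<And>i. uniform_limit K (\<lambda>n z. F n z $ i) (\<lambda>z. g z $ i) sequentially"
      using conv[OF K(1,2) star] by blast
    have "f z = g z" if "z \<in> K" for z
      unfolding f_def vec_eq_iff using limI[OF tendsto_uniform_limitI[OF g that]] by simp
    then have "uniform_limit (cball x d) (\<lambda>n z. F n z $ i) (\<lambda>z. f z $ i) sequentially" for i
    proof -
      have eq: "f z $ i = g z $ i" if "z \<in> cball x d" for z using that K(3) \<open>\<And>z. z \<in> K \<Longrightarrow> f z = g z\<close> by auto
      show ?thesis
        by (rule uniform_limit_cong'[THEN iffD2, OF refl eq uniform_limit_on_subset[OF g K(3)]])
    qed
    then show ?thesis using d by blast
  qed
  have fp: "f p = v" by (simp add: f_def Fp vec_eq_iff)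
  have lim: "(\<lambda>n. F n z $ i) \<longlonglongrightarrow> f z $ i" if "z \<in> U" for z i
  proof -
    from nbd[OF that] obtain d where d: "d > 0"
      "uniform_limit (cball z d) (\<lambda>n z. F n z $ i) (\<lambda>z. f z $ i) sequentially" by blast
    show ?thesis by (rule tendsto_uniform_limitI[OF d(2)]) (use d(1) in simp)
  qed
  have "((\<lambda>w. f w $ i) has_field_derivative (\<Sum>j\<in>UNIV. B i j z * f z $ j)) (at z)"
    if z: "z \<in> U" for z i
  proof -
    have "\<exists>g'. \<forall>x\<in>U. ((\<lambda>w. f w $ i) has_field_derivative g' x) (at x) \<and>
        ((\<lambda>n. (\<Sum>j\<in>UNIV. B i j x * F n x $ j)) \<longlongrightarrow> g' x) sequentially"
    proof (rule has_complex_derivative_uniform_sequence[OF U(1) Fd])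
      fix x assume "x \<in> U"
      from nbd[OF this] obtain d where d: "d > 0" "cball x d \<subseteq> U"
        "uniform_limit (cball x d) (\<lambda>n z. F n z $ i) (\<lambda>z. f z $ i) sequentially" by blast
      have "uniform_limit (cball x d) (\<lambda>n z. F (Suc n) z $ i) (\<lambda>z. f z $ i) sequentially"
        by (rule filterlim_compose[OF d(3) filterlim_Suc])
      with d show "\<exists>d>0. cball x d \<subseteq> U \<and> uniform_limit (cball x d) (\<lambda>n z. F (Suc n) z $ i) (\<lambda>w. f w $ i) sequentially"
        by blast
    qed
    then obtain g' where g': "((\<lambda>w. f w $ i) has_field_derivative g' z) (at z)"
        "(\<lambda>n. (\<Sum>j\<in>UNIV. B i j z * F n z $ j)) \<longlonglongrightarrow> g' z" using z by blast
    have "(\<lambda>n. (\<Sum>j\<in>UNIV. B i j z * F n z $ j)) \<longlonglongrightarrow> (\<Sum>j\<in>UNIV. B i j z * f z $ j)"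
      by (intro tendsto_intros lim z)
    from LIMSEQ_unique[OF g'(2) this] have "g' z = (\<Sum>j\<in>UNIV. B i j z * f z $ j)" .
    with g'(1) show ?thesis by simp
  qed
  then show ?thesis using that fp by blast
qed

section \<open>Solutions of the system\<close>

lemma diagm_minus_mat_mult: "((diagm lam - mat z) *v D) $ i = (lam i - z) * D $ i"
proof -
  have "((diagm lam - mat z) *v D) $ i = (\<Sum>j\<in>UNIV. if j = i then (lam i - z) * D $ j else 0)"
    unfolding matrix_vector_mult_def diagm_def mat_def vec_lambda_beta by (rule sum.cong) auto
  then show ?thesis by simp
qed

lemma is_solution_iff:
  "is_solution lam A1 S f \<longleftrightarrow> (\<forall>z\<in>S. \<exists>D :: complex^'n.
     \<forall>i. ((\<lambda>w. f w $ i) has_field_derivative D $ i) (at z) \<and>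
         (lam i - z) * D $ i = ((A1 + mat 1) *v f z) $ i)"
  unfolding is_solution_def by (simp add: vec_eq_iff diagm_minus_mat_mult all_conj_distrib)

lemma is_solution_iff_derivative:
  assumes "S \<inter> range lam = {}"
  shows "is_solution lam A1 S f \<longleftrightarrow> (\<forall>z\<in>S. \<forall>i.
    ((\<lambda>w. f w $ i) has_field_derivative ((A1 + mat 1) *v f z) $ i / (lam i - z)) (at z))"
    (is "_ \<longleftrightarrow> ?R")
proof
  assume L: "is_solution lam A1 S f"
  show ?R
  proof (intro ballI allI)
    fix z i assume z: "z \<in> S"
    with L obtain D :: "complex^'a" where D: "((\<lambda>w. f w $ i) has_field_derivative D $ i) (at z)"
      "(lam i - z) * D $ i = ((A1 + mat 1) *v f z) $ i"
      unfolding is_solution_iff by blast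
    have "lam i - z \<noteq> 0" using z assms by auto
    with D show "((\<lambda>w. f w $ i) has_field_derivative ((A1 + mat 1) *v f z) $ i / (lam i - z)) (at z)"
      by (metis nonzero_mult_div_cancel_left)
  qed
next
  assume R: ?R
  show "is_solution lam A1 S f"
    unfolding is_solution_iff
  proof
    fix z assume z: "z \<in> S"
    have "lam i - z \<noteq> 0" for i using z assms by auto
    then show "\<exists>D :: complex^'a. \<forall>i. ((\<lambda>w. f w $ i) has_field_derivative D $ i) (at z) \<and>
         (lam i - z) * D $ i = ((A1 + mat 1) *v f z) $ i"
      using R z by (intro exI[of _ "\<chi> i. ((A1 + mat 1) *v f z) $ i / (lam i - z)"]) auto
  qed
qed

lemma is_solution_imp_vec_holomorphic:
  assumes "is_solution lam A1 S f" "open S"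
  shows "f vec_holomorphic_on S"
  unfolding vec_holomorphic_on_def holomorphic_on_open[OF assms(2)]
proof (intro allI ballI)
  fix i z assume "z \<in> S"
  from bspec[OF assms(1)[unfolded is_solution_iff] this]
  show "\<exists>f'. ((\<lambda>z. f z $ i) has_field_derivative f') (at z)" by (elim exE allE[of _ i]) auto
qed

lemma is_solution_subset: "is_solution lam A1 S f \<Longrightarrow> T \<subseteq> S \<Longrightarrow> is_solution lam A1 T f"
  unfolding is_solution_def by (intro ballI, elim bspec, rule subsetD)

text \<open>Solving the system is a local property; this is what allows solutions on overlapping
  open sets to be glued.\<close>

lemma is_solution_cong_local:
  assumes "\<And>z. z \<in> S \<Longrightarrow> \<exists>T g. open T \<and> z \<in> T \<and> is_solution lam A1 T g \<and> (\<forall>w\<in>T. f w = g w)"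
  shows "is_solution lam A1 S f"
  unfolding is_solution_iff
proof
  fix z assume "z \<in> S"
  from assms[OF this] obtain T g where
    T: "open T" "z \<in> T" "is_solution lam A1 T g" "\<And>w. w \<in> T \<Longrightarrow> f w = g w"
    by (elim exE conjE) simp
  then have "\<exists>D :: complex^'a. \<forall>i. ((\<lambda>w. g w $ i) has_field_derivative D $ i) (at z) \<and>
      (lam i - z) * D $ i = ((A1 + mat 1) *v g z) $ i"
    unfolding is_solution_iff by (elim bspec)
  then obtain D :: "complex^'a" where D: "\<And>i. ((\<lambda>w. g w $ i) has_field_derivative D $ i) (at z)"
      "\<And>i. (lam i - z) * D $ i = ((A1 + mat 1) *v g z) $ i"
    by auto
  have "((\<lambda>w. f w $ i) has_field_derivative D $ i) (at z)" for i
    by (rule has_field_derivative_transform_within_open[OF D(1) T(1,2)]) (simp add: T(4))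
  then show "\<exists>D :: complex^'a. \<forall>i. ((\<lambda>w. f w $ i) has_field_derivative D $ i) (at z) \<and>
         (lam i - z) * D $ i = ((A1 + mat 1) *v f z) $ i"
    using D T by auto
qed

lemma is_solution_cong:
  assumes "is_solution lam A1 S g" "open S" "\<And>z. z \<in> S \<Longrightarrow> f z = g z"
  shows "is_solution lam A1 S f"
  by (rule is_solution_cong_local) (use assms in blast)

lemma is_solution_zero: "is_solution lam A1 S (\<lambda>z. 0)"
  unfolding is_solution_iff by (auto intro!: exI[of _ 0] simp: matrix_vector_mult_0_right)

lemma is_solution_add:
  assumes "is_solution lam A1 S f" "is_solution lam A1 S g"
  shows "is_solution lam A1 S (\<lambda>z. f z + g z)"
  unfolding is_solution_iff
proof
  fix z assume z: "z \<in> S"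
  obtain D :: "complex^'a" where D:
    "\<forall>i. ((\<lambda>w. f w $ i) has_field_derivative D $ i) (at z) \<and>
         (lam i - z) * D $ i = ((A1 + mat 1) *v f z) $ i"
    using bspec[OF assms(1)[unfolded is_solution_iff] z] by (elim exE)
  obtain D' :: "complex^'a" where D':
    "\<forall>i. ((\<lambda>w. g w $ i) has_field_derivative D' $ i) (at z) \<and>
         (lam i - z) * D' $ i = ((A1 + mat 1) *v g z) $ i"
    using bspec[OF assms(2)[unfolded is_solution_iff] z] by (elim exE)
  from D D' show "\<exists>D :: complex^'a. \<forall>i. ((\<lambda>w. (f w + g w) $ i) has_field_derivative D $ i) (at z) \<and>
         (lam i - z) * D $ i = ((A1 + mat 1) *v (f z + g z)) $ i"
    by (intro exI[of _ "D + D'"])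
      (auto intro!: DERIV_add simp: matrix_vector_right_distrib distrib_left)
qed

lemma is_solution_scale:
  assumes "is_solution lam A1 S f"
  shows "is_solution lam A1 S (\<lambda>z. c *s f z)"
  unfolding is_solution_iff
proof
  fix z assume z: "z \<in> S"
  obtain D :: "complex^'a" where
    "\<forall>i. ((\<lambda>w. f w $ i) has_field_derivative D $ i) (at z) \<and>
         (lam i - z) * D $ i = ((A1 + mat 1) *v f z) $ i"
    using bspec[OF assms(1)[unfolded is_solution_iff] z] by (elim exE)
  then show "\<exists>D :: complex^'a. \<forall>i. ((\<lambda>w. (c *s f w) $ i) has_field_derivative D $ i) (at z) \<and>
         (lam i - z) * D $ i = ((A1 + mat 1) *v (c *s f z)) $ i"
    by (intro exI[of _ "c *s D"])
      (auto intro!: DERIV_cmult simp: vector_scalar_commute mult.left_commute)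
qed

lemma is_solution_sum:
  "(\<And>k. k \<in> K \<Longrightarrow> is_solution lam A1 S (f k)) \<Longrightarrow> is_solution lam A1 S (\<lambda>z. \<Sum>k\<in>K. f k z)"
  by (induction K rule: infinite_finite_induct) (auto intro: is_solution_zero is_solution_add)

lemma is_solution_diff:
  "is_solution lam A1 S f \<Longrightarrow> is_solution lam A1 S g \<Longrightarrow> is_solution lam A1 S (\<lambda>z. f z - g z)"
  using is_solution_add[of lam A1 S f "\<lambda>z. (-1) *s g z"] is_solution_scale[of lam A1 S g "-1"]
  by (simp add: vector_sneg_minus1[symmetric])

lemma is_solution_matrix_vector_mult:
  assumes "\<And>k. is_solution lam A1 S (\<lambda>z. column k (Y z))"
  shows "is_solution lam A1 S (\<lambda>z. Y z *v v)"
  unfolding matrix_mult_sum by (intro is_solution_sum is_solution_scale assms)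

text \<open>A contraction estimate at a maximum: on a small closed ball let the sum norm
  \<open>N\<close> of \<open>f\<close> be maximal at \<open>z0\<close>. Since
  \<open>f p = 0\<close>, the mean value inequality bounds \<open>N z0\<close> by
  \<open>n * L * e * N z0\<close>, and the factor is less than one.\<close>

lemma is_solution_zero_near:
  assumes f: "is_solution lam A1 S f" and S: "open S" "S \<inter> range lam = {}"
    and p: "p \<in> S" "f p = 0"
  shows "\<exists>e>0. ball p e \<subseteq> S \<and> (\<forall>z\<in>ball p e. f z = 0)"
proof -
  obtain r where r: "r > 0" "cball p r \<subseteq> S" using S(1) p open_contains_cball by blast
  let ?B = "\<lambda>i j z. (A1 + mat 1) $ i $ j / (lam i - z)"
  have nz: "lam i - z \<noteq> 0" if "z \<in> S" for i z using S that by auto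
  have "continuous_on (cball p r) (\<lambda>z. \<Sum>i\<in>UNIV. \<Sum>j\<in>UNIV. cmod (?B i j z))"
    using nz r by (intro continuous_intros) auto
  from continuous_bounded_above_on_compact[OF compact_cball this] obtain L where
    L: "\<And>z. z \<in> cball p r \<Longrightarrow> (\<Sum>i\<in>UNIV. \<Sum>j\<in>UNIV. cmod (?B i j z)) \<le> L" by auto
  have L0: "L \<ge> 0" by (rule order_trans[OF _ L[of p]]) (use r in \<open>auto intro!: sum_nonneg\<close>)
  define N where "N z = (\<Sum>i\<in>UNIV. cmod (f z $ i))" for z
  define n where "n = real CARD('a)"
  \<comment> \<open>The radius is chosen to give \<open>n * L * e < 1\<close>; the added
    \<open>1\<close> keeps the denominator positive when \<open>L = 0\<close>.\<close>
  define e where "e = min r (1 / (n * L + 1))"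
  have n: "n \<ge> 0" by (simp add: n_def)
  have e: "e > 0" "e \<le> r" "n * L * e < 1"
  proof -
    have p: "n * L + 1 > 0" using n L0 by (simp add: add_nonneg_pos)
    then show "e > 0" "e \<le> r" using r by (auto simp: e_def)
    have "n * L * e \<le> n * L * (1 / (n * L + 1))"
      by (intro mult_left_mono) (use n L0 in \<open>auto simp: e_def\<close>)
    also have "\<dots> < 1" using p by (simp add: field_simps)
    finally show "n * L * e < 1" .
  qed
  have sub: "cball p e \<subseteq> S" using e r by auto
  have "continuous_on (cball p e) f"
    using is_solution_imp_vec_holomorphic[OF f S(1)] sub
    by (meson vec_holomorphic_on_imp_continuous_on vec_holomorphic_on_subset)
  then have "continuous_on (cball p e) N"
    unfolding N_def by (intro continuous_intros)
  then obtain z0 where z0: "z0 \<in> cball p e" "\<And>z. z \<in> cball p e \<Longrightarrow> N z \<le> N z0"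
    using continuous_attains_sup[of "cball p e" N] e by auto
  have N0: "N z \<ge> 0" for z unfolding N_def by (intro sum_nonneg) auto
  have "cmod (f z0 $ i) \<le> (L * N z0) * e" for i
  proof -
    have "cmod (f z0 $ i - f p $ i) \<le> (L * N z0) * cmod (z0 - p)"
    proof (rule field_differentiable_bound[where S = "cball p e"])
      fix z assume z: "z \<in> cball p e"
      then show "((\<lambda>z. f z $ i) has_field_derivative ((A1 + mat 1) *v f z) $ i / (lam i - z)) (at z within cball p e)"
        using f sub unfolding is_solution_iff_derivative[OF S(2)]
        by (blast intro: has_field_derivative_at_within)
      have "((A1 + mat 1) *v f z) $ i / (lam i - z) = (\<Sum>j\<in>UNIV. ?B i j z * f z $ j)"
        by (simp add: matrix_vector_mult_def sum_divide_distrib)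
      also have "cmod \<dots> \<le> (\<Sum>j\<in>UNIV. cmod (?B i j z) * N z)"
      proof (intro order_trans[OF norm_sum] sum_mono)
        fix j
        have "cmod (f z $ j) \<le> N z" unfolding N_def by (rule member_le_sum) auto
        then show "cmod (?B i j z * f z $ j) \<le> cmod (?B i j z) * N z"
          unfolding norm_mult by (rule mult_left_mono) simp
      qed
      also have "\<dots> = (\<Sum>j\<in>UNIV. cmod (?B i j z)) * N z" by (rule sum_distrib_right[symmetric])
      also have "\<dots> \<le> L * N z0"
      proof (rule mult_mono)
        have "(\<Sum>j\<in>UNIV. cmod (?B i j z)) \<le> (\<Sum>i\<in>UNIV. \<Sum>j\<in>UNIV. cmod (?B i j z))"
          by (rule member_le_sum) (auto intro: sum_nonneg)
        then show "(\<Sum>j\<in>UNIV. cmod (?B i j z)) \<le> L" using L[of z] z e by auto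
      qed (use z0 z L0 N0 in auto)
      finally show "cmod (((A1 + mat 1) *v f z) $ i / (lam i - z)) \<le> L * N z0" .
    qed (use z0 e in auto)
    also have "\<dots> \<le> (L * N z0) * e"
      using z0 L0 N0 by (intro mult_left_mono) (auto simp: dist_norm norm_minus_commute)
    finally show ?thesis using p by simp
  qed
  then have "N z0 \<le> (\<Sum>i\<in>(UNIV::'a set). (L * N z0) * e)"
    unfolding N_def[of z0] by (intro sum_mono) (simp add: N_def)
  also have "\<dots> = (n * L * e) * N z0" by (simp add: n_def)
  finally have "(1 - n * L * e) * N z0 \<le> 0" by (simp add: algebra_simps)
  then have "N z0 \<le> 0" using e by (simp add: mult_le_0_iff)
  then have "f z = 0" if "z \<in> ball p e" for z
  proof -
    have "N z \<le> 0" using z0(2)[of z] that \<open>N z0 \<le> 0\<close> by auto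
    then have "N z = 0" using N0[of z] by simp
    then show ?thesis unfolding N_def by (subst (asm) sum_nonneg_eq_0_iff) (auto simp: vec_eq_iff)
  qed
  then show ?thesis using e sub by (intro exI[of _ e]) auto
qed

lemma is_solution_unique:
  assumes f: "is_solution lam A1 S f" and g: "is_solution lam A1 S g"
    and S: "open S" "connected S" "S \<inter> range lam = {}"
    and p: "p \<in> S" "f p = g p" and z: "z \<in> S"
  shows "f z = g z"
proof -
  obtain e where e: "e > 0" "ball p e \<subseteq> S" "\<And>z. z \<in> ball p e \<Longrightarrow> f z - g z = 0"
    using is_solution_zero_near[OF is_solution_diff[OF f g] S(1,3) p(1)] p by auto
  show ?thesis
    by (rule vec_analytic_continuation[where W = "ball p e" and S = S])
      (use e S z f g is_solution_imp_vec_holomorphic in auto)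
qed

text \<open>Convexity of both domains is asked for because it makes their intersection connected;
  agreement at one common point then spreads over all of it.\<close>

lemma is_solution_unique_Int:
  assumes f: "is_solution lam A1 S f" and g: "is_solution lam A1 T g"
    and S: "open S" "convex S" "S \<inter> range lam = {}" and T: "open T" "convex T"
    and p: "p \<in> S" "p \<in> T" "f p = g p" and z: "z \<in> S" "z \<in> T"
  shows "f z = g z"
proof (rule is_solution_unique[of lam A1 "S \<inter> T" f g p])
  show "connected (S \<inter> T)" by (intro convex_connected convex_Int S T)
  show "is_solution lam A1 (S \<inter> T) f" by (rule is_solution_subset[OF f]) blast
  show "is_solution lam A1 (S \<inter> T) g" by (rule is_solution_subset[OF g]) blast
qed (use assms in auto)

lemma is_solution_exists_on_convex:
  assumes "open U" "convex U" "U \<inter> range lam = {}" "p \<in> U"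
  obtains f where "is_solution lam A1 U f" "f p = v"
proof -
  let ?B = "\<lambda>i j z. (A1 + mat 1) $ i $ j / (lam i - z)"
  have B: "?B i j holomorphic_on U" for i j
    using assms(3) by (intro holomorphic_intros) auto
  obtain f where f: "f p = v"
    "\<And>z i. z \<in> U \<Longrightarrow> ((\<lambda>w. f w $ i) has_field_derivative (\<Sum>j\<in>UNIV. ?B i j z * f z $ j)) (at z)"
    using that by (rule linear_ode_exists_on_convex[OF assms(1,2,4), of ?B v, OF B])
  have "is_solution lam A1 U f"
    unfolding is_solution_iff_derivative[OF assms(3)]
    using f(2) by (simp add: matrix_vector_mult_def sum_divide_distrib)
  then show ?thesis using that f by blast
qed

section \<open>Geometry of the cut plane\<close>

text \<open>Coordinates along and across the direction \<open>\<eta>\<close> of the cuts: every cut is a half-line on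
  which \<open>yc\<close> is constant and \<open>xc\<close> is bounded below.\<close>

definition xc :: "real \<Rightarrow> complex \<Rightarrow> real" where "xc \<eta> z = inner (cis \<eta>) z"
definition yc :: "real \<Rightarrow> complex \<Rightarrow> real" where "yc \<eta> z = inner (\<i> * cis \<eta>) z"

lemma xc_add: "xc \<eta> (z + w) = xc \<eta> z + xc \<eta> w" and yc_add: "yc \<eta> (z + w) = yc \<eta> z + yc \<eta> w"
  and xc_diff: "xc \<eta> (z - w) = xc \<eta> z - xc \<eta> w" and yc_diff: "yc \<eta> (z - w) = yc \<eta> z - yc \<eta> w"
  by (simp_all add: xc_def yc_def inner_add inner_diff)

lemma xc_polar: "xc \<eta> (of_real s * cis \<eta> + of_real t * (\<i> * cis \<eta>)) = s"
  and yc_polar: "yc \<eta> (of_real s * cis \<eta> + of_real t * (\<i> * cis \<eta>)) = t"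
proof -
  have sc: "cos \<eta> * cos \<eta> + sin \<eta> * sin \<eta> = 1"
    using sin_cos_squared_add[of \<eta>] by (simp add: power2_eq_square)
  let ?z = "of_real s * cis \<eta> + of_real t * (\<i> * cis \<eta>)"
  have z: "Re ?z = s * cos \<eta> - t * sin \<eta>" "Im ?z = s * sin \<eta> + t * cos \<eta>" by simp_all
  have "xc \<eta> ?z = cos \<eta> * (s * cos \<eta> - t * sin \<eta>) + sin \<eta> * (s * sin \<eta> + t * cos \<eta>)"
    unfolding xc_def inner_complex_def z by simp
  also have "\<dots> = s * (cos \<eta> * cos \<eta> + sin \<eta> * sin \<eta>)" by algebra
  finally show "xc \<eta> ?z = s" by (simp only: sc mult_1_right)
  have "yc \<eta> ?z = - sin \<eta> * (s * cos \<eta> - t * sin \<eta>) + cos \<eta> * (s * sin \<eta> + t * cos \<eta>)"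
    unfolding yc_def inner_complex_def z by simp
  also have "\<dots> = t * (cos \<eta> * cos \<eta> + sin \<eta> * sin \<eta>)" by algebra
  finally show "yc \<eta> ?z = t" by (simp only: sc mult_1_right)
qed

lemma polar_coordinates: "of_real (xc \<eta> z) * cis \<eta> + of_real (yc \<eta> z) * (\<i> * cis \<eta>) = z"
proof -
  have sc: "cos \<eta> * cos \<eta> + sin \<eta> * sin \<eta> = 1"
    using sin_cos_squared_add[of \<eta>] by (simp add: power2_eq_square)
  have x: "xc \<eta> z = cos \<eta> * Re z + sin \<eta> * Im z" and y: "yc \<eta> z = cos \<eta> * Im z - sin \<eta> * Re z"
    by (simp_all add: xc_def yc_def inner_complex_def)
  have "(cos \<eta> * Re z + sin \<eta> * Im z) * cos \<eta> - (cos \<eta> * Im z - sin \<eta> * Re z) * sin \<eta> = Re z"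
    "(cos \<eta> * Re z + sin \<eta> * Im z) * sin \<eta> + (cos \<eta> * Im z - sin \<eta> * Re z) * cos \<eta> = Im z"
    using sc by algebra+
  then show ?thesis by (simp add: complex_eq_iff x y)
qed

lemma xc_of_real_cis: "xc \<eta> (of_real s * cis \<eta>) = s" and yc_of_real_cis: "yc \<eta> (of_real s * cis \<eta>) = 0"
  using xc_polar[of \<eta> s 0] yc_polar[of \<eta> s 0] by simp_all

lemma mult_cis_uminus: "z * cis (- \<eta>) = Complex (xc \<eta> z) (yc \<eta> z)"
  by (simp add: complex_eq_iff xc_def yc_def inner_complex_def)

lemma xc_yc_eqI: "xc \<eta> z = xc \<eta> w \<Longrightarrow> yc \<eta> z = yc \<eta> w \<Longrightarrow> z = w"
  by (metis polar_coordinates)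

lemma abs_xc_le: "\<bar>xc \<eta> z\<bar> \<le> norm z" and abs_yc_le: "\<bar>yc \<eta> z\<bar> \<le> norm z"
  using Cauchy_Schwarz_ineq2[of "cis \<eta>" z] Cauchy_Schwarz_ineq2[of "\<i> * cis \<eta>" z]
  by (simp_all add: xc_def yc_def norm_mult)

lemma norm_le_xc_yc: "norm z \<le> \<bar>xc \<eta> z\<bar> + \<bar>yc \<eta> z\<bar>"
proof -
  have "norm z = norm (of_real (xc \<eta> z) * cis \<eta> + of_real (yc \<eta> z) * (\<i> * cis \<eta>))"
    by (simp add: polar_coordinates)
  also have "\<dots> \<le> \<bar>xc \<eta> z\<bar> + \<bar>yc \<eta> z\<bar>"
    by (rule order_trans[OF norm_triangle_ineq]) (simp add: norm_mult)
  finally show ?thesis .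
qed

lemma open_convex_halfplanes:
  "open {z. xc \<eta> z < b}" "convex {z. xc \<eta> z < b}" "open {z. b < xc \<eta> z}" "convex {z. b < xc \<eta> z}"
  "open {z. yc \<eta> z < b}" "convex {z. yc \<eta> z < b}" "open {z. b < yc \<eta> z}" "convex {z. b < yc \<eta> z}"
  unfolding xc_def yc_def
  by (auto simp: open_halfspace_lt open_halfspace_gt convex_halfspace_lt convex_halfspace_gt)

lemma mem_cut_ray_iff: "z \<in> cut_ray a \<eta> \<longleftrightarrow> yc \<eta> z = yc \<eta> a \<and> xc \<eta> a \<le> xc \<eta> z"
proof
  assume "z \<in> cut_ray a \<eta>"
  then show "yc \<eta> z = yc \<eta> a \<and> xc \<eta> a \<le> xc \<eta> z"
    unfolding cut_ray_def by (auto simp: xc_add yc_add xc_of_real_cis yc_of_real_cis)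
next
  assume z: "yc \<eta> z = yc \<eta> a \<and> xc \<eta> a \<le> xc \<eta> z"
  have "z = a + of_real (xc \<eta> z - xc \<eta> a) * cis \<eta>"
    using z by (intro xc_yc_eqI[of \<eta>]) (simp_all add: xc_add yc_add xc_of_real_cis yc_of_real_cis del: of_real_diff)
  then show "z \<in> cut_ray a \<eta>" unfolding cut_ray_def using z by fastforce
qed

lemma mem_cut_plane_iff:
  "z \<in> cut_plane lam \<eta> \<longleftrightarrow> (\<forall>k. yc \<eta> z = yc \<eta> (lam k) \<longrightarrow> xc \<eta> z < xc \<eta> (lam k))"
  unfolding cut_plane_def by (auto simp: mem_cut_ray_iff not_le)

text \<open>Two points on the same level differ by a positive multiple of \<open>cis \<eta>\<close>
  in one of the two orders, and then \<open>\<eta>\<close> is the argument of that difference modulo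
  \<open>2 * pi\<close>.\<close>

lemma admissible_yc_neq:
  assumes "inj lam" "admissible lam \<eta>" "j \<noteq> k"
  shows "yc \<eta> (lam j) \<noteq> yc \<eta> (lam k)"
proof
  assume eq: "yc \<eta> (lam j) = yc \<eta> (lam k)"
  have *: False if jk: "j \<noteq> k" and eq: "yc \<eta> (lam j) = yc \<eta> (lam k)"
    and le: "xc \<eta> (lam k) \<le> xc \<eta> (lam j)" for j k
  proof -
    define t where "t = xc \<eta> (lam j) - xc \<eta> (lam k)"
    define w where "w = lam j - lam k"
    have w: "w = of_real t * cis \<eta>"
      by (intro xc_yc_eqI[of \<eta>]) (simp_all add: eq t_def w_def xc_diff yc_diff xc_of_real_cis yc_of_real_cis del: of_real_diff)
    have "w \<noteq> 0" using jk assms(1) by (auto simp: w_def inj_def)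
    with w le have t: "t > 0" by (auto simp: t_def)
    have "cis (Arg w) = sgn w" using cis_Arg[OF \<open>w \<noteq> 0\<close>] .
    also have "\<dots> = cis \<eta>" using t by (simp add: w sgn_eq norm_mult)
    finally have "sin \<eta> = sin (Arg w)" "cos \<eta> = cos (Arg w)"
      by (simp_all add: complex_eq_iff)
    then have "\<exists>n::int. \<eta> = Arg w + 2 * pi * n"
      using sin_cos_eq_iff[of \<eta> "Arg w"] by simp
    then show False using assms(2) jk unfolding admissible_def w_def by blast
  qed
  from *[of j k] *[of k j] assms(3) eq show False by force
qed

section \<open>Convex strips in the cut plane and global existence of solutions\<close>

locale cut_system =
  fixes lam :: "'n::finite \<Rightarrow> complex" and A1 :: "complex^'n^'n" and \<eta> :: real
  assumes inj_lam: "inj lam" and admissible: "admissible lam \<eta>"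
begin

lemma yc_lam_neq: "j \<noteq> k \<Longrightarrow> yc \<eta> (lam j) \<noteq> yc \<eta> (lam k)"
  using admissible_yc_neq inj_lam admissible by metis

lemma cut_plane_disjoint: "cut_plane lam \<eta> \<inter> range lam = {}"
  by (auto simp: mem_cut_plane_iff)

text \<open>A convex neighbourhood of \<open>z\<close> that is unbounded to the left. With each
  point the cut plane contains such a strip, because cuts only run to the right; all strips reach
  the half-plane to the left of every singular point, which serves as a common base.\<close>

definition tube :: "real \<Rightarrow> complex \<Rightarrow> complex set" where
  "tube e z = {w. yc \<eta> w < yc \<eta> z + e} \<inter> {w. yc \<eta> z - e < yc \<eta> w} \<inter> {w. xc \<eta> w < xc \<eta> z + e}"

lemma tube_open_convex: "open (tube e z)" "convex (tube e z)"
  unfolding tube_def by (intro open_Int open_convex_halfplanes convex_Int)+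

lemma mem_tube: "e > 0 \<Longrightarrow> z \<in> tube e z"
  by (simp add: tube_def)

lemma tube_meets_left:
  assumes "yc \<eta> w1 \<in> {yc \<eta> z1 - e1<..<yc \<eta> z1 + e1} " "yc \<eta> w1 \<in> {yc \<eta> z2 - e2<..<yc \<eta> z2 + e2}"
  shows "\<exists>w. w \<in> tube e1 z1 \<inter> tube e2 z2 \<and> xc \<eta> w < b"
proof -
  define s where "s = min (min (xc \<eta> z1 + e1) (xc \<eta> z2 + e2)) b - 1"
  have s: "s < xc \<eta> z1 + e1" "s < xc \<eta> z2 + e2" "s < b" by (auto simp: s_def)
  show ?thesis
    by (rule exI[of _ "of_real s * cis \<eta> + of_real (yc \<eta> w1) * (\<i> * cis \<eta>)"])
      (use assms s in \<open>auto simp: tube_def xc_polar yc_polar\<close>)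
qed

lemma tube_subset_cut_plane:
  assumes "z \<in> cut_plane lam \<eta>"
  obtains e where "e > 0" "tube e z \<subseteq> cut_plane lam \<eta>"
proof -
  \<comment> \<open>The room left by each cut: the horizontal distance to its tip if the cut lies on
    the line through \<open>z\<close>, and the vertical distance otherwise.\<close>
  define d where "d k = (if yc \<eta> z = yc \<eta> (lam k) then xc \<eta> (lam k) - xc \<eta> z
      else \<bar>yc \<eta> z - yc \<eta> (lam k)\<bar>)" for k
  define e where "e = Min (range d)"
  have d: "d k > 0" for k using assms by (auto simp: d_def mem_cut_plane_iff)
  have e: "e \<le> d k" for k by (simp add: e_def)
  have "e > 0" using d by (simp add: e_def)
  moreover have "tube e z \<subseteq> cut_plane lam \<eta>"
  proof
    fix w assume w: "w \<in> tube e z"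
    show "w \<in> cut_plane lam \<eta>"
      unfolding mem_cut_plane_iff
    proof (intro allI impI)
      fix k assume "yc \<eta> w = yc \<eta> (lam k)"
      then show "xc \<eta> w < xc \<eta> (lam k)"
        using w e[of k] unfolding tube_def d_def by (auto split: if_splits)
    qed
  qed
  ultimately show ?thesis using that by blast
qed

definition tube_radius :: "complex \<Rightarrow> real" where
  "tube_radius z = (SOME e. e > 0 \<and> tube e z \<subseteq> cut_plane lam \<eta>)"

lemma tube_radius:
  assumes "z \<in> cut_plane lam \<eta>"
  shows "tube_radius z > 0" "tube (tube_radius z) z \<subseteq> cut_plane lam \<eta>"
proof -
  have "\<exists>e. e > 0 \<and> tube e z \<subseteq> cut_plane lam \<eta>"
    using tube_subset_cut_plane[OF assms] by blast
  from someI_ex[OF this] show "tube_radius z > 0" "tube (tube_radius z) z \<subseteq> cut_plane lam \<eta>"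
    unfolding tube_radius_def by auto
qed

lemma open_cut_plane: "open (cut_plane lam \<eta>)"
proof (subst open_subopen, intro ballI)
  fix z assume z: "z \<in> cut_plane lam \<eta>"
  show "\<exists>T. open T \<and> z \<in> T \<and> T \<subseteq> cut_plane lam \<eta>"
    by (intro exI[of _ "tube (tube_radius z) z"] conjI tube_open_convex mem_tube tube_radius z)
qed

definition xmin :: real where "xmin = Min (range (\<lambda>k. xc \<eta> (lam k)))"

lemma left_halfplane_subset: "{z. xc \<eta> z < xmin} \<subseteq> cut_plane lam \<eta>"
  by (auto simp: mem_cut_plane_iff xmin_def)

lemma tube_Int_tube_meets_left:
  assumes "w \<in> tube e z" "w \<in> tube e' z'"
  obtains u where "u \<in> tube e z" "u \<in> tube e' z'" "xc \<eta> u < xmin"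
  using tube_meets_left[of w z e z' e' xmin] assms unfolding tube_def by auto

lemma connected_cut_plane: "connected (cut_plane lam \<eta>)"
proof -
  let ?T = "\<lambda>z. tube (tube_radius z) z \<union> {w. xc \<eta> w < xmin}"
  have "connected (\<Union>z\<in>cut_plane lam \<eta>. ?T z)"
  proof (rule connected_Union)
    fix S assume "S \<in> ?T ` cut_plane lam \<eta>"
    then obtain z where z: "z \<in> cut_plane lam \<eta>" "S = ?T z" by blast
    obtain u where "u \<in> tube (tube_radius z) z" "xc \<eta> u < xmin"
      using tube_Int_tube_meets_left mem_tube[OF tube_radius(1)[OF z(1)]] by metis
    then show "connected S" unfolding z
      by (intro connected_Un convex_connected tube_open_convex open_convex_halfplanes) auto
  next
    have "of_real (xmin - 1) * cis \<eta> \<in> {w. xc \<eta> w < xmin}" by (simp add: xc_of_real_cis del: of_real_diff)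
    then show "\<Inter> (?T ` cut_plane lam \<eta>) \<noteq> {}" by blast
  qed
  moreover have "(\<Union>z\<in>cut_plane lam \<eta>. ?T z) = cut_plane lam \<eta>"
  proof (rule equalityI)
    show "(\<Union>z\<in>cut_plane lam \<eta>. ?T z) \<subseteq> cut_plane lam \<eta>"
      using tube_radius(2) left_halfplane_subset by (intro UN_least Un_least)
    show "cut_plane lam \<eta> \<subseteq> (\<Union>z\<in>cut_plane lam \<eta>. ?T z)"
      using mem_tube[OF tube_radius(1)] by (intro subsetI UN_I UnI1)
  qed
  ultimately show ?thesis by simp
qed

text \<open>This replaces a monodromy argument on the simply connected cut plane. In every tube the
  system is solved with data taken from \<open>g\<close>; two tubes sharing a point also meet in the
  left half-plane, where both solutions equal \<open>g\<close>, so they agree wherever both are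
  defined.\<close>

lemma is_solution_extends_from_left:
  assumes g: "is_solution lam A1 {z. xc \<eta> z < xmin} g"
  obtains f where "is_solution lam A1 (cut_plane lam \<eta>) f" "\<And>z. xc \<eta> z < xmin \<Longrightarrow> f z = g z"
proof -
  let ?H = "{z. xc \<eta> z < xmin}" and ?T = "\<lambda>z. tube (tube_radius z) z"
  have disj: "S \<inter> range lam = {}" if "S \<subseteq> cut_plane lam \<eta>" for S
    using that cut_plane_disjoint by auto
  have "\<exists>h. is_solution lam A1 (?T z) h \<and> (\<forall>w\<in>?T z \<inter> ?H. h w = g w)" if z: "z \<in> cut_plane lam \<eta>" for z
  proof -
    obtain u where u: "u \<in> ?T z" "xc \<eta> u < xmin"
      using tube_Int_tube_meets_left mem_tube[OF tube_radius(1)[OF z]] by metis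
    obtain h where h: "is_solution lam A1 (?T z) h" "h u = g u"
      using is_solution_exists_on_convex[OF tube_open_convex disj[OF tube_radius(2)[OF z]] u(1)] by blast
    have "h w = g w" if "w \<in> ?T z \<inter> ?H" for w
      by (rule is_solution_unique_Int[OF h(1) g tube_open_convex disj[OF tube_radius(2)[OF z]]
            open_convex_halfplanes(1,2), of u]) (use u h that in auto)
    then show ?thesis using h by blast
  qed
  then obtain h where h: "\<And>z. z \<in> cut_plane lam \<eta> \<Longrightarrow> is_solution lam A1 (?T z) (h z)"
    "\<And>z w. z \<in> cut_plane lam \<eta> \<Longrightarrow> w \<in> ?T z \<inter> ?H \<Longrightarrow> h z w = g w" by metis
  \<comment> \<open>Each point uses the solution of its own tube; \<open>fh\<close> shows that any
    other tube containing the point gives the same value.\<close>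
  define f where "f z = h z z" for z
  have fh: "f w = h z w" if z: "z \<in> cut_plane lam \<eta>" and w: "w \<in> ?T z" for w z
  proof -
    have wP: "w \<in> cut_plane lam \<eta>" using tube_radius(2)[OF z] w by blast
    have ww: "w \<in> ?T w" using mem_tube[OF tube_radius(1)[OF wP]] .
    obtain u where u: "u \<in> ?T w" "u \<in> ?T z" "xc \<eta> u < xmin"
      using tube_Int_tube_meets_left[OF ww w] by blast
    have "h w w = h z w"
      by (rule is_solution_unique_Int[OF h(1)[OF wP] h(1)[OF z] tube_open_convex
            disj[OF tube_radius(2)[OF wP]] tube_open_convex u(1,2)])
        (use h(2)[OF wP, of u] h(2)[OF z, of u] u w ww in auto)
    then show ?thesis by (simp add: f_def)
  qed
  show ?thesis
  proof (rule that)
    show "is_solution lam A1 (cut_plane lam \<eta>) f"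
    proof (rule is_solution_cong_local)
      fix z assume z: "z \<in> cut_plane lam \<eta>"
      show "\<exists>T g. open T \<and> z \<in> T \<and> is_solution lam A1 T g \<and> (\<forall>w\<in>T. f w = g w)"
        by (rule exI[of _ "?T z"], rule exI[of _ "h z"])
          (use h(1)[OF z] fh[OF z] tube_open_convex mem_tube[OF tube_radius(1)[OF z]] in auto)
    qed
  next
    fix z assume z: "xc \<eta> z < xmin"
    then have zP: "z \<in> cut_plane lam \<eta>" using left_halfplane_subset by auto
    show "f z = g z"
      unfolding f_def using h(2)[OF zP, of z] z mem_tube[OF tube_radius(1)[OF zP]] by auto
  qed
qed

text \<open>The value at \<open>p\<close> is transported to the left half-plane inside the tube of
  \<open>p\<close>, and the resulting solution is extended back from there.\<close>

lemma is_solution_exists: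
  assumes p: "p \<in> cut_plane lam \<eta>"
  obtains f where "is_solution lam A1 (cut_plane lam \<eta>) f" "f p = v"
proof -
  let ?H = "{z. xc \<eta> z < xmin}" and ?T = "tube (tube_radius p) p"
  have disj: "?T \<inter> range lam = {}" "?H \<inter> range lam = {}"
    using tube_radius[OF p] left_halfplane_subset cut_plane_disjoint by blast+
  obtain u where u: "u \<in> ?T" "xc \<eta> u < xmin"
    using tube_Int_tube_meets_left mem_tube[OF tube_radius(1)[OF p]] by metis
  have pT: "p \<in> ?T" using mem_tube[OF tube_radius(1)[OF p]] .
  obtain h where h: "is_solution lam A1 ?T h" "h p = v"
    using is_solution_exists_on_convex[OF tube_open_convex disj(1) pT] by blast
  have uH: "u \<in> ?H" using u by simp
  obtain g where g: "is_solution lam A1 ?H g" "g u = h u"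
    using is_solution_exists_on_convex[OF open_convex_halfplanes(1,2) disj(2) uH] by blast
  obtain f where f: "is_solution lam A1 (cut_plane lam \<eta>) f" "\<And>z. xc \<eta> z < xmin \<Longrightarrow> f z = g z"
    using is_solution_extends_from_left[OF g(1)] by blast
  have "f p = h p"
    by (rule is_solution_unique_Int[OF is_solution_subset[OF f(1) tube_radius(2)[OF p]] h(1)
          tube_open_convex disj(1) tube_open_convex u(1) u(1)]) (use u g f pT in auto)
  then show ?thesis using that f h by simp
qed

end

section \<open>Power series\<close>

definition powser :: "(nat \<Rightarrow> complex) \<Rightarrow> complex \<Rightarrow> complex" where
  "powser c x = (\<Sum>n. c n * x ^ n)"

text \<open>A form of positive radius of convergence, uniform over the components, that can be
  carried through a recursion by induction.\<close>

definition geometric_bound :: "(nat \<Rightarrow> complex^'n) \<Rightarrow> bool" where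
  "geometric_bound b \<longleftrightarrow> (\<exists>K \<rho>. \<rho> > 0 \<and> (\<forall>l i. cmod (b l $ i) \<le> K * \<rho> ^ l))"

lemma powser_sums:
  assumes c: "\<And>l. cmod (c l) \<le> K * \<rho> ^ l" and "\<rho> > 0" and x: "cmod x < 1 / \<rho>"
  shows "(\<lambda>l. c l * x ^ l) sums powser c x"
proof -
  have "summable (\<lambda>l. K * (\<rho> * cmod x) ^ l)"
    using assms(2) x by (intro summable_mult summable_geometric) (simp add: abs_mult field_simps)
  moreover have "cmod (c l * x ^ l) \<le> K * (\<rho> * cmod x) ^ l" for l
    using mult_right_mono[OF c[of l], of "cmod x ^ l"]
    by (simp add: norm_mult norm_power power_mult_distrib mult.assoc)
  ultimately have "summable (\<lambda>l. c l * x ^ l)"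
    by (rule summable_comparison_test'[where N = 0])
  then show ?thesis unfolding powser_def by (rule summable_sums)
qed

lemma powser_derivative:
  assumes c: "\<And>l. cmod (c l) \<le> K * \<rho> ^ l" and "\<rho> > 0" and x: "cmod x < 1 / \<rho>"
  obtains d where "(powser c has_field_derivative d) (at x)"
    "(\<lambda>l. of_nat (Suc l) * c (Suc l) * x ^ l) sums d"
    "(\<lambda>l. of_nat l * c l * x ^ l) sums (x * d)"
proof -
  have sm: "summable (\<lambda>n. c n * z ^ n)" if "norm z < 1 / \<rho>" for z
    using powser_sums[OF c assms(2) that] by (rule sums_summable)
  have d: "((\<lambda>z. \<Sum>n. c n * z ^ n) has_field_derivative (\<Sum>n. diffs c n * x ^ n)) (at x)"
    by (rule termdiffs_strong'[OF sm x])
  have "summable (\<lambda>n. diffs c n * x ^ n)"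
    by (rule termdiff_converges[OF x sm])
  then have s: "(\<lambda>n. diffs c n * x ^ n) sums (\<Sum>n. diffs c n * x ^ n)" by (rule summable_sums)
  have "(\<lambda>n. x * (diffs c n * x ^ n)) sums (x * (\<Sum>n. diffs c n * x ^ n))"
    by (rule sums_mult[OF s])
  then have "(\<lambda>n. (\<lambda>l. of_nat l * c l * x ^ l) (Suc n)) sums (x * (\<Sum>n. diffs c n * x ^ n))"
    by (simp add: diffs_def mult_ac)
  then have "(\<lambda>l. of_nat l * c l * x ^ l) sums (x * (\<Sum>n. diffs c n * x ^ n))"
    by (subst (asm) sums_Suc_iff) simp
  with that d s show ?thesis unfolding powser_def[abs_def] by (simp add: diffs_def)
qed

lemma powser_0: "powser c 0 = c 0"
  unfolding powser_def using powser_zero[of c] by simp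

lemma geometric_bound_joint:
  fixes b g :: "nat \<Rightarrow> complex^'n"
  assumes "geometric_bound b" "geometric_bound g"
  obtains K \<rho> where "\<rho> > 0" "\<And>l i. cmod (b l $ i) \<le> K * \<rho> ^ l" "\<And>l i. cmod (g l $ i) \<le> K * \<rho> ^ l"
proof -
  from assms obtain K \<rho> K' \<rho>' where b: "\<rho> > 0" "\<And>l i. cmod (b l $ i) \<le> K * \<rho> ^ l"
    "\<rho>' > 0" "\<And>l i. cmod (g l $ i) \<le> K' * \<rho>' ^ l"
    unfolding geometric_bound_def by auto
  have m: "K1 * r1 ^ l \<le> (\<bar>K\<bar> + \<bar>K'\<bar>) * (\<rho> + \<rho>') ^ l"
    if "K1 \<le> \<bar>K\<bar> + \<bar>K'\<bar>" "0 \<le> r1" "r1 \<le> \<rho> + \<rho>'" for K1 r1 l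
    using that by (intro mult_mono power_mono) auto
  show ?thesis
  proof (rule that)
    show "\<rho> + \<rho>' > 0" using b by simp
    fix l i
    show "cmod (b l $ i) \<le> (\<bar>K\<bar> + \<bar>K'\<bar>) * (\<rho> + \<rho>') ^ l"
      by (rule order_trans[OF b(2) m]) (use b in auto)
    show "cmod (g l $ i) \<le> (\<bar>K\<bar> + \<bar>K'\<bar>) * (\<rho> + \<rho>') ^ l"
      by (rule order_trans[OF b(4) m]) (use b in auto)
  qed
qed

lemma geometric_bound_add_scale:
  assumes "geometric_bound b" "geometric_bound g"
  shows "geometric_bound (\<lambda>l. b l + c *s g l)"
proof -
  obtain K \<rho> where b: "\<rho> > 0" "\<And>l i. cmod (b l $ i) \<le> K * \<rho> ^ l" "\<And>l i. cmod (g l $ i) \<le> K * \<rho> ^ l"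
    using geometric_bound_joint[OF assms] by metis
  have "cmod ((b l + c *s g l) $ i) \<le> (K + cmod c * K) * \<rho> ^ l" for l i
  proof -
    have "cmod ((b l + c *s g l) $ i) \<le> cmod (b l $ i) + cmod c * cmod (g l $ i)"
      using norm_triangle_ineq[of "b l $ i" "c * g l $ i"] by (simp add: norm_mult)
    also have "\<dots> \<le> K * \<rho> ^ l + cmod c * (K * \<rho> ^ l)"
      by (intro add_mono mult_left_mono b) auto
    finally show ?thesis by (simp add: algebra_simps)
  qed
  then show ?thesis unfolding geometric_bound_def using b(1) by blast
qed

lemma geometric_bound_recursion:
  fixes \<beta> :: "nat \<Rightarrow> real"
  assumes rec: "\<And>l. \<beta> (Suc l) \<le> A * (\<beta> l + K * \<rho> ^ l)" and "A \<ge> 0" "\<rho> \<ge> 0"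
  shows "\<exists>K' \<rho>'. \<rho>' > 0 \<and> (\<forall>l. \<beta> l \<le> K' * \<rho>' ^ l)"
proof -
  \<comment> \<open>Both summands of the recursion are at most \<open>K' * \<rho>' ^ l\<close>,
    hence the requirement \<open>2 * A \<le> \<rho>'\<close>; \<open>\<rho> \<le> \<rho>'\<close>
    absorbs the inhomogeneous term.\<close>
  define \<rho>' where "\<rho>' = 2 * A + \<rho> + 1"
  define K' where "K' = \<bar>\<beta> 0\<bar> + \<bar>K\<bar>"
  have r: "\<rho>' > 0" "\<rho> \<le> \<rho>'" "2 * A \<le> \<rho>'" using assms(2,3) by (auto simp: \<rho>'_def)
  have "\<beta> l \<le> K' * \<rho>' ^ l" for l
  proof (induction l)
    case 0 show ?case by (simp add: K'_def)
  next
    case (Suc l)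
    have "K * \<rho> ^ l \<le> K' * \<rho>' ^ l"
      by (intro mult_mono power_mono) (use r assms(3) in \<open>auto simp: K'_def\<close>)
    then have "A * (\<beta> l + K * \<rho> ^ l) \<le> A * (K' * \<rho>' ^ l + K' * \<rho>' ^ l)"
      using Suc assms(2) by (intro mult_left_mono add_mono) auto
    also have "\<dots> = (2 * A) * (K' * \<rho>' ^ l)" by simp
    also have "\<dots> \<le> \<rho>' * (K' * \<rho>' ^ l)"
      using r by (intro mult_right_mono) (auto simp: K'_def)
    finally show ?case using rec[of l] by (simp add: mult_ac)
  qed
  then show ?thesis using r(1) by blast
qed

section \<open>Sum norms of vectors and matrices\<close>

definition norm1 :: "complex^'n \<Rightarrow> real" where "norm1 x = (\<Sum>i\<in>UNIV. cmod (x $ i))"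

lemma norm1_nonneg: "norm1 x \<ge> 0"
  unfolding norm1_def by (intro sum_nonneg) auto

lemma cmod_le_norm1: "cmod (x $ i) \<le> norm1 x"
  unfolding norm1_def by (rule member_le_sum) auto

lemma norm1_le: "(\<And>i. cmod (x $ i) \<le> B) \<Longrightarrow> norm1 (x :: complex^'n) \<le> real CARD('n) * B"
  unfolding norm1_def using sum_bounded_above[of UNIV "\<lambda>i. cmod (x $ i)" B] by simp

definition mat_norm1 :: "complex^'n^'m \<Rightarrow> real" where
  "mat_norm1 A = (\<Sum>i\<in>UNIV. \<Sum>j\<in>UNIV. cmod (A $ i $ j))"

lemma mat_norm1_nonneg: "mat_norm1 A \<ge> 0"
  unfolding mat_norm1_def by (intro sum_nonneg) auto

lemma cmod_matrix_vector_mult_le: "cmod ((A *v x) $ i) \<le> mat_norm1 A * norm1 x"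
proof -
  have "cmod ((A *v x) $ i) \<le> (\<Sum>j\<in>UNIV. cmod (A $ i $ j) * norm1 x)"
    unfolding matrix_vector_mult_def vec_lambda_beta
    by (intro order_trans[OF norm_sum] sum_mono) (simp add: norm_mult mult_left_mono cmod_le_norm1)
  also have "\<dots> = (\<Sum>j\<in>UNIV. cmod (A $ i $ j)) * norm1 x" by (rule sum_distrib_right[symmetric])
  also have "\<dots> \<le> mat_norm1 A * norm1 x"
    unfolding mat_norm1_def
    by (intro mult_right_mono norm1_nonneg member_le_sum[of i UNIV "\<lambda>i. \<Sum>j\<in>UNIV. cmod (A $ i $ j)"])
      (auto intro: sum_nonneg)
  finally show ?thesis .
qed

section \<open>Local solutions at a singular point\<close>

text \<open>Stated with \<open>inverse\<close> so that it covers every \<open>l\<close>: at a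
  resonant index, where the denominator is zero, \<open>inverse 0 = 0\<close> satisfies the
  bound.\<close>

lemma bounded_inverse_shift: "\<exists>Q\<ge>0. \<forall>l. cmod (inverse (\<mu> + of_nat l :: complex)) \<le> Q"
proof -
  have "(\<lambda>l. \<mu> + of_nat l :: complex) = (\<lambda>l. of_nat l + \<mu>)" by (simp add: add.commute)
  moreover have "filterlim (\<lambda>l. of_nat l + \<mu> :: complex) at_infinity sequentially"
    using tendsto_add_filterlim_at_infinity'[OF tendsto_of_nat tendsto_const] .
  ultimately have "(\<lambda>l. inverse (\<mu> + of_nat l :: complex)) \<longlonglongrightarrow> 0"
    using filterlim_compose[OF tendsto_inverse_0] by metis
  then have "Bseq (\<lambda>l. inverse (\<mu> + of_nat l :: complex))"
    by (intro convergent_imp_Bseq) (auto simp: convergent_def)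
  then obtain Q where "Q > 0" "\<forall>l. cmod (inverse (\<mu> + of_nat l :: complex)) \<le> Q"
    unfolding Bseq_def by blast
  then show ?thesis by (intro exI[of _ Q]) simp
qed

text \<open>Residual of the coefficient of \<open>(z - lam j)\<^sup>l\<close> when \<open>\<Sum>l. b l (z - lam j)\<^sup>l\<close> is inserted into the
  system with right-hand side \<open>(A\<^sub>1 + I) \<Psi> + \<Sum>l. g l (z - lam j)\<^sup>l\<close>.\<close>

definition series_residual ::
  "('n::finite \<Rightarrow> complex) \<Rightarrow> complex^'n^'n \<Rightarrow> 'n \<Rightarrow> (nat \<Rightarrow> complex^'n) \<Rightarrow> (nat \<Rightarrow> complex^'n)
    \<Rightarrow> nat \<Rightarrow> 'n \<Rightarrow> complex" where
  "series_residual lam A1 j g b l i =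
     ((A1 + mat 1) *v b l) $ i + of_nat l * b l $ i + g l $ i
       - (lam i - lam j) * (of_nat (Suc l) * b (Suc l) $ i)"

text \<open>It isolates the coefficient of \<open>x $ j\<close>. In the residual at row
  \<open>j\<close> the term with the next coefficient vanishes, so
  \<open>A1 $ j $ j + 1 + of_nat l\<close> is the exact factor of \<open>b l $ j\<close>.\<close>

lemma row_split:
  "((A1 + mat 1) *v (x :: complex^'n)) $ j = (A1 $ j $ j + 1) * x $ j + (\<Sum>i\<in>UNIV - {j}. A1 $ j $ i * x $ i)"
proof -
  have "((A1 + mat 1) *v x) $ j = (\<Sum>i\<in>UNIV. (A1 $ j $ i + mat 1 $ j $ i) * x $ i)"
    by (simp add: matrix_vector_mult_def)
  also have "\<dots> = (A1 $ j $ j + mat 1 $ j $ j) * x $ j + (\<Sum>i\<in>UNIV - {j}. (A1 $ j $ i + mat 1 $ j $ i) * x $ i)"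
    by (rule sum.remove) auto
  also have "(\<Sum>i\<in>UNIV - {j}. (A1 $ j $ i + mat 1 $ j $ i) * x $ i) = (\<Sum>i\<in>UNIV - {j}. A1 $ j $ i * x $ i)"
    by (intro sum.cong) (auto simp: mat_def)
  finally show ?thesis by (simp add: mat_def)
qed

text \<open>In a row \<open>i \<noteq> j\<close> the residual of index \<open>l\<close> contains
  \<open>b (Suc l) $ i\<close> with a nonzero factor and determines it. In row \<open>j\<close> that
  factor is zero, and the residual is an algebraic equation for \<open>b l $ j\<close>, solvable
  unless \<open>A1 $ j $ j + 1 + of_nat l = 0\<close>. The free data are the entries of
  \<open>b 0\<close> off \<open>j\<close>.\<close>

lemma local_recursion:
  fixes lam :: "'n::finite \<Rightarrow> complex" and A1 :: "complex^'n^'n" and u :: "complex^'n"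
  assumes "inj lam" and g: "geometric_bound g"
  obtains b where "geometric_bound b" "\<And>i. i \<noteq> j \<Longrightarrow> b 0 $ i = u $ i"
    "\<And>l i. i \<noteq> j \<or> A1 $ j $ j + 1 + of_nat l \<noteq> 0 \<Longrightarrow> series_residual lam A1 j g b l i = 0"
proof -
  define \<mu> where "\<mu> = A1 $ j $ j + 1"
  \<comment> \<open>Solves the equation of row \<open>j\<close> for the \<open>j\<close>-th entry,
    given the other ones; at a resonance \<open>inverse 0 = 0\<close> makes this entry zero.\<close>
  define fill :: "nat \<Rightarrow> complex^'n \<Rightarrow> complex^'n" where
    "fill l w = (\<chi> i. if i = j then - ((\<Sum>i\<in>UNIV - {j}. A1 $ j $ i * w $ i) + g l $ j) * inverse (\<mu> + of_nat l) else w $ i)"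
    for l w
  define nxt :: "nat \<Rightarrow> complex^'n \<Rightarrow> complex^'n" where
    "nxt l x = (\<chi> i. (((A1 + mat 1) *v x) $ i + of_nat l * x $ i + g l $ i) / ((lam i - lam j) * of_nat (Suc l)))"
    for l x
  define b where "b = rec_nat (fill 0 u) (\<lambda>l x. fill (Suc l) (nxt l x))"
  have b0: "b 0 = fill 0 u" and bS: "b (Suc l) = fill (Suc l) (nxt l (b l))" for l
    by (simp_all add: b_def)
  have bfill: "\<exists>w. b l = fill l w" for l by (cases l) (auto simp: b0 bS)
  have nz: "lam i - lam j \<noteq> 0" if "i \<noteq> j" for i using assms(1) that by (auto simp: inj_def)
  have res: "series_residual lam A1 j g b l i = 0" if "i \<noteq> j" for l i
    using nz[OF that] that
    by (simp add: series_residual_def bS fill_def nxt_def del: of_nat_Suc)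
  have resj: "series_residual lam A1 j g b l j = 0" if "\<mu> + of_nat l \<noteq> 0" for l
  proof -
    obtain w where w: "b l = fill l w" using bfill by blast
    have "(\<Sum>i\<in>UNIV - {j}. A1 $ j $ i * b l $ i) = (\<Sum>i\<in>UNIV - {j}. A1 $ j $ i * w $ i)"
      by (intro sum.cong) (auto simp: w fill_def)
    then have "b l $ j * (\<mu> + of_nat l) = - ((\<Sum>i\<in>UNIV - {j}. A1 $ j $ i * b l $ i) + g l $ j)"
      using that by (simp add: w fill_def)
    then show ?thesis
      unfolding series_residual_def row_split \<mu>_def by (simp add: algebra_simps)
  qed
  obtain K \<rho> where g: "\<rho> > 0" "\<And>l i. cmod (g l $ i) \<le> K * \<rho> ^ l"
    using g unfolding geometric_bound_def by blast
  have K0: "K \<ge> 0" using order_trans[OF norm_ge_zero g(2)[of 0]] by simp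
  obtain Q where Q: "Q \<ge> 0" "\<And>l. cmod (inverse (\<mu> + of_nat l)) \<le> Q"
    using bounded_inverse_shift by blast
  \<comment> \<open>The summand \<open>1\<close> in \<open>S\<close> lets \<open>S\<close> times
    \<open>of_nat (Suc l)\<close> dominate the matrix norm, the term \<open>of_nat l * x $ i\<close>
    and the inhomogeneity together. Division by \<open>of_nat (Suc l)\<close> in \<open>nxt\<close>
    then leaves a bound independent of \<open>l\<close>.\<close>
  define S where "S = mat_norm1 (A1 + mat 1) + mat_norm1 A1 + 1"
  \<comment> \<open>The summand for \<open>i = j\<close> is \<open>1 / 0 = 0\<close>, so
    \<open>q\<close> bounds each summand without an exception.\<close>
  define q where "q = (\<Sum>i\<in>UNIV. 1 / cmod (lam i - lam j))"
  define n where "n = real CARD('n)"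
  have S: "S \<ge> 1"
    using mat_norm1_nonneg[of "A1 + mat 1"] mat_norm1_nonneg[of A1] by (simp add: S_def)
  have q: "q \<ge> 0" unfolding q_def by (intro sum_nonneg) auto
  have n: "n \<ge> 1" unfolding n_def by (simp add: Suc_le_eq)
  define A where "A = n * (Q * (S * (n * (q * S))) + Q * (1 + \<rho>) + q * S)"
  have nxt_le: "cmod (nxt l x $ i) \<le> q * S * (norm1 x + K * \<rho> ^ l)" for l x i
  proof -
    have "cmod (((A1 + mat 1) *v x) $ i + of_nat l * x $ i + g l $ i)
        \<le> mat_norm1 (A1 + mat 1) * norm1 x + of_nat l * norm1 x + K * \<rho> ^ l"
      by (intro order_trans[OF norm_triangle_ineq] add_mono cmod_matrix_vector_mult_le g)
        (simp add: norm_mult mult_left_mono cmod_le_norm1)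
    also have "\<dots> \<le> (S - 1) * norm1 x + of_nat l * norm1 x + K * \<rho> ^ l"
    proof -
      have "mat_norm1 (A1 + mat 1) * norm1 x \<le> (S - 1) * norm1 x"
        by (rule mult_right_mono[OF _ norm1_nonneg]) (use mat_norm1_nonneg[of A1] in \<open>simp add: S_def\<close>)
      then show ?thesis by simp
    qed
    also have "\<dots> \<le> of_nat (Suc l) * (S * (norm1 x + K * \<rho> ^ l))"
    proof -
      have "0 \<le> real l * ((S - 1) * norm1 x) + (S - 1 + S * real l) * (K * \<rho> ^ l) + norm1 x"
        using S K0 g(1) norm1_nonneg[of x] by (intro add_nonneg_nonneg mult_nonneg_nonneg) auto
      then show ?thesis by (simp add: algebra_simps)
    qed
    finally have N: "cmod (((A1 + mat 1) *v x) $ i + of_nat l * x $ i + g l $ i)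
      \<le> of_nat (Suc l) * (S * (norm1 x + K * \<rho> ^ l))" .
    have "cmod (nxt l x $ i) = cmod (((A1 + mat 1) *v x) $ i + of_nat l * x $ i + g l $ i)
        / of_nat (Suc l) * (1 / cmod (lam i - lam j))"
      by (simp add: nxt_def norm_divide norm_mult del: of_nat_Suc)
    also have "\<dots> \<le> (S * (norm1 x + K * \<rho> ^ l)) * q"
    proof (intro mult_mono)
      show "cmod (((A1 + mat 1) *v x) $ i + of_nat l * x $ i + g l $ i) / of_nat (Suc l) \<le> S * (norm1 x + K * \<rho> ^ l)"
        using N by (simp add: divide_le_eq mult.commute)
      show "1 / cmod (lam i - lam j) \<le> q" unfolding q_def by (rule member_le_sum) auto
      show "0 \<le> S * (norm1 x + K * \<rho> ^ l)"
        using S K0 g(1) norm1_nonneg[of x] by simp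
    qed auto
    finally show ?thesis by (simp add: mult_ac)
  qed
  have "norm1 (b (Suc l)) \<le> A * (norm1 (b l) + K * \<rho> ^ l)" for l
  proof -
    define R where "R = norm1 (b l) + K * \<rho> ^ l"
    have R: "R \<ge> 0" "K * \<rho> ^ l \<le> R" using K0 g(1) norm1_nonneg[of "b l"] by (auto simp: R_def)
    define w where "w = nxt l (b l)"
    have wR: "cmod (w $ i) \<le> q * S * R" for i unfolding w_def R_def by (rule nxt_le)
    have "norm1 w \<le> n * (q * S * R)" unfolding n_def by (rule norm1_le) (rule wR)
    have "cmod (b (Suc l) $ i) \<le> (Q * (S * (n * (q * S))) + Q * (1 + \<rho>) + q * S) * R" for i
    proof (cases "i = j")
      case True
      have "cmod (\<Sum>i\<in>UNIV - {j}. A1 $ j $ i * w $ i) \<le> (\<Sum>i\<in>UNIV - {j}. cmod (A1 $ j $ i) * norm1 w)"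
        by (intro order_trans[OF norm_sum] sum_mono) (simp add: norm_mult mult_left_mono cmod_le_norm1)
      also have "\<dots> \<le> (\<Sum>i\<in>UNIV. cmod (A1 $ j $ i) * norm1 w)"
        by (rule sum_mono2) (auto intro: mult_nonneg_nonneg norm1_nonneg)
      also have "\<dots> = (\<Sum>i\<in>UNIV. cmod (A1 $ j $ i)) * norm1 w" by (rule sum_distrib_right[symmetric])
      also have "\<dots> \<le> S * (n * (q * S * R))"
      proof (intro mult_mono)
        have "(\<Sum>i\<in>UNIV. cmod (A1 $ j $ i)) \<le> mat_norm1 A1" unfolding mat_norm1_def
          by (rule member_le_sum[of j UNIV "\<lambda>i. \<Sum>k\<in>UNIV. cmod (A1 $ i $ k)"]) (auto intro: sum_nonneg)
        then show "(\<Sum>i\<in>UNIV. cmod (A1 $ j $ i)) \<le> S"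
          using mat_norm1_nonneg[of "A1 + mat 1"] by (simp add: S_def)
      qed (use S \<open>norm1 w \<le> n * (q * S * R)\<close> norm1_nonneg in auto)
      finally have s: "cmod (\<Sum>i\<in>UNIV - {j}. A1 $ j $ i * w $ i) \<le> S * (n * (q * S * R))" .
      have "cmod (g (Suc l) $ j) \<le> \<rho> * (K * \<rho> ^ l)" using g(2)[of "Suc l" j] by (simp add: mult_ac)
      also have "\<dots> \<le> (1 + \<rho>) * R" using R g(1) K0 by (intro mult_mono) auto
      finally have gg: "cmod (g (Suc l) $ j) \<le> (1 + \<rho>) * R" .
      have "b (Suc l) $ i = - ((\<Sum>i\<in>UNIV - {j}. A1 $ j $ i * w $ i) + g (Suc l) $ j) * inverse (\<mu> + of_nat (Suc l))"
        using True by (simp add: bS fill_def w_def del: of_nat_Suc)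
      then have "cmod (b (Suc l) $ i) = cmod ((\<Sum>i\<in>UNIV - {j}. A1 $ j $ i * w $ i) + g (Suc l) $ j)
          * cmod (inverse (\<mu> + of_nat (Suc l)))"
        by (simp only: norm_mult norm_minus_cancel)
      also have "\<dots> \<le> (S * (n * (q * S * R)) + (1 + \<rho>) * R) * Q"
      proof (rule mult_mono)
        show "cmod ((\<Sum>i\<in>UNIV - {j}. A1 $ j $ i * w $ i) + g (Suc l) $ j) \<le> S * (n * (q * S * R)) + (1 + \<rho>) * R"
          by (rule order_trans[OF norm_triangle_ineq add_mono[OF s gg]])
        show "0 \<le> S * (n * (q * S * R)) + (1 + \<rho>) * R"
          by (rule order_trans[OF norm_ge_zero order_trans[OF norm_triangle_ineq add_mono[OF s gg]]])
      qed (use Q in \<open>simp_all del: of_nat_Suc\<close>)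
      also have "\<dots> \<le> (S * (n * (q * S * R)) + (1 + \<rho>) * R) * Q + q * S * R"
        using q S R by simp
      finally show ?thesis by (simp add: algebra_simps)
    next
      case False
      have "cmod (b (Suc l) $ i) \<le> q * S * R" using wR[of i] False by (simp add: bS fill_def w_def)
      also have "\<dots> \<le> (S * (n * (q * S * R)) + (1 + \<rho>) * R) * Q + q * S * R"
        using q S R Q n g(1) by simp
      finally show ?thesis by (simp add: algebra_simps)
    qed
    from norm1_le[OF this] show ?thesis by (simp add: A_def n_def R_def mult.assoc)
  qed
  moreover have "A \<ge> 0" unfolding A_def using n Q S q g(1)
    by (intro mult_nonneg_nonneg add_nonneg_nonneg) auto
  ultimately have "\<exists>K' \<rho>'. \<rho>' > 0 \<and> (\<forall>l. norm1 (b l) \<le> K' * \<rho>' ^ l)"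
    using g(1) by (intro geometric_bound_recursion[where A = A and K = K and \<rho> = \<rho>]) auto
  then have "geometric_bound b"
    unfolding geometric_bound_def using order_trans[OF cmod_le_norm1] by (elim ex_forward conjE) auto
  moreover have "b 0 $ i = u $ i" if "i \<noteq> j" for i using that by (simp add: b0 fill_def)
  ultimately show ?thesis using that res resj unfolding \<mu>_def by metis
qed

text \<open>A resonance \<open>A1 $ j $ j + 1 + m = 0\<close> obstructs the recursion in one coefficient only; the obstruction
  is removed by adding a multiple of an inhomogeneity whose first nonzero coefficient is the \<open>m\<close>-th.\<close>

lemma local_recursion_resonant:
  fixes lam :: "'n::finite \<Rightarrow> complex" and A1 :: "complex^'n^'n" and u :: "complex^'n"
  assumes "inj lam" and g: "geometric_bound g"
    and m: "A1 $ j $ j + 1 + of_nat m = 0"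
    and g0: "\<And>l. l < m \<Longrightarrow> g l = 0" and gm: "g m $ j \<noteq> 0"
  obtains b c where "geometric_bound b" "\<And>i. i \<noteq> j \<Longrightarrow> b 0 $ i = u $ i"
    "\<And>l i. series_residual lam A1 j (\<lambda>l. c *s g l) b l i = 0"
proof -
  have "geometric_bound (\<lambda>l. 0 :: complex^'n)"
    unfolding geometric_bound_def by (intro exI[of _ 0] exI[of _ 1]) simp
  from local_recursion[OF assms(1) this, of j u A1] obtain b0 where b0: "geometric_bound b0"
    "\<And>i. i \<noteq> j \<Longrightarrow> b0 0 $ i = u $ i"
    "\<And>l i. i \<noteq> j \<or> A1 $ j $ j + 1 + of_nat l \<noteq> 0 \<Longrightarrow> series_residual lam A1 j (\<lambda>l. 0) b0 l i = 0"
    by metis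
  from local_recursion[OF assms(1) g, of j 0 A1] obtain b1 where b1: "geometric_bound b1"
    "\<And>i. i \<noteq> j \<Longrightarrow> b1 0 $ i = 0"
    "\<And>l i. i \<noteq> j \<or> A1 $ j $ j + 1 + of_nat l \<noteq> 0 \<Longrightarrow> series_residual lam A1 j g b1 l i = 0"
    by (metis zero_index)
  have nz: "lam i - lam j \<noteq> 0" if "i \<noteq> j" for i using assms(1) that by (auto simp: inj_def)
  have other: "A1 $ j $ j + 1 + of_nat l \<noteq> 0" if "l \<noteq> m" for l
  proof
    assume "A1 $ j $ j + 1 + of_nat l = 0"
    then have "(of_nat l :: complex) = of_nat m" using m by (metis add_left_imp_eq)
    then show False using that by simp
  qed
  \<comment> \<open>With zero initial data and no inhomogeneity before index \<open>m\<close>, every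
    coefficient vanishes until the resonance is reached; at index \<open>m\<close> only entry
    \<open>j\<close> may differ from zero.\<close>
  have off: "(\<forall>i. i \<noteq> j \<longrightarrow> b1 l $ i = 0) \<and> (l < m \<longrightarrow> b1 l $ j = 0)" if "l \<le> m" for l
    using that
  proof (induction l)
    case 0
    have "b1 0 $ j = 0" if "0 < m"
    proof -
      have "series_residual lam A1 j g b1 0 j = 0" using other[of 0] that by (intro b1(3)) auto
      moreover have "(\<Sum>i\<in>UNIV - {j}. A1 $ j $ i * b1 0 $ i) = 0" using b1(2) by (intro sum.neutral) auto
      ultimately have "(A1 $ j $ j + 1 + of_nat 0) * b1 0 $ j = 0"
        using g0[OF that] unfolding series_residual_def row_split by simp
      then show ?thesis using other[of 0] that by (simp del: of_nat_0)
    qed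
    then show ?case using b1(2) by auto
  next
    case (Suc l)
    then have "b1 l $ i = 0" for i by (cases "i = j") auto
    then have z: "b1 l = 0" by (simp add: vec_eq_iff)
    have gl: "g l = 0" using g0 Suc by simp
    have a: "b1 (Suc l) $ i = 0" if "i \<noteq> j" for i
    proof -
      have "series_residual lam A1 j g b1 l i = 0" using that by (intro b1(3)) auto
      then show ?thesis using nz[OF that] unfolding series_residual_def
        by (simp add: z gl matrix_vector_mult_0_right del: of_nat_Suc)
    qed
    have "b1 (Suc l) $ j = 0" if "Suc l < m"
    proof -
      have "series_residual lam A1 j g b1 (Suc l) j = 0" using other[of "Suc l"] that by (intro b1(3)) auto
      moreover have "(\<Sum>i\<in>UNIV - {j}. A1 $ j $ i * b1 (Suc l) $ i) = 0" using a by (intro sum.neutral) auto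
      ultimately have "(A1 $ j $ j + 1 + of_nat (Suc l)) * b1 (Suc l) $ j = 0"
        using g0[OF that] unfolding series_residual_def row_split by (simp add: algebra_simps)
      then show ?thesis using other[of "Suc l"] that by (simp del: of_nat_Suc)
    qed
    with a show ?case by auto
  qed
  \<comment> \<open>At the resonance the factor of \<open>b1 m $ j\<close> is zero and the other
    entries vanish, so only the inhomogeneity survives. It is nonzero, and a multiple of
    \<open>b1\<close> can cancel the residual of \<open>b0\<close>.\<close>
  have r1: "series_residual lam A1 j g b1 m j = g m $ j"
  proof -
    have "(\<Sum>i\<in>UNIV - {j}. A1 $ j $ i * b1 m $ i) = 0" using off[of m] by (intro sum.neutral) auto
    then have "series_residual lam A1 j g b1 m j = (A1 $ j $ j + 1 + of_nat m) * b1 m $ j + g m $ j"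
      unfolding series_residual_def row_split by (simp add: algebra_simps)
    then show ?thesis by (simp add: m)
  qed
  define c where "c = - series_residual lam A1 j (\<lambda>l. 0) b0 m j / g m $ j"
  define b where "b l = b0 l + c *s b1 l" for l
  have lin: "series_residual lam A1 j (\<lambda>l. c *s g l) b l i =
      series_residual lam A1 j (\<lambda>l. 0) b0 l i + c * series_residual lam A1 j g b1 l i" for l i
    unfolding series_residual_def b_def
    by (simp add: matrix_vector_right_distrib vector_scalar_commute algebra_simps del: of_nat_Suc)
  show ?thesis
  proof (rule that[of b c])
    show "geometric_bound b" unfolding b_def[abs_def] by (rule geometric_bound_add_scale[OF b0(1) b1(1)])
    show "b 0 $ i = u $ i" if "i \<noteq> j" for i using b0(2) b1(2) that by (simp add: b_def)
    show "series_residual lam A1 j (\<lambda>l. c *s g l) b l i = 0" for l i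
    proof (cases "i \<noteq> j \<or> l \<noteq> m")
      case True
      then show ?thesis unfolding lin using other by (simp add: b0(3) b1(3))
    next
      case False
      then show ?thesis unfolding lin using gm r1 by (simp add: c_def)
    qed
  qed
qed

text \<open>With \<open>x = z - lam j\<close> one has
  \<open>lam i - z = (lam i - lam j) - x\<close>. The series of \<open>d\<close> and of
  \<open>x * d\<close> have coefficients \<open>of_nat (Suc l) * b (Suc l)\<close> and
  \<open>of_nat l * b l\<close>, so comparing coefficients turns the equation into the vanishing of
  all residuals.\<close>

lemma local_series_solution:
  fixes lam :: "'n::finite \<Rightarrow> complex" and A1 :: "complex^'n^'n"
  assumes b: "geometric_bound b" and g: "geometric_bound g"
    and res: "\<And>l i. series_residual lam A1 j g b l i = 0"
  obtains r where "r > 0"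
    "\<And>z i. z \<in> ball (lam j) r \<Longrightarrow> \<exists>d.
       ((\<lambda>w. powser (\<lambda>l. b l $ i) (w - lam j)) has_field_derivative d) (at z) \<and>
       (lam i - z) * d = ((A1 + mat 1) *v (\<chi> k. powser (\<lambda>l. b l $ k) (z - lam j))) $ i
          + powser (\<lambda>l. g l $ i) (z - lam j)"
proof -
  obtain K \<rho> where k: "\<rho> > 0" "\<And>l i. cmod (b l $ i) \<le> K * \<rho> ^ l" "\<And>l i. cmod (g l $ i) \<le> K * \<rho> ^ l"
    using geometric_bound_joint[OF b g] by metis
  show ?thesis
  proof (rule that[of "1 / \<rho>"])
    show "1 / \<rho> > 0" using k by simp
    fix z i assume z: "z \<in> ball (lam j) (1 / \<rho>)"
    define x where "x = z - lam j"
    have x: "cmod x < 1 / \<rho>" using z by (simp add: x_def dist_norm norm_minus_commute)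
    obtain d where d: "(powser (\<lambda>l. b l $ i) has_field_derivative d) (at x)"
      "(\<lambda>l. of_nat (Suc l) * b (Suc l) $ i * x ^ l) sums d"
      "(\<lambda>l. of_nat l * b l $ i * x ^ l) sums (x * d)"
      by (rule powser_derivative[OF k(2) k(1) x])
    have "(\<lambda>l. (A1 + mat 1) $ i $ k * (b l $ k * x ^ l)) sums
        ((A1 + mat 1) $ i $ k * powser (\<lambda>l. b l $ k) x)" for k
      by (rule sums_mult[OF powser_sums[OF k(2) k(1) x]])
    then have "(\<lambda>l. \<Sum>k\<in>UNIV. (A1 + mat 1) $ i $ k * (b l $ k * x ^ l)) sums
        (\<Sum>k\<in>UNIV. (A1 + mat 1) $ i $ k * powser (\<lambda>l. b l $ k) x)"
      by (rule sums_sum)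
    moreover have "(\<Sum>k\<in>UNIV. (A1 + mat 1) $ i $ k * (b l $ k * x ^ l)) = ((A1 + mat 1) *v b l) $ i * x ^ l" for l
      unfolding matrix_vector_mult_def vec_lambda_beta sum_distrib_right by (simp add: mult.assoc)
    ultimately have s1: "(\<lambda>l. ((A1 + mat 1) *v b l) $ i * x ^ l) sums
        ((A1 + mat 1) *v (\<chi> k. powser (\<lambda>l. b l $ k) x)) $ i"
      by (simp add: matrix_vector_mult_def)
    have "(\<lambda>l. ((A1 + mat 1) *v b l) $ i * x ^ l + of_nat l * b l $ i * x ^ l + g l $ i * x ^ l) sums
        (((A1 + mat 1) *v (\<chi> k. powser (\<lambda>l. b l $ k) x)) $ i + x * d + powser (\<lambda>l. g l $ i) x)"
      by (intro sums_add s1 d powser_sums[OF k(3) k(1) x])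
    moreover have "((A1 + mat 1) *v b l) $ i * x ^ l + of_nat l * b l $ i * x ^ l + g l $ i * x ^ l
       = (lam i - lam j) * (of_nat (Suc l) * b (Suc l) $ i * x ^ l)" for l
    proof -
      have "((A1 + mat 1) *v b l) $ i + of_nat l * b l $ i + g l $ i
       = (lam i - lam j) * (of_nat (Suc l) * b (Suc l) $ i)"
        using res[of l i] unfolding series_residual_def by simp
      then show ?thesis by (metis distrib_right mult.assoc)
    qed
    moreover have "(\<lambda>l. (lam i - lam j) * (of_nat (Suc l) * b (Suc l) $ i * x ^ l)) sums ((lam i - lam j) * d)"
      by (rule sums_mult[OF d(2)])
    ultimately have "((A1 + mat 1) *v (\<chi> k. powser (\<lambda>l. b l $ k) x)) $ i + x * d + powser (\<lambda>l. g l $ i) x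
       = (lam i - lam j) * d" by (simp add: sums_unique2)
    moreover have "((\<lambda>w. powser (\<lambda>l. b l $ i) (w - lam j)) has_field_derivative d) (at z)"
    proof -
      have "((\<lambda>w. w - lam j) has_field_derivative 1) (at z)" by (auto intro!: derivative_eq_intros)
      from DERIV_chain2[where f = "powser (\<lambda>l. b l $ i)" and g = "\<lambda>w. w - lam j", OF d(1)[unfolded x_def] this]
      show ?thesis by simp
    qed
    ultimately show "\<exists>d. ((\<lambda>w. powser (\<lambda>l. b l $ i) (w - lam j)) has_field_derivative d) (at z) \<and>
       (lam i - z) * d = ((A1 + mat 1) *v (\<chi> k. powser (\<lambda>l. b l $ k) (z - lam j))) $ i
          + powser (\<lambda>l. g l $ i) (z - lam j)"
      by (intro exI[of _ d]) (simp add: x_def algebra_simps)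
  qed
qed

section \<open>Regularity and jumps at a singular point\<close>

lemma vec_holomorphic_on_powser:
  assumes b: "geometric_bound b"
  obtains r where "r > 0" "(\<lambda>z. \<chi> i. powser (\<lambda>l. b l $ i) (z - a)) vec_holomorphic_on ball a r"
proof -
  obtain K \<rho> where k: "\<rho> > 0" "\<And>l i. cmod (b l $ i) \<le> K * \<rho> ^ l"
    using b unfolding geometric_bound_def by auto
  have "\<exists>d. ((\<lambda>z. powser (\<lambda>l. b l $ i) (z - a)) has_field_derivative d) (at z)" if "z \<in> ball a (1 / \<rho>)" for z i
  proof -
    have x: "cmod (z - a) < 1 / \<rho>" using that by (simp add: dist_norm norm_minus_commute)
    obtain d where d: "(powser (\<lambda>l. b l $ i) has_field_derivative d) (at (z - a))"
      "(\<lambda>l. of_nat (Suc l) * b (Suc l) $ i * (z - a) ^ l) sums d"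
      "(\<lambda>l. of_nat l * b l $ i * (z - a) ^ l) sums ((z - a) * d)"
      by (rule powser_derivative[OF k(2) k(1) x])
    have "((\<lambda>w. w - a) has_field_derivative 1) (at z)" by (auto intro!: derivative_eq_intros)
    from DERIV_chain2[where f = "powser (\<lambda>l. b l $ i)" and g = "\<lambda>w. w - a", OF d(1) this]
    show ?thesis by auto
  qed
  then have "(\<lambda>z. \<chi> i. powser (\<lambda>l. b l $ i) (z - a)) vec_holomorphic_on ball a (1 / \<rho>)"
    unfolding vec_holomorphic_on_def vec_lambda_beta by (simp add: holomorphic_on_open)
  moreover have "1 / \<rho> > 0" using k by simp
  ultimately show ?thesis using that by blast
qed

section \<open>Branches of the logarithm on the two sides of a cut\<close>

lemma mult_cis_pi_minus: "w * cis (pi - \<eta>) = - (w * cis (- \<eta>))"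
  by (simp add: complex_eq_iff cos_diff sin_diff)

lemma cut_ln_derivative:
  assumes "\<not> (yc \<eta> w = 0 \<and> xc \<eta> w \<ge> 0)"
  shows "(cut_ln \<eta> has_field_derivative 1 / w) (at w)"
proof -
  have w: "w \<noteq> 0" using assms by (auto simp: xc_def yc_def)
  have "w * cis (pi - \<eta>) \<notin> \<real>\<^sub>\<le>\<^sub>0"
    using assms unfolding mult_cis_pi_minus mult_cis_uminus
    by (auto simp: complex_nonpos_Reals_iff)
  moreover have "((\<lambda>w. Ln (w * c) - k) has_field_derivative 1 / w) (at w)"
    if "w * c \<notin> \<real>\<^sub>\<le>\<^sub>0" for c k
  proof -
    have "c \<noteq> 0" using that by auto
    then show ?thesis using that w by (auto intro!: derivative_eq_intros simp: field_simps)
  qed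
  ultimately show ?thesis unfolding cut_ln_def[abs_def] by blast
qed

text \<open>The logarithm continued across the cut: it is holomorphic on the half-plane around the
  direction \<open>\<eta>\<close> and has imaginary part \<open>\<eta>\<close> on the ray
  itself.\<close>

definition right_ln :: "real \<Rightarrow> complex \<Rightarrow> complex" where
  "right_ln \<eta> w = Ln (w * cis (- \<eta>)) + \<i> * of_real \<eta>"

lemma right_ln_holomorphic:
  assumes "f holomorphic_on S" "\<And>z. z \<in> S \<Longrightarrow> xc \<eta> (f z) > 0"
  shows "(\<lambda>z. right_ln \<eta> (f z)) holomorphic_on S"
  unfolding right_ln_def
  using assms by (intro holomorphic_intros) (force simp: mult_cis_uminus complex_nonpos_Reals_iff)+

text \<open>The cut branch has argument close to \<open>\<eta>\<close> just below the ray and close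
  to \<open>\<eta> - 2 * pi\<close> just above it. All jumps in the proof originate in this
  difference of \<open>2 * pi * \<i>\<close>.\<close>

lemma cut_ln_eq_right_ln:
  assumes "xc \<eta> w > 0"
  shows "yc \<eta> w < 0 \<Longrightarrow> cut_ln \<eta> w = right_ln \<eta> w"
    and "yc \<eta> w > 0 \<Longrightarrow> cut_ln \<eta> w = right_ln \<eta> w - 2 * of_real pi * \<i>"
proof -
  have nz: "w * cis (- \<eta>) \<noteq> 0" using assms by (auto simp: xc_def)
  have "cut_ln \<eta> w = (if Im (w * cis (- \<eta>)) \<le> 0 \<and> \<not> (Re (w * cis (- \<eta>)) < 0 \<and> Im (w * cis (- \<eta>)) = 0)
       then Ln (w * cis (- \<eta>)) + \<i> * pi else Ln (w * cis (- \<eta>)) - \<i> * pi) - \<i> * of_real (pi - \<eta>)"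
    unfolding cut_ln_def mult_cis_pi_minus using Ln_minus[OF nz] by simp
  then show "yc \<eta> w < 0 \<Longrightarrow> cut_ln \<eta> w = right_ln \<eta> w"
    and "yc \<eta> w > 0 \<Longrightarrow> cut_ln \<eta> w = right_ln \<eta> w - 2 * of_real pi * \<i>"
    using assms by (auto simp: mult_cis_uminus right_ln_def algebra_simps)
qed

lemma exp_cut_ln: "w \<noteq> 0 \<Longrightarrow> exp (cut_ln \<eta> w) = w"
  unfolding cut_ln_def exp_diff by (simp add: cis_conv_exp)

lemma cut_pow_of_nat: "w \<noteq> 0 \<Longrightarrow> cut_pow \<eta> w (of_nat m) = w ^ m"
  unfolding cut_pow_def by (simp add: exp_of_nat_mult exp_cut_ln)

context cut_system
begin

text \<open>Half the width of a strip around the line of the cut at \<open>lam j\<close> that no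
  other cut enters. The inserted \<open>1\<close> keeps the set nonempty when there is only one
  singular point.\<close>

definition gap :: "'n \<Rightarrow> real" where
  "gap j = Min (insert 1 ((\<lambda>k. \<bar>yc \<eta> (lam k) - yc \<eta> (lam j)\<bar>) ` (UNIV - {j})))"

lemma gap_pos: "gap j > 0"
  using yc_lam_neq by (auto simp: gap_def)

lemma gap_le: "k \<noteq> j \<Longrightarrow> gap j \<le> \<bar>yc \<eta> (lam k) - yc \<eta> (lam j)\<bar>"
  unfolding gap_def by (intro Min_le) auto

lemma mem_cut_plane_near:
  assumes "\<bar>yc \<eta> z - yc \<eta> (lam j)\<bar> < gap j"
  shows "z \<in> cut_plane lam \<eta> \<longleftrightarrow> \<not> (yc \<eta> z = yc \<eta> (lam j) \<and> xc \<eta> (lam j) \<le> xc \<eta> z)"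
  unfolding mem_cut_plane_iff using assms gap_le[of _ j] by (metis linorder_not_le)

definition slit :: "'n \<Rightarrow> real \<Rightarrow> complex set" where
  "slit j r = ball (lam j) r \<inter> cut_plane lam \<eta>"

lemma abs_yc_less: "z \<in> ball a r \<Longrightarrow> \<bar>yc \<eta> z - yc \<eta> a\<bar> < r"
  using abs_yc_le[of \<eta> "z - a"] by (simp add: yc_diff dist_norm norm_minus_commute)

lemma mem_slit:
  assumes "r \<le> gap j"
  shows "z \<in> slit j r \<longleftrightarrow> z \<in> ball (lam j) r \<and> \<not> (yc \<eta> z = yc \<eta> (lam j) \<and> xc \<eta> (lam j) \<le> xc \<eta> z)"
proof -
  have "\<bar>yc \<eta> z - yc \<eta> (lam j)\<bar> < gap j" if "z \<in> ball (lam j) r"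
    using abs_yc_less[OF that] assms by simp
  then show ?thesis unfolding slit_def using mem_cut_plane_near by blast
qed

lemma slit_mono: "r \<le> r' \<Longrightarrow> slit j r \<subseteq> slit j r'"
  unfolding slit_def by auto

lemma slit_subset: "slit j r \<subseteq> cut_plane lam \<eta>" "slit j r \<subseteq> ball (lam j) r"
  unfolding slit_def by auto

lemma slit_disjoint: "slit j r \<inter> range lam = {}"
  using slit_subset(1) cut_plane_disjoint by blast

lemma open_slit: "open (slit j r)"
  unfolding slit_def by (intro open_Int open_ball open_cut_plane)

definition offset :: "'n \<Rightarrow> real \<Rightarrow> real \<Rightarrow> complex" where
  "offset j s t = lam j + (of_real s * cis \<eta> + of_real t * (\<i> * cis \<eta>))"

lemma xc_offset: "xc \<eta> (offset j s t) = xc \<eta> (lam j) + s"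
  and yc_offset: "yc \<eta> (offset j s t) = yc \<eta> (lam j) + t"
  unfolding offset_def xc_add[of \<eta> "lam j"] yc_add[of \<eta> "lam j"] xc_polar yc_polar by (rule refl)+

lemma offset_mem_ball:
  assumes "\<bar>s\<bar> + \<bar>t\<bar> < r"
  shows "offset j s t \<in> ball (lam j) r"
proof -
  have "norm (of_real s * cis \<eta> + of_real t * (\<i> * cis \<eta>)) \<le> \<bar>s\<bar> + \<bar>t\<bar>"
    by (rule order_trans[OF norm_triangle_ineq]) (simp add: norm_mult)
  moreover have "dist (lam j) (offset j s t) = norm (of_real s * cis \<eta> + of_real t * (\<i> * cis \<eta>))"
    unfolding offset_def dist_norm by (metis add_diff_cancel_left' norm_minus_commute)
  ultimately show ?thesis using assms by simp
qed

lemma slit_nonempty: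
  assumes "r > 0" "r \<le> gap j"
  shows "slit j r \<noteq> {}"
proof -
  have "offset j (-(r/3)) 0 \<in> slit j r"
    unfolding mem_slit[OF assms(2)] using offset_mem_ball[of "-(r/3)" 0 r j] assms
    by (simp add: xc_offset)
  then show ?thesis by blast
qed

text \<open>The slit disc is the union of its upper, lower and left halves; these are convex, and
  the left one meets the other two.\<close>

lemma connected_slit:
  assumes r: "r > 0" "r \<le> gap j"
  shows "connected (slit j r)"
proof -
  let ?b = "ball (lam j) r"
  let ?U = "?b \<inter> {z. yc \<eta> (lam j) < yc \<eta> z}" and ?D = "?b \<inter> {z. yc \<eta> z < yc \<eta> (lam j)}"
    and ?L = "?b \<inter> {z. xc \<eta> z < xc \<eta> (lam j)}"
  have 1: "offset j (-(r/3)) (r/3) \<in> ?U \<inter> ?L" and 2: "offset j (-(r/3)) (-(r/3)) \<in> ?D \<inter> ?L"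
    using offset_mem_ball[of "-(r/3)" "r/3" r j] offset_mem_ball[of "-(r/3)" "-(r/3)" r j] r
    by (simp_all add: xc_offset yc_offset)
  have c: "connected ?U" "connected ?D" "connected ?L"
    by (intro convex_connected convex_Int convex_ball open_convex_halfplanes)+
  have UL: "connected (?U \<union> ?L)" by (rule connected_Un) (use 1 c in auto)
  have "?D \<inter> (?U \<union> ?L) \<noteq> {}" using 2 by blast
  from connected_Un[OF c(2) UL this] have "connected (?D \<union> (?U \<union> ?L))" .
  moreover have "slit j r = ?D \<union> (?U \<union> ?L)"
  proof (rule Set.set_eqI)
    fix z
    show "z \<in> slit j r \<longleftrightarrow> z \<in> ?D \<union> (?U \<union> ?L)"
      unfolding mem_slit[OF r(2)] Un_iff Int_iff mem_Collect_eq
      by (cases "yc \<eta> z" "yc \<eta> (lam j)" rule: linorder_cases) (auto simp only: not_le)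
  qed
  ultimately show ?thesis by simp
qed

text \<open>A convex set containing the beginning of the cut but not \<open>lam j\<close>.
  Continuation across the cut is expressed by one holomorphic function on it, compared with given
  functions below and above the cut.\<close>

definition right_half :: "'n \<Rightarrow> real \<Rightarrow> complex set" where
  "right_half j r = ball (lam j) r \<inter> {z. xc \<eta> (lam j) < xc \<eta> z}"

lemma open_right_half: "open (right_half j r)" and convex_right_half: "convex (right_half j r)"
  unfolding right_half_def by (intro open_Int open_ball convex_Int convex_ball open_convex_halfplanes)+

lemma right_half_mono: "r \<le> r' \<Longrightarrow> right_half j r \<subseteq> right_half j r'"
  unfolding right_half_def by auto

lemma right_half_mem_slit:
  "r \<le> gap j \<Longrightarrow> z \<in> right_half j r \<Longrightarrow> yc \<eta> z \<noteq> yc \<eta> (lam j) \<Longrightarrow> z \<in> slit j r"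
  by (simp add: mem_slit right_half_def)

lemma right_half_offset:
  assumes "r > 0"
  shows "\<exists>z\<in>right_half j r. yc \<eta> z < yc \<eta> (lam j)" "\<exists>z\<in>right_half j r. yc \<eta> z > yc \<eta> (lam j)"
proof -
  have "offset j (r/3) (-(r/3)) \<in> right_half j r" "offset j (r/3) (r/3) \<in> right_half j r"
    using offset_mem_ball[of "r/3" "r/3" r j] offset_mem_ball[of "r/3" "-(r/3)" r j] assms
    by (simp_all add: right_half_def xc_offset)
  then show "\<exists>z\<in>right_half j r. yc \<eta> z < yc \<eta> (lam j)" "\<exists>z\<in>right_half j r. yc \<eta> z > yc \<eta> (lam j)"
    using assms yc_offset by (metis less_add_same_cancel1 add_less_same_cancel1 divide_pos_pos neg_less_0_iff_less zero_less_numeral)+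
qed

subsection \<open>Regular functions\<close>

lemma is_reg_iff:
  "is_reg lam \<eta> j f \<longleftrightarrow> (\<exists>r>0. r \<le> gap j \<and> (\<exists>h. h vec_holomorphic_on ball (lam j) r \<and> (\<forall>z\<in>slit j r. f z = h z)))"
    (is "_ \<longleftrightarrow> ?R")
proof
  assume "is_reg lam \<eta> j f"
  then obtain r h where h: "r > 0" "h vec_holomorphic_on ball (lam j) r" "\<forall>z\<in>slit j r. f z = h z"
    unfolding is_reg_def vec_holomorphic_on_def slit_def by auto
  have "slit j (min r (gap j)) \<subseteq> slit j r" by (rule slit_mono) simp
  then show ?R using h gap_pos[of j]
    by (intro exI[of _ "min r (gap j)"] conjI exI[of _ h] vec_holomorphic_on_subset[OF h(2)]) auto
next
  assume ?R
  then show "is_reg lam \<eta> j f"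
    unfolding is_reg_def vec_holomorphic_on_def slit_def by (elim exE conjE) (intro exI conjI; assumption)
qed

lemma is_regI:
  assumes "r > 0" "h vec_holomorphic_on ball (lam j) r" "\<And>z. z \<in> slit j r \<Longrightarrow> f z = h z"
  shows "is_reg lam \<eta> j f"
  unfolding is_reg_def using assms unfolding vec_holomorphic_on_def slit_def
  by (intro exI[of _ r] conjI exI[of _ h]) auto

lemma is_regE:
  assumes "is_reg lam \<eta> j f" "e > 0"
  obtains r h where "r > 0" "r \<le> gap j" "r \<le> e" "h vec_holomorphic_on ball (lam j) r"
    "\<And>z. z \<in> slit j r \<Longrightarrow> f z = h z"
proof -
  obtain r h where h: "r > 0" "r \<le> gap j" "h vec_holomorphic_on ball (lam j) r" "\<forall>z\<in>slit j r. f z = h z"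
    using assms(1) unfolding is_reg_iff by (elim exE conjE)
  have "slit j (min r e) \<subseteq> slit j r" by (rule slit_mono) simp
  then show ?thesis using h assms(2)
    by (intro that[of "min r e" h] vec_holomorphic_on_subset[OF h(3)]) auto
qed

lemma is_reg_cong:
  assumes "is_reg lam \<eta> j g" "r > 0" "\<And>z. z \<in> slit j r \<Longrightarrow> f z = g z"
  shows "is_reg lam \<eta> j f"
proof -
  obtain r' h where h: "r' > 0" "r' \<le> r" "h vec_holomorphic_on ball (lam j) r'"
    "\<And>z. z \<in> slit j r' \<Longrightarrow> g z = h z"
    using is_regE[OF assms(1,2)] by metis
  show ?thesis
    by (rule is_regI[OF h(1,3)]) (metis assms(3) h(4) slit_mono[OF h(2)] subsetD)
qed

lemma is_reg_zero: "is_reg lam \<eta> j (\<lambda>z. 0)"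
  by (rule is_regI[of 1 "\<lambda>z. 0"]) (auto intro: vec_holomorphic_on_const)

lemma is_reg_add_scale:
  assumes "is_reg lam \<eta> j f" "is_reg lam \<eta> j g"
  shows "is_reg lam \<eta> j (\<lambda>z. f z + c *s g z)"
proof -
  obtain r h where h: "r > 0" "h vec_holomorphic_on ball (lam j) r" "\<And>z. z \<in> slit j r \<Longrightarrow> f z = h z"
    using is_regE[OF assms(1) zero_less_one] by metis
  obtain r' h' where h': "r' > 0" "r' \<le> r" "h' vec_holomorphic_on ball (lam j) r'" "\<And>z. z \<in> slit j r' \<Longrightarrow> g z = h' z"
    using is_regE[OF assms(2) h(1)] by metis
  show ?thesis
  proof (rule is_regI[OF h'(1)])
    have "h vec_holomorphic_on ball (lam j) r'"
      by (rule vec_holomorphic_on_subset[OF h(2)]) (use h'(2) in auto)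
    then show "(\<lambda>z. h z + c *s h' z) vec_holomorphic_on ball (lam j) r'"
      using h'(3) by (intro vec_holomorphic_intros) auto
    show "f z + c *s g z = h z + c *s h' z" if "z \<in> slit j r'" for z
      using h(3) h'(4) that slit_mono[OF h'(2)] by (metis subsetD)
  qed
qed

lemma is_reg_scale: "is_reg lam \<eta> j g \<Longrightarrow> is_reg lam \<eta> j (\<lambda>z. c *s g z)"
  using is_reg_add_scale[OF is_reg_zero, of j g c] by simp

lemma is_reg_diff_scale:
  "is_reg lam \<eta> j f \<Longrightarrow> is_reg lam \<eta> j g \<Longrightarrow> is_reg lam \<eta> j (\<lambda>z. f z - c *s g z)"
  using is_reg_add_scale[of j f g "-c"] by (simp add: vector_smult_lneg)

lemma is_reg_sum: "(\<And>k. k \<in> K \<Longrightarrow> is_reg lam \<eta> j (f k)) \<Longrightarrow> is_reg lam \<eta> j (\<lambda>z. \<Sum>k\<in>K. c k *s f k z)"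
proof (induction K rule: infinite_finite_induct)
  case (insert x F)
  have "is_reg lam \<eta> j (\<lambda>z. (\<Sum>k\<in>F. c k *s f k z) + c x *s f x z)"
    by (rule is_reg_add_scale) (use insert in auto)
  then show ?case using insert by (simp add: add.commute)
qed (auto simp: is_reg_zero)

subsection \<open>Jumps\<close>

text \<open>Near \<open>lam j\<close>, \<open>f\<close> continues anticlockwise across the cut to \<open>f + g\<close>.\<close>

definition jump_near :: "'n \<Rightarrow> (complex \<Rightarrow> complex^'n) \<Rightarrow> (complex \<Rightarrow> complex^'n) \<Rightarrow> bool" where
  "jump_near j f g \<longleftrightarrow> (\<exists>r>0. r \<le> gap j \<and> (\<exists>F. F vec_holomorphic_on right_half j r \<and>
     (\<forall>z\<in>right_half j r. (yc \<eta> z < yc \<eta> (lam j) \<longrightarrow> F z = f z) \<and>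
       (yc \<eta> z > yc \<eta> (lam j) \<longrightarrow> F z = f z + g z))))"

lemma jump_nearI:
  assumes "r > 0" "F vec_holomorphic_on right_half j r"
    "\<And>z. z \<in> right_half j r \<Longrightarrow> z \<in> slit j r \<Longrightarrow> yc \<eta> z < yc \<eta> (lam j) \<Longrightarrow> F z = f z"
    "\<And>z. z \<in> right_half j r \<Longrightarrow> z \<in> slit j r \<Longrightarrow> yc \<eta> z > yc \<eta> (lam j) \<Longrightarrow> F z = f z + g z"
  shows "jump_near j f g"
proof -
  let ?r = "min r (gap j)"
  have sub: "right_half j ?r \<subseteq> right_half j r" "slit j ?r \<subseteq> slit j r"
    by (intro right_half_mono slit_mono; simp)+
  have mem: "z \<in> slit j r" if "z \<in> right_half j ?r" "yc \<eta> z \<noteq> yc \<eta> (lam j)" for z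
    using right_half_mem_slit[of ?r j z] that sub(2) by auto
  show ?thesis unfolding jump_near_def
    by (rule exI[of _ ?r])
      (use assms(1) gap_pos[of j] sub(1) mem in \<open>auto intro!: exI[of _ F] vec_holomorphic_on_subset[OF assms(2)] assms(3,4)\<close>)
qed

lemma jump_nearE:
  assumes "jump_near j f g" "e > 0"
  obtains r F where "r > 0" "r \<le> gap j" "r \<le> e" "F vec_holomorphic_on right_half j r"
    "\<And>z. z \<in> right_half j r \<Longrightarrow> yc \<eta> z < yc \<eta> (lam j) \<Longrightarrow> F z = f z"
    "\<And>z. z \<in> right_half j r \<Longrightarrow> yc \<eta> z > yc \<eta> (lam j) \<Longrightarrow> F z = f z + g z"
proof -
  obtain r F where r: "r > 0" "r \<le> gap j" "F vec_holomorphic_on right_half j r"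
     "\<forall>z\<in>right_half j r. (yc \<eta> z < yc \<eta> (lam j) \<longrightarrow> F z = f z) \<and>
       (yc \<eta> z > yc \<eta> (lam j) \<longrightarrow> F z = f z + g z)"
    using assms(1) unfolding jump_near_def by (elim exE conjE)
  have sub: "right_half j (min r e) \<subseteq> right_half j r" by (rule right_half_mono) simp
  show ?thesis
    by (rule that[of "min r e" F])
      (use r assms(2) sub vec_holomorphic_on_subset[OF r(3) sub] in auto)
qed

lemma jump_near_is_reg:
  assumes "is_reg lam \<eta> j f"
  shows "jump_near j f (\<lambda>z. 0)"
proof -
  obtain r h where h: "r > 0" "h vec_holomorphic_on ball (lam j) r" "\<And>z. z \<in> slit j r \<Longrightarrow> f z = h z"
    using is_regE[OF assms zero_less_one] by metis
  have "h vec_holomorphic_on right_half j r"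
    by (rule vec_holomorphic_on_subset[OF h(2)]) (auto simp: right_half_def)
  from jump_nearI[OF h(1) this, of f "\<lambda>z. 0"] show ?thesis using h(3) by auto
qed

lemma jump_near_add_scale:
  assumes "jump_near j f g" "jump_near j f' g'"
  shows "jump_near j (\<lambda>z. f z + c *s f' z) (\<lambda>z. g z + c *s g' z)"
proof -
  obtain r F where r: "r > 0" "F vec_holomorphic_on right_half j r"
    "\<And>z. z \<in> right_half j r \<Longrightarrow> yc \<eta> z < yc \<eta> (lam j) \<Longrightarrow> F z = f z"
    "\<And>z. z \<in> right_half j r \<Longrightarrow> yc \<eta> z > yc \<eta> (lam j) \<Longrightarrow> F z = f z + g z"
    using jump_nearE[OF assms(1) zero_less_one] by metis
  obtain r' F' where r': "r' > 0" "r' \<le> r" "F' vec_holomorphic_on right_half j r'"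
    "\<And>z. z \<in> right_half j r' \<Longrightarrow> yc \<eta> z < yc \<eta> (lam j) \<Longrightarrow> F' z = f' z"
    "\<And>z. z \<in> right_half j r' \<Longrightarrow> yc \<eta> z > yc \<eta> (lam j) \<Longrightarrow> F' z = f' z + g' z"
    using jump_nearE[OF assms(2) r(1)] by metis
  have sub: "right_half j r' \<subseteq> right_half j r" by (rule right_half_mono[OF r'(2)])
  have "(\<lambda>z. F z + c *s F' z) vec_holomorphic_on right_half j r'"
    using r'(3) vec_holomorphic_on_subset[OF r(2) sub] by (intro vec_holomorphic_intros) auto
  then show ?thesis
    by (rule jump_nearI[OF r'(1)])
      (use r(3,4) r'(4,5) sub in \<open>auto simp: subset_iff vector_add_ldistrib algebra_simps\<close>)
qed

text \<open>The function that realizes the continuation is determined by its values below the cut,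
  by the identity theorem on the convex right half-disc.\<close>

lemma jump_near_unique:
  assumes "jump_near j f g" "jump_near j f g'"
  obtains r where "r > 0" "r \<le> gap j"
    "\<And>z. z \<in> right_half j r \<Longrightarrow> yc \<eta> z > yc \<eta> (lam j) \<Longrightarrow> g z = g' z"
proof -
  obtain r F where r: "r > 0" "r \<le> gap j" "F vec_holomorphic_on right_half j r"
    "\<And>z. z \<in> right_half j r \<Longrightarrow> yc \<eta> z < yc \<eta> (lam j) \<Longrightarrow> F z = f z"
    "\<And>z. z \<in> right_half j r \<Longrightarrow> yc \<eta> z > yc \<eta> (lam j) \<Longrightarrow> F z = f z + g z"
    using jump_nearE[OF assms(1) zero_less_one] by metis
  obtain r' F' where r': "r' > 0" "r' \<le> r" "F' vec_holomorphic_on right_half j r'"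
    "\<And>z. z \<in> right_half j r' \<Longrightarrow> yc \<eta> z < yc \<eta> (lam j) \<Longrightarrow> F' z = f z"
    "\<And>z. z \<in> right_half j r' \<Longrightarrow> yc \<eta> z > yc \<eta> (lam j) \<Longrightarrow> F' z = f z + g' z"
    using jump_nearE[OF assms(2) r(1)] by metis
  have sub: "right_half j r' \<subseteq> right_half j r" by (rule right_half_mono[OF r'(2)])
  let ?W = "right_half j r' \<inter> {z. yc \<eta> z < yc \<eta> (lam j)}"
  have eq: "F z = F' z" if "z \<in> right_half j r'" for z
  proof (rule vec_analytic_continuation[of ?W "right_half j r'"])
    show "open ?W" by (intro open_Int open_right_half open_convex_halfplanes)
    show "?W \<noteq> {}" using right_half_offset(1)[OF r'(1)] by auto
    show "F w = F' w" if "w \<in> ?W" for w using that r(4) r'(4) sub by auto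
  qed (use that open_right_half convex_connected[OF convex_right_half] r' vec_holomorphic_on_subset[OF r(3) sub] in auto)
  show ?thesis
  proof (rule that[OF r'(1)])
    show "r' \<le> gap j" using r'(2) r(2) by simp
    fix z assume z: "z \<in> right_half j r'" "yc \<eta> z > yc \<eta> (lam j)"
    have "f z + g z = f z + g' z" using r(5)[of z] r'(5)[of z] eq[of z] z sub by auto
    then show "g z = g' z" by simp
  qed
qed

lemma jump_near_cut_ln:
  assumes "is_reg lam \<eta> j f"
  shows "jump_near j (\<lambda>z. cut_ln \<eta> (z - lam j) *s f z) (\<lambda>z. (2 * of_real pi * \<i>) *s f z)"
proof -
  obtain r h where h: "r > 0" "h vec_holomorphic_on ball (lam j) r" "\<And>z. z \<in> slit j r \<Longrightarrow> f z = h z"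
    using is_regE[OF assms zero_less_one] by metis
  have pos: "xc \<eta> (z - lam j) > 0" if "z \<in> right_half j r" for z
    using that by (simp add: right_half_def xc_diff)
  have hol: "(\<lambda>z. right_ln \<eta> (z - lam j) *s h z) vec_holomorphic_on right_half j r"
    by (intro vec_holomorphic_on_scale vec_holomorphic_on_subset[OF h(2)] right_ln_holomorphic
        holomorphic_intros pos) (auto simp: right_half_def)
  show ?thesis
  proof (rule jump_nearI[OF h(1) hol])
    fix z assume z: "z \<in> right_half j r" "z \<in> slit j r"
    show "right_ln \<eta> (z - lam j) *s h z = cut_ln \<eta> (z - lam j) *s f z" if "yc \<eta> z < yc \<eta> (lam j)"
      using cut_ln_eq_right_ln(1)[OF pos[OF z(1)]] that h(3)[OF z(2)] by (simp add: yc_diff)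
    show "right_ln \<eta> (z - lam j) *s h z = cut_ln \<eta> (z - lam j) *s f z + (2 * of_real pi * \<i>) *s f z"
      if "yc \<eta> (lam j) < yc \<eta> z"
    proof -
      have "right_ln \<eta> (z - lam j) = cut_ln \<eta> (z - lam j) + 2 * of_real pi * \<i>"
        using cut_ln_eq_right_ln(2)[OF pos[OF z(1)]] that by (simp add: yc_diff)
      then show ?thesis using h(3)[OF z(2)] by (simp add: vec_eq_iff algebra_simps)
    qed
  qed
qed

text \<open>Replacing the cut branch of the logarithm by \<open>right_ln\<close> continues the power
  across the cut; above the cut the exponent has grown by \<open>2 * pi * \<i> * a\<close>.\<close>

lemma jump_near_cut_pow:
  assumes r: "r > 0" and h: "h vec_holomorphic_on ball (lam j) r"
    and f: "\<And>z. z \<in> slit j r \<Longrightarrow> f z = cut_pow \<eta> (z - lam j) a *s h z"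
  shows "jump_near j f (\<lambda>z. (exp (2 * of_real pi * \<i> * a) - 1) *s f z)"
proof -
  have pos: "xc \<eta> (z - lam j) > 0" if "z \<in> right_half j r" for z
    using that by (simp add: right_half_def xc_diff)
  have hol: "(\<lambda>z. exp (a * right_ln \<eta> (z - lam j)) *s h z) vec_holomorphic_on right_half j r"
    by (intro vec_holomorphic_on_scale vec_holomorphic_on_subset[OF h] holomorphic_intros
        right_ln_holomorphic pos) (auto simp: right_half_def)
  show ?thesis
  proof (rule jump_nearI[OF r hol])
    fix z assume z: "z \<in> right_half j r" "z \<in> slit j r"
    show "exp (a * right_ln \<eta> (z - lam j)) *s h z = f z" if "yc \<eta> z < yc \<eta> (lam j)"
      using cut_ln_eq_right_ln(1)[OF pos[OF z(1)]] that f[OF z(2)] by (simp add: yc_diff cut_pow_def)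
    show "exp (a * right_ln \<eta> (z - lam j)) *s h z = f z + (exp (2 * of_real pi * \<i> * a) - 1) *s f z"
      if "yc \<eta> (lam j) < yc \<eta> z"
    proof -
      have "cut_ln \<eta> (z - lam j) = right_ln \<eta> (z - lam j) - 2 * of_real pi * \<i>"
        using cut_ln_eq_right_ln(2)[OF pos[OF z(1)]] that by (simp add: yc_diff)
      then have "right_ln \<eta> (z - lam j) = cut_ln \<eta> (z - lam j) + 2 * of_real pi * \<i>" by simp
      then have "exp (a * right_ln \<eta> (z - lam j)) = exp (2 * of_real pi * \<i> * a) * cut_pow \<eta> (z - lam j) a"
        by (simp add: cut_pow_def exp_add[symmetric] algebra_simps)
      then show ?thesis using f[OF z(2)] by (simp add: vec_eq_iff algebra_simps)
    qed
  qed
qed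

subsection \<open>Expansions\<close>

text \<open>Convergence at a single point other than \<open>lam k\<close> bounds the terms of the
  series and hence its coefficients geometrically. This provides the holomorphic power series that
  all later uses of an expansion need.\<close>

lemma has_expansionE:
  assumes "has_expansion lam \<eta> k v a \<psi>"
  obtains r b where "r > 0" "r \<le> gap k" "geometric_bound b" "b 0 = v"
    "(\<lambda>z. \<chi> i. powser (\<lambda>l. b l $ i) (z - lam k)) vec_holomorphic_on ball (lam k) r"
    "\<And>z. z \<in> slit k r \<Longrightarrow> \<psi> z = cut_pow \<eta> (z - lam k) a *s (\<chi> i. powser (\<lambda>l. b l $ i) (z - lam k))"
proof -
  obtain r b where r: "r > 0" "b 0 = v" and
    E: "\<And>z. z \<in> slit k r \<Longrightarrow> \<exists>s. (\<lambda>l. (z - lam k) ^ l *s b l) sums s \<and> \<psi> z = cut_pow \<eta> (z - lam k) a *s s"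
    using assms unfolding has_expansion_def slit_def by auto
  have sums: "(\<lambda>l. b l $ i * (z - lam k) ^ l) sums s $ i" if "(\<lambda>l. (z - lam k) ^ l *s b l) sums s" for z s i
    using bounded_linear.sums[OF bounded_linear_vec_nth that, of i] by (simp add: mult.commute)
  have E': "\<psi> z = cut_pow \<eta> (z - lam k) a *s (\<chi> i. powser (\<lambda>l. b l $ i) (z - lam k))" if z: "z \<in> slit k r" for z
  proof -
    obtain s where s: "(\<lambda>l. (z - lam k) ^ l *s b l) sums s" "\<psi> z = cut_pow \<eta> (z - lam k) a *s s"
      using E[OF z] by (elim exE conjE)
    have "(\<chi> i. powser (\<lambda>l. b l $ i) (z - lam k)) = s"
      unfolding vec_eq_iff powser_def vec_lambda_beta using sums[OF s(1)] by (auto simp: sums_iff)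
    then show ?thesis using s(2) by simp
  qed
  have "slit k (min r (gap k)) \<noteq> {}" using r gap_pos[of k] by (intro slit_nonempty) auto
  then obtain z where z: "z \<in> slit k r" using slit_mono[of "min r (gap k)" r k] by auto
  then have z0: "z \<noteq> lam k" using slit_disjoint by blast
  obtain s where s: "(\<lambda>l. (z - lam k) ^ l *s b l) sums s" using E[OF z] by (elim exE conjE)
  have "\<exists>K. \<forall>l. cmod (b l $ i * (z - lam k) ^ l) \<le> K" for i
  proof -
    have "(\<lambda>l. b l $ i * (z - lam k) ^ l) \<longlonglongrightarrow> 0"
      using sums_summable[OF sums[OF s]] by (rule summable_LIMSEQ_zero)
    then show ?thesis using convergent_imp_Bseq[of "\<lambda>l. b l $ i * (z - lam k) ^ l"]
      unfolding Bseq_def convergent_def by blast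
  qed
  then obtain K where K: "\<And>i l. cmod (b l $ i * (z - lam k) ^ l) \<le> K i" by metis
  define x where "x = cmod (z - lam k)"
  have x: "x > 0" using z0 by (simp add: x_def)
  have gb: "geometric_bound b"
    unfolding geometric_bound_def
  proof (rule exI[of _ "Max (range K)"], rule exI[of _ "1 / x"], intro conjI allI)
    fix l i
    have "cmod (b l $ i) * x ^ l \<le> K i" using K[where i = i and l = l] by (simp add: x_def norm_mult norm_power)
    also have "\<dots> \<le> Max (range K)" by simp
    finally show "cmod (b l $ i) \<le> Max (range K) * (1 / x) ^ l"
      using x by (simp add: power_divide pos_le_divide_eq)
  qed (use x in simp)
  obtain r' where r': "r' > 0" "(\<lambda>z. \<chi> i. powser (\<lambda>l. b l $ i) (z - lam k)) vec_holomorphic_on ball (lam k) r'"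
    by (rule vec_holomorphic_on_powser[OF gb])
  let ?r = "min r (min r' (gap k))"
  have sub: "slit k ?r \<subseteq> slit k r" by (rule slit_mono) simp
  show ?thesis
  proof (rule that[of ?r b, OF _ _ gb r(2)])
    show "(\<lambda>z. \<chi> i. powser (\<lambda>l. b l $ i) (z - lam k)) vec_holomorphic_on ball (lam k) ?r"
      by (rule vec_holomorphic_on_subset[OF r'(2)]) auto
  qed (use r r' gap_pos[of k] sub E' in auto)
qed

lemma zero_on_slit_imp_zero:
  assumes "h vec_holomorphic_on ball (lam k) r" "0 < r" "r \<le> gap k" "\<And>z. z \<in> slit k r \<Longrightarrow> h z = 0"
    and "z \<in> ball (lam k) r"
  shows "h z = 0"
  by (rule vec_analytic_continuation[of "slit k r" "ball (lam k) r" h "\<lambda>_. 0"])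
    (use assms open_slit slit_nonempty slit_subset in \<open>auto intro: vec_holomorphic_on_const\<close>)

lemma has_expansion_nonzero:
  assumes "has_expansion lam \<eta> k v a \<psi>" "v \<noteq> 0"
  shows "\<exists>z\<in>cut_plane lam \<eta>. \<psi> z \<noteq> 0"
proof (rule ccontr)
  assume "\<not> ?thesis"
  then have z0: "\<psi> z = 0" if "z \<in> slit k r" for z r using that slit_subset by blast
  obtain r b where r: "r > 0" "r \<le> gap k" and gb: "geometric_bound b" and b0: "b 0 = v" and
    h: "(\<lambda>z. \<chi> i. powser (\<lambda>l. b l $ i) (z - lam k)) vec_holomorphic_on ball (lam k) r"
    "\<And>z. z \<in> slit k r \<Longrightarrow> \<psi> z = cut_pow \<eta> (z - lam k) a *s (\<chi> i. powser (\<lambda>l. b l $ i) (z - lam k))"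
    using that by (rule has_expansionE[OF assms(1)])
  have "(\<chi> i. powser (\<lambda>l. b l $ i) (lam k - lam k)) = 0"
  proof (rule zero_on_slit_imp_zero[OF h(1) r])
    fix z assume z: "z \<in> slit k r"
    have "cut_pow \<eta> (z - lam k) a \<noteq> 0" by (simp add: cut_pow_def)
    then show "(\<chi> i. powser (\<lambda>l. b l $ i) (z - lam k)) = 0"
      using h(2)[OF z] z0[OF z] by (metis vector_mul_eq_0)
  qed (use r in simp)
  then have "v = 0" using b0 by (simp add: powser_0 vec_eq_iff)
  then show False using assms(2) by simp
qed

text \<open>Linear independence of the columns as functions becomes invertibility at each point,
  because a combination vanishing at one point vanishes everywhere. Solving for the value of
  \<open>f\<close> at one point then represents \<open>f\<close> on all of \<open>S\<close>.\<close>

lemma solutions_spanned: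
  fixes B :: "complex \<Rightarrow> complex^'n^'n"
  assumes S: "open S" "connected S" "S \<noteq> {}" "S \<inter> range lam = {}"
    and B: "\<And>i. is_solution lam A1 S (\<lambda>z. column i (B z))"
    and indep: "\<And>x. (\<And>z. z \<in> S \<Longrightarrow> B z *v x = 0) \<Longrightarrow> x = 0"
    and f: "is_solution lam A1 S f"
  shows "\<exists>x. \<forall>z\<in>S. f z = B z *v x" and "\<And>p. p \<in> S \<Longrightarrow> invertible (B p)"
proof -
  have sol: "is_solution lam A1 S (\<lambda>z. B z *v x)" for x
    by (rule is_solution_matrix_vector_mult[OF B])
  show inv: "invertible (B p)" if p: "p \<in> S" for p
    unfolding invertible_left_inverse matrix_left_invertible_ker
  proof (intro allI impI)
    fix x assume x: "B p *v x = 0"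
    show "x = 0"
      by (rule indep, rule is_solution_unique[OF sol is_solution_zero S(1,2,4) p]) (use x in auto)
  qed
  from S(3) obtain p where p: "p \<in> S" by blast
  obtain x where "B p *v x = f p"
    using inv[OF p] unfolding invertible_right_inverse matrix_right_invertible_surjective by (metis surjD)
  then have "f z = B z *v x" if "z \<in> S" for z
    using is_solution_unique[OF f sol S(1,2,4) p _ that] by simp
  then show "\<exists>x. \<forall>z\<in>S. f z = B z *v x" by blast
qed

end

section \<open>Local structure of the solutions at a singular point\<close>

context cut_system
begin

text \<open>Without resonance the recursion runs for arbitrary entries of \<open>b 0\<close> off
  \<open>k\<close>; unit vectors as data give the \<open>n - 1\<close> independent regular
  solutions.\<close>

lemma regular_local_solution:
  assumes "\<And>l. A1 $ k $ k + 1 + of_nat l \<noteq> 0"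
  obtains r h where "r > 0" "is_solution lam A1 (ball (lam k) r) h" "\<And>i. i \<noteq> k \<Longrightarrow> h (lam k) $ i = u $ i"
proof -
  have gb0: "geometric_bound (\<lambda>l. 0 :: complex^'n)"
    unfolding geometric_bound_def by (intro exI[of _ 0] exI[of _ 1]) simp
  obtain b where b: "geometric_bound b" "\<And>i. i \<noteq> k \<Longrightarrow> b 0 $ i = u $ i"
    "\<And>l i. i \<noteq> k \<or> A1 $ k $ k + 1 + of_nat l \<noteq> 0 \<Longrightarrow> series_residual lam A1 k (\<lambda>l. 0) b l i = 0"
    using that by (rule local_recursion[OF inj_lam gb0, of k u A1])
  have res: "series_residual lam A1 k (\<lambda>l. 0) b l i = 0" for l i using b(3) assms by simp
  obtain r where r: "r > 0" "\<And>z i. z \<in> ball (lam k) r \<Longrightarrow> \<exists>d.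
       ((\<lambda>w. powser (\<lambda>l. b l $ i) (w - lam k)) has_field_derivative d) (at z) \<and>
       (lam i - z) * d = ((A1 + mat 1) *v (\<chi> k'. powser (\<lambda>l. b l $ k') (z - lam k))) $ i
          + powser (\<lambda>l. (0 :: complex^'n) $ i) (z - lam k)"
    using that by (rule local_series_solution[OF b(1) gb0 res])
  define h where "h z = (\<chi> i. powser (\<lambda>l. b l $ i) (z - lam k))" for z
  have "is_solution lam A1 (ball (lam k) r) h"
    unfolding is_solution_iff
  proof
    fix z assume z: "z \<in> ball (lam k) r"
    have "\<forall>i. \<exists>d. ((\<lambda>w. h w $ i) has_field_derivative d) (at z) \<and> (lam i - z) * d = ((A1 + mat 1) *v h z) $ i"
    proof
      fix i show "\<exists>d. ((\<lambda>w. h w $ i) has_field_derivative d) (at z) \<and> (lam i - z) * d = ((A1 + mat 1) *v h z) $ i"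
        using r(2)[OF z, of i] by (simp add: h_def powser_def)
    qed
    then obtain D where "\<forall>i. ((\<lambda>w. h w $ i) has_field_derivative D i) (at z) \<and> (lam i - z) * D i = ((A1 + mat 1) *v h z) $ i"
      by (rule choice[THEN exE])
    then show "\<exists>D :: complex^'n. \<forall>i. ((\<lambda>w. h w $ i) has_field_derivative D $ i) (at z) \<and>
         (lam i - z) * D $ i = ((A1 + mat 1) *v h z) $ i"
      by (intro exI[of _ "\<chi> i. D i"]) simp
  qed
  moreover have "h (lam k) $ i = u $ i" if "i \<noteq> k" for i using b(2)[OF that] by (simp add: h_def powser_0)
  ultimately show ?thesis using that r(1) by blast
qed

text \<open>Substituting \<open>h + c ln(z - lam k) \<psi>\<close> leaves for \<open>h\<close> the
  system with an inhomogeneity that comes from differentiating the logarithm. Since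
  \<open>\<psi>\<close> starts with a multiple of the \<open>k\<close>-th unit vector at order
  \<open>m\<close>, this inhomogeneity acts first at the resonant index and in the resonant row,
  which is what the constant \<open>c\<close> needs to remove the obstruction.\<close>

lemma resonant_log_solution:
  assumes m: "A1 $ k $ k + 1 + of_nat m = 0"
    and \<psi>: "is_solution lam A1 (slit k r0) \<psi>" and r0: "r0 > 0" "r0 \<le> gap k"
    and e: "geometric_bound e" "e 0 = w *s axis k 1" "w \<noteq> 0"
    and \<psi>_eq: "\<And>z. z \<in> slit k r0 \<Longrightarrow> \<psi> z = (z - lam k) ^ m *s (\<chi> i. powser (\<lambda>l. e l $ i) (z - lam k))"
  obtains c r h where "r > 0" "h vec_holomorphic_on ball (lam k) r" "\<And>i. i \<noteq> k \<Longrightarrow> h (lam k) $ i = u $ i"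
    "is_solution lam A1 (slit k r) (\<lambda>z. h z + c *s (cut_ln \<eta> (z - lam k) *s \<psi> z))"
proof -
  define a where "a l = (if l < m then 0 else e (l - m))" for l
  \<comment> \<open>With \<open>a\<close> the Taylor coefficients of \<open>\<psi>\<close>, these
    are the coefficients of \<open>- (lam i - z) / (z - lam k) * \<psi> z $ i\<close>, rewritten as
    \<open>\<psi> z $ i - (lam i - lam k) * \<psi> z $ i / (z - lam k)\<close>.\<close>
  define g :: "nat \<Rightarrow> complex^'n" where "g l = (\<chi> i. a l $ i - (lam i - lam k) * a (Suc l) $ i)" for l
  obtain K \<rho> where K: "\<rho> > 0" "\<And>l i. cmod (e l $ i) \<le> K * \<rho> ^ l"
    using e(1) unfolding geometric_bound_def by auto
  have K0: "K \<ge> 0" using order_trans[OF norm_ge_zero K(2)[of 0]] by simp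
  define K' where "K' = K / \<rho> ^ m"
  have K': "K' \<ge> 0" using K0 K(1) by (simp add: K'_def)
  have a_le: "cmod (a l $ i) \<le> K' * \<rho> ^ l" for l i
  proof (cases "l < m")
    case True then show ?thesis using K' K(1) by (simp add: a_def)
  next
    case False
    then have "K' * \<rho> ^ l = K * \<rho> ^ (l - m)" using K(1) by (simp add: K'_def power_diff)
    then show ?thesis using K(2)[of "l - m" i] False by (simp add: a_def)
  qed
  define M where "M = (\<Sum>i\<in>UNIV. cmod (lam i - lam k))"
  have M: "cmod (lam i - lam k) \<le> M" for i unfolding M_def by (rule member_le_sum) auto
  have "geometric_bound g" unfolding geometric_bound_def
  proof (rule exI[of _ "K' + M * (K' * \<rho>)"], rule exI[of _ \<rho>], intro conjI allI)
    fix l i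
    have "cmod (g l $ i) \<le> cmod (a l $ i) + cmod (lam i - lam k) * cmod (a (Suc l) $ i)"
      unfolding g_def vec_lambda_beta by (rule order_trans[OF norm_triangle_ineq4]) (simp add: norm_mult)
    also have "\<dots> \<le> K' * \<rho> ^ l + M * (K' * \<rho> ^ Suc l)"
      by (intro add_mono mult_mono a_le M) (auto simp: M_def sum_nonneg)
    also have "\<dots> = (K' + M * (K' * \<rho>)) * \<rho> ^ l" by (simp add: algebra_simps)
    finally show "cmod (g l $ i) \<le> (K' + M * (K' * \<rho>)) * \<rho> ^ l" .
  qed (rule K(1))
  \<comment> \<open>The case \<open>l = m\<close> matters: \<open>e 0\<close> is a multiple of the
    \<open>k\<close>-th unit vector, and the factor \<open>lam i - lam k\<close> kills its only
    nonzero entry. Hence \<open>g\<close> starts no earlier than index \<open>m\<close>, and no pole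
    arises even for \<open>m = 0\<close>.\<close>
  have a0: "(lam i - lam k) * a l $ i = 0" if "l \<le> m" for l i
    using that by (auto simp: a_def e(2) axis_def)
  have g0: "g l = 0" if "l < m" for l
  proof -
    have "a l = 0" using that by (simp add: a_def)
    moreover have "(lam i - lam k) * a (Suc l) $ i = 0" for i using that by (intro a0) simp
    ultimately show ?thesis by (simp add: g_def vec_eq_iff del: mult_eq_0_iff)
  qed
  have gm: "g m $ k \<noteq> 0" using e(2,3) by (simp add: g_def a_def)
  obtain b c where b: "geometric_bound b" "\<And>i. i \<noteq> k \<Longrightarrow> b 0 $ i = u $ i"
    "\<And>l i. series_residual lam A1 k (\<lambda>l. c *s g l) b l i = 0"
  proof (rule local_recursion_resonant[OF inj_lam \<open>geometric_bound g\<close> m _ gm, where u = u])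
    show "g l = 0" if "l < m" for l by (rule g0[OF that])
  qed (rule that)
  have "geometric_bound (\<lambda>l. 0 + c *s g l)"
    by (rule geometric_bound_add_scale[OF _ \<open>geometric_bound g\<close>])
      (auto simp: geometric_bound_def intro!: exI[of _ 0] exI[of _ 1])
  then have cg: "geometric_bound (\<lambda>l. c *s g l)" by simp
  obtain r1 where r1: "r1 > 0" "\<And>z i. z \<in> ball (lam k) r1 \<Longrightarrow> \<exists>d.
       ((\<lambda>w. powser (\<lambda>l. b l $ i) (w - lam k)) has_field_derivative d) (at z) \<and>
       (lam i - z) * d = ((A1 + mat 1) *v (\<chi> k'. powser (\<lambda>l. b l $ k') (z - lam k))) $ i
          + powser (\<lambda>l. (c *s g l) $ i) (z - lam k)"
    using that by (rule local_series_solution[OF b(1) cg b(3)])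
  obtain r2 where r2: "r2 > 0" "(\<lambda>z. \<chi> i. powser (\<lambda>l. b l $ i) (z - lam k)) vec_holomorphic_on ball (lam k) r2"
    by (rule vec_holomorphic_on_powser[OF b(1)])
  define h where "h z = (\<chi> i. powser (\<lambda>l. b l $ i) (z - lam k))" for z
  define r where "r = min (min r0 r1) (min r2 (1 / \<rho>))"
  have r: "r > 0" "r \<le> r0" "r \<le> r1" "r \<le> r2" "r \<le> 1 / \<rho>" using r0 r1 r2 K(1) by (auto simp: r_def)
  have hol: "h vec_holomorphic_on ball (lam k) r"
    unfolding h_def[abs_def] by (rule vec_holomorphic_on_subset[OF r2(2)]) (use r in auto)
  have gpow: "powser (\<lambda>l. (c *s g l) $ i) (z - lam k) = - (c * ((lam i - z) / (z - lam k) * \<psi> z $ i))"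
    if z: "z \<in> slit k r" for z i
  proof -
    define x where "x = z - lam k"
    have zb: "z \<in> ball (lam k) r" and z0: "z \<in> slit k r0" using subsetD[OF slit_subset(2) z] subsetD[OF slit_mono[OF r(2)] z] by auto
    have x: "cmod x < 1 / \<rho>" using zb r by (auto simp: x_def dist_norm norm_minus_commute)
    have xnz: "x \<noteq> 0" using z slit_disjoint[of k r] by (auto simp: x_def)
    have "(\<lambda>l. x ^ m * (e l $ i * x ^ l)) sums (x ^ m * powser (\<lambda>l. e l $ i) x)"
      by (rule sums_mult[OF powser_sums[OF K(2) K(1) x]])
    moreover have "x ^ m * (e l $ i * x ^ l) = a (l + m) $ i * x ^ (l + m)" for l
      by (simp add: a_def power_add)
    moreover have "x ^ m * powser (\<lambda>l. e l $ i) x = \<psi> z $ i"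
      using \<psi>_eq[OF z0] by (simp add: x_def)
    ultimately have "(\<lambda>l. a (l + m) $ i * x ^ (l + m)) sums \<psi> z $ i" by simp
    then have s: "(\<lambda>l. a l $ i * x ^ l) sums (\<psi> z $ i)"
      by (subst (asm) sums_iff_shift) (simp add: a_def)
    then have "(\<lambda>l. (\<lambda>l. a l $ i * x ^ l) (Suc l)) sums (\<psi> z $ i - a 0 $ i)"
      by (subst sums_Suc_iff) simp
    then have "(\<lambda>l. a (Suc l) $ i * x ^ Suc l / x) sums ((\<psi> z $ i - a 0 $ i) / x)"
      by (rule sums_divide)
    then have "(\<lambda>l. a (Suc l) $ i * x ^ l) sums ((\<psi> z $ i - a 0 $ i) / x)"
      using xnz by simp
    then have "(\<lambda>l. a l $ i * x ^ l - (lam i - lam k) * (a (Suc l) $ i * x ^ l)) sums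
        (\<psi> z $ i - (lam i - lam k) * ((\<psi> z $ i - a 0 $ i) / x))"
      by (intro sums_diff s sums_mult)
    moreover have "a l $ i * x ^ l - (lam i - lam k) * (a (Suc l) $ i * x ^ l) = g l $ i * x ^ l" for l
      by (simp add: g_def algebra_simps)
    moreover have "\<psi> z $ i - (lam i - lam k) * ((\<psi> z $ i - a 0 $ i) / x) = - ((lam i - z) / x * \<psi> z $ i)"
    proof -
      have "(lam i - lam k) * ((\<psi> z $ i - a 0 $ i) / x) = ((lam i - lam k) * \<psi> z $ i - (lam i - lam k) * a 0 $ i) / x"
        by (simp only: times_divide_eq_right right_diff_distrib)
      also have "\<dots> = (lam i - lam k) * \<psi> z $ i / x" using a0[of 0 i] by simp
      finally have eq: "(lam i - lam k) * ((\<psi> z $ i - a 0 $ i) / x) = (lam i - lam k) * \<psi> z $ i / x" .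
      show ?thesis unfolding eq using xnz by (simp add: x_def field_simps)
    qed
    ultimately have "(\<lambda>l. g l $ i * x ^ l) sums (- ((lam i - z) / x * \<psi> z $ i))" by simp
    then have "(\<lambda>l. c * (g l $ i * x ^ l)) sums (c * (- ((lam i - z) / x * \<psi> z $ i)))" by (rule sums_mult)
    then show ?thesis unfolding powser_def by (simp add: sums_iff x_def mult.assoc)
  qed
  have sol: "is_solution lam A1 (slit k r) (\<lambda>z. h z + c *s (cut_ln \<eta> (z - lam k) *s \<psi> z))"
    unfolding is_solution_iff
  proof
    fix z assume z: "z \<in> slit k r"
    define x where "x = z - lam k"
    let ?L = "cut_ln \<eta> x"
    have zb: "z \<in> ball (lam k) r1" and z0: "z \<in> slit k r0" using subsetD[OF slit_subset(2) z] subsetD[OF slit_mono[OF r(2)] z] r(3) by auto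
    have "\<not> (yc \<eta> z = yc \<eta> (lam k) \<and> xc \<eta> (lam k) \<le> xc \<eta> z)" using z0 mem_slit[OF r0(2)] by simp
    then have "(cut_ln \<eta> has_field_derivative 1 / x) (at x)"
      unfolding x_def by (intro cut_ln_derivative) (auto simp: xc_diff yc_diff)
    moreover have "((\<lambda>w. w - lam k) has_field_derivative 1) (at z)" by (auto intro!: derivative_eq_intros)
    ultimately have Ld: "((\<lambda>z. cut_ln \<eta> (z - lam k)) has_field_derivative 1 / x) (at z)"
      using DERIV_chain2[where f = "cut_ln \<eta>" and g = "\<lambda>w. w - lam k"] unfolding x_def by fastforce
    obtain D :: "complex^'n" where D: "\<forall>i. ((\<lambda>w. \<psi> w $ i) has_field_derivative D $ i) (at z) \<and>
         (lam i - z) * D $ i = ((A1 + mat 1) *v \<psi> z) $ i"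
      using bspec[OF \<psi>[unfolded is_solution_iff] z0] by (elim exE)
    have "\<forall>i. \<exists>d. ((\<lambda>w. h w $ i) has_field_derivative d) (at z) \<and> (lam i - z) * d
        = ((A1 + mat 1) *v h z) $ i - c * ((lam i - z) / x * \<psi> z $ i)"
    proof
      fix i show "\<exists>d. ((\<lambda>w. h w $ i) has_field_derivative d) (at z) \<and> (lam i - z) * d
        = ((A1 + mat 1) *v h z) $ i - c * ((lam i - z) / x * \<psi> z $ i)"
        using r1(2)[OF zb, of i] unfolding gpow[OF z] by (simp add: h_def x_def)
    qed
    then obtain d where d: "\<forall>i. ((\<lambda>w. h w $ i) has_field_derivative d i) (at z) \<and> (lam i - z) * d i
        = ((A1 + mat 1) *v h z) $ i - c * ((lam i - z) / x * \<psi> z $ i)"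
      by (rule choice[THEN exE])
    show "\<exists>D :: complex^'n. \<forall>i. ((\<lambda>w. (h w + c *s (cut_ln \<eta> (w - lam k) *s \<psi> w)) $ i) has_field_derivative D $ i) (at z) \<and>
         (lam i - z) * D $ i = ((A1 + mat 1) *v (h z + c *s (cut_ln \<eta> (z - lam k) *s \<psi> z))) $ i"
    proof (intro exI[of _ "\<chi> i. d i + c * (?L * D $ i + 1 / x * \<psi> z $ i)"] allI conjI)
      fix i
      have "((\<lambda>w. h w $ i + c * (cut_ln \<eta> (w - lam k) * \<psi> w $ i)) has_field_derivative
          d i + c * (?L * D $ i + 1 / x * \<psi> z $ i)) (at z)"
        unfolding x_def using D d Ld
        by (intro DERIV_add DERIV_cmult DERIV_mult') (auto simp: x_def)
      then show "((\<lambda>w. (h w + c *s (cut_ln \<eta> (w - lam k) *s \<psi> w)) $ i) has_field_derivative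
          (\<chi> i. d i + c * (?L * D $ i + 1 / x * \<psi> z $ i)) $ i) (at z)" by (simp add: mult.assoc)
      have "(lam i - z) * (d i + c * (?L * D $ i + 1 / x * \<psi> z $ i)) =
          (lam i - z) * d i + c * ?L * ((lam i - z) * D $ i) + c * ((lam i - z) / x * \<psi> z $ i)"
        by (simp add: algebra_simps)
      also have "\<dots> = ((A1 + mat 1) *v h z) $ i + c * ?L * ((A1 + mat 1) *v \<psi> z) $ i"
        using d D by simp
      also have "\<dots> = ((A1 + mat 1) *v (h z + c *s (?L *s \<psi> z))) $ i"
        by (simp add: matrix_vector_right_distrib vector_scalar_commute mult.assoc)
      finally show "(lam i - z) * (\<chi> i. d i + c * (?L * D $ i + 1 / x * \<psi> z $ i)) $ i =
          ((A1 + mat 1) *v (h z + c *s (cut_ln \<eta> (z - lam k) *s \<psi> z))) $ i"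
        by (simp add: x_def)
    qed
  qed
  have "h (lam k) $ i = u $ i" if "i \<noteq> k" for i using b(2)[OF that] by (simp add: h_def powser_0)
  with that r(1) hol sol show ?thesis by blast
qed

text \<open>The solutions \<open>h i + \<kappa> i L\<close> form a local basis, and \<open>L\<close> carries all of the singular behaviour.\<close>

lemma local_decomposition:
  fixes h :: "'n \<Rightarrow> complex \<Rightarrow> complex^'n"
  assumes r: "r > 0" "r \<le> gap k"
    and h: "\<And>i. h i vec_holomorphic_on ball (lam k) r"
      "\<And>i i'. i' \<noteq> k \<Longrightarrow> h i (lam k) $ i' = (if i = i' then 1 else 0)"
    and sol: "\<And>i. is_solution lam A1 (slit k r) (\<lambda>z. h i z + \<kappa> i *s L z)"
    and L: "\<And>c. is_reg lam \<eta> k (\<lambda>z. c *s L z) \<Longrightarrow> c = 0"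
    and nz: "\<exists>z\<in>slit k r. h k z + \<kappa> k *s L z \<noteq> 0"
    and f: "is_solution lam A1 (slit k r) f"
  shows "\<exists>c. is_reg lam \<eta> k (\<lambda>z. f z - c *s L z)"
proof -
  define B :: "complex \<Rightarrow> complex^'n^'n" where "B z = (\<chi> i' i. (h i z + \<kappa> i *s L z) $ i')" for z
  have col: "column i (B z) = h i z + \<kappa> i *s L z" for i z by (simp add: B_def column_def vec_eq_iff)
  have B: "B z *v x = (\<Sum>i\<in>UNIV. x $ i *s h i z) + (\<Sum>i\<in>UNIV. x $ i * \<kappa> i) *s L z" for z x
    unfolding matrix_mult_sum col
    by (simp add: vector_add_ldistrib sum.distrib vec.scale_sum_left)
  have hx: "(\<lambda>z. \<Sum>i\<in>UNIV. x $ i *s h i z) vec_holomorphic_on ball (lam k) r" for x :: "complex^'n"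
    by (intro vec_holomorphic_intros h(1)) auto
  have regx: "is_reg lam \<eta> k (\<lambda>z. \<Sum>i\<in>UNIV. x $ i *s h i z)" for x :: "complex^'n"
    by (rule is_regI[OF r(1) hx]) simp
  have at_lam: "(\<Sum>i\<in>UNIV. x $ i *s h i (lam k)) $ i' = x $ i'" if "i' \<noteq> k" for x :: "complex^'n" and i'
  proof -
    have "(\<Sum>i\<in>UNIV. x $ i *s h i (lam k)) $ i' = (\<Sum>i\<in>UNIV. if i = i' then x $ i else 0)"
      unfolding sum_component using h(2)[OF that] by (intro sum.cong) auto
    then show ?thesis by simp
  qed
  \<comment> \<open>In a vanishing combination the coefficient of \<open>L\<close> is zero because
    \<open>L\<close> is not regular. Evaluating the regular part at \<open>lam k\<close> then gives
    \<open>x $ i = 0\<close> for \<open>i \<noteq> k\<close>, and \<open>nz\<close> excludes the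
    remaining multiple of the \<open>k\<close>-th solution.\<close>
  have indep: "x = 0" if x: "\<And>z. z \<in> slit k r \<Longrightarrow> B z *v x = 0" for x
  proof -
    let ?c = "\<Sum>i\<in>UNIV. x $ i * \<kappa> i"
    have "is_reg lam \<eta> k (\<lambda>z. (-1) *s (\<Sum>i\<in>UNIV. x $ i *s h i z))" by (rule is_reg_scale[OF regx])
    then have "is_reg lam \<eta> k (\<lambda>z. ?c *s L z)"
    proof (rule is_reg_cong[OF _ r(1)])
      fix z assume "z \<in> slit k r"
      from x[OF this] have "?c *s L z = - (\<Sum>i\<in>UNIV. x $ i *s h i z)" unfolding B by (metis add_eq_0_iff)
      then show "?c *s L z = (-1) *s (\<Sum>i\<in>UNIV. x $ i *s h i z)" by (simp add: vec_eq_iff)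
    qed
    then have c: "?c = 0" by (rule L)
    have "(\<Sum>i\<in>UNIV. x $ i *s h i (lam k)) = 0"
      by (rule zero_on_slit_imp_zero[OF hx r]) (use x B c r in auto)
    then have xi: "x $ i' = 0" if "i' \<noteq> k" for i' using at_lam[OF that, of x] by simp
    from nz obtain z where z: "z \<in> slit k r" "h k z + \<kappa> k *s L z \<noteq> 0" by blast
    have "B z *v x = (\<Sum>i\<in>UNIV. if i = k then x $ k *s (h k z + \<kappa> k *s L z) else 0)"
      unfolding matrix_mult_sum col by (intro sum.cong) (auto simp: xi)
    then have "x $ k *s (h k z + \<kappa> k *s L z) = 0" using x[OF z(1)] by simp
    then have "x $ k = 0" using z(2) by (metis vector_mul_eq_0)
    with xi have "x $ i' = 0" for i' by (cases "i' = k") auto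
    then show "x = 0" by (simp add: vec_eq_iff)
  qed
  have solB: "is_solution lam A1 (slit k r) (\<lambda>z. column i (B z))" for i
    unfolding col by (rule sol)
  have "\<exists>x. \<forall>z\<in>slit k r. f z = B z *v x"
    by (rule solutions_spanned(1)[OF open_slit connected_slit[OF r] slit_nonempty[OF r] slit_disjoint solB _ f])
      (rule indep)
  then obtain x where x: "\<forall>z\<in>slit k r. f z = B z *v x" by (elim exE)
  have "is_reg lam \<eta> k (\<lambda>z. f z - (\<Sum>i\<in>UNIV. x $ i * \<kappa> i) *s L z)"
    by (rule is_reg_cong[OF regx[of x] r(1)]) (use x B in auto)
  then show ?thesis by blast
qed

end

section \<open>The distinguished solutions\<close>

locale distinguished = cut_system lam A1 \<eta>
  for lam :: "'n::finite \<Rightarrow> complex" and A1 :: "complex^'n^'n" and \<eta> :: real +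
  fixes Psi Psing :: "'n \<Rightarrow> complex \<Rightarrow> complex^'n" and C :: "complex^'n^'n"
  assumes is_Psi: "is_Psi lam A1 \<eta> k (Psi k)"
    and is_Psing: "is_Psi_sing lam A1 \<eta> k (Psi k) (Psing k)"
    and is_C: "is_connection_matrix lam \<eta> Psi Psing C"
begin

abbreviation "P \<equiv> cut_plane lam \<eta>"

lemma solution_Psi: "is_solution lam A1 P (Psi k)"
  using is_Psi[of k] unfolding is_Psi_def by (elim conjE)

lemma solution_zero:
  assumes "is_solution lam A1 P f" "p \<in> P" "f p = 0" "z \<in> P"
  shows "f z = 0"
  using is_solution_unique[OF assms(1) is_solution_zero open_cut_plane connected_cut_plane
      cut_plane_disjoint assms(2) _ assms(4)] assms(3) by simp

text \<open>Negative integers are written as \<open>- m - 1\<close>, through the resonance condition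
  of the recursion; the same \<open>m\<close> is the order of vanishing of \<open>Psi k\<close> at
  \<open>lam k\<close>.\<close>

lemma diagonal_cases:
  obtains (nonint) "A1 $ k $ k \<notin> \<int>" | (nat) N where "A1 $ k $ k = of_nat N"
  | (neg) m where "A1 $ k $ k + 1 + of_nat m = 0"
proof (cases "A1 $ k $ k \<in> \<int>")
  case True
  then obtain i where i: "A1 $ k $ k = of_int i" by (elim Ints_cases)
  show ?thesis
  proof (cases "i \<ge> 0")
    case True then show ?thesis using nat[of "nat i"] i by simp
  next
    case False
    then have "A1 $ k $ k + 1 + of_nat (nat (- i - 1)) = 0" using i by simp
    then show ?thesis by (rule neg)
  qed
qed (rule nonint)

lemma diagonal_integer:
  "A1 $ k $ k + 1 + of_nat m = 0 \<Longrightarrow> A1 $ k $ k = of_int (- int m - 1)"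
  "A1 $ k $ k = of_nat N \<Longrightarrow> A1 $ k $ k + 1 + of_nat m \<noteq> 0"
  "A1 $ k $ k + 1 + of_nat m = 0 \<Longrightarrow> A1 $ k $ k \<in> \<int>"
  "A1 $ k $ k = of_nat N \<Longrightarrow> A1 $ k $ k \<in> \<int>"
proof -
  show 1: "A1 $ k $ k = of_int (- int m - 1)" if "A1 $ k $ k + 1 + of_nat m = 0"
    using that by (simp add: algebra_simps eq_neg_iff_add_eq_0)
  show "A1 $ k $ k + 1 + of_nat m \<noteq> 0" if "A1 $ k $ k = of_nat N"
  proof -
    have "A1 $ k $ k + 1 + of_nat m = of_nat (N + 1 + m)" using that by simp
    also have "\<dots> \<noteq> (0 :: complex)" unfolding of_nat_eq_0_iff by simp
    finally show ?thesis .
  qed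
  show "A1 $ k $ k \<in> \<int>" if "A1 $ k $ k + 1 + of_nat m = 0" using 1[OF that] by (metis Ints_of_int)
  show "A1 $ k $ k \<in> \<int>" if "A1 $ k $ k = of_nat N" using that by simp
qed

lemma expansion_neg:
  assumes "A1 $ k $ k + 1 + of_nat m = 0"
  obtains w where "w \<noteq> 0" "has_expansion lam \<eta> k (w *s axis k 1) (of_nat m) (Psi k)"
proof -
  let ?N = "- int m - 1"
  have N: "A1 $ k $ k = of_int ?N \<and> ?N < 0" using diagonal_integer(1)[OF assms] by simp
  have "\<forall>N::int. A1 $ k $ k = of_int N \<and> N < 0 \<longrightarrow>
      has_expansion lam \<eta> k (((- 1) powi N / fact (nat (- N - 1))) *s axis k 1) (- of_int N - 1) (Psi k)"
    using is_Psi[of k] unfolding is_Psi_def by (elim conjE)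
  from mp[OF spec[OF this, of ?N] N]
  have "has_expansion lam \<eta> k (((- 1) powi ?N / fact (nat (- ?N - 1))) *s axis k 1) (- of_int ?N - 1) (Psi k)" .
  moreover have "(- of_int ?N - 1 :: complex) = of_nat m" by simp
  ultimately show ?thesis using that[of "(- 1) powi ?N / fact (nat (- ?N - 1))"] by simp
qed

lemma expansion_nonint:
  assumes "A1 $ k $ k \<notin> \<int>"
  obtains w where "w \<noteq> 0" "has_expansion lam \<eta> k (w *s axis k 1) (- A1 $ k $ k - 1) (Psi k)"
proof -
  have "A1 $ k $ k + 1 \<notin> \<int>"
  proof
    assume "A1 $ k $ k + 1 \<in> \<int>"
    from Ints_diff[OF this Ints_1] show False using assms by simp
  qed
  then have "Gamma (A1 $ k $ k + 1) \<noteq> 0"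
    unfolding Gamma_eq_zero_iff using nonpos_Ints_subset_Ints by blast
  moreover have "has_expansion lam \<eta> k (Gamma (A1 $ k $ k + 1) *s axis k 1) (- A1 $ k $ k - 1) (Psi k)"
    using is_Psi[of k] assms unfolding is_Psi_def by simp
  ultimately show ?thesis using that by blast
qed

lemma axis_nonzero: "w \<noteq> 0 \<Longrightarrow> w *s axis k (1 :: complex) \<noteq> (0 :: complex^'n)"
  by (simp add: vec_eq_iff axis_def exI[of _ k])

text \<open>The leading coefficient of the expansion is nonzero in these cases, so
  \<open>Psi k\<close> can vanish identically only for natural diagonal entries.\<close>

lemma Psi_nonzero:
  assumes "A1 $ k $ k \<notin> \<int> \<or> A1 $ k $ k + 1 + of_nat m = 0"
  shows "\<exists>z\<in>P. Psi k z \<noteq> 0"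
  using assms
proof
  assume "A1 $ k $ k \<notin> \<int>"
  then obtain w where "w \<noteq> 0" "has_expansion lam \<eta> k (w *s axis k 1) (- A1 $ k $ k - 1) (Psi k)"
    by (rule expansion_nonint)
  then show ?thesis using has_expansion_nonzero axis_nonzero by blast
next
  assume "A1 $ k $ k + 1 + of_nat m = 0"
  then obtain w where "w \<noteq> 0" "has_expansion lam \<eta> k (w *s axis k 1) (of_nat m) (Psi k)"
    by (rule expansion_neg)
  then show ?thesis using has_expansion_nonzero axis_nonzero by blast
qed

lemma Psi_neg:
  assumes "A1 $ k $ k + 1 + of_nat m = 0"
  obtains r b w where "r > 0" "r \<le> gap k" "geometric_bound b" "b 0 = w *s axis k 1" "w \<noteq> 0"
    "(\<lambda>z. (z - lam k) ^ m *s (\<chi> i. powser (\<lambda>l. b l $ i) (z - lam k))) vec_holomorphic_on ball (lam k) r"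
    "\<And>z. z \<in> slit k r \<Longrightarrow> Psi k z = (z - lam k) ^ m *s (\<chi> i. powser (\<lambda>l. b l $ i) (z - lam k))"
proof -
  obtain w where w: "w \<noteq> 0" "has_expansion lam \<eta> k (w *s axis k 1) (of_nat m) (Psi k)"
    using expansion_neg[OF assms] by blast
  obtain r b where r: "r > 0" "r \<le> gap k" "geometric_bound b" "b 0 = w *s axis k 1"
    "(\<lambda>z. \<chi> i. powser (\<lambda>l. b l $ i) (z - lam k)) vec_holomorphic_on ball (lam k) r"
    "\<And>z. z \<in> slit k r \<Longrightarrow> Psi k z = cut_pow \<eta> (z - lam k) (of_nat m) *s (\<chi> i. powser (\<lambda>l. b l $ i) (z - lam k))"
    using that by (rule has_expansionE[OF w(2)])
  show ?thesis
  proof (rule that[OF r(1-4) w(1)])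
    show "(\<lambda>z. (z - lam k) ^ m *s (\<chi> i. powser (\<lambda>l. b l $ i) (z - lam k))) vec_holomorphic_on ball (lam k) r"
      by (intro vec_holomorphic_on_scale r(5) holomorphic_intros)
    fix z assume z: "z \<in> slit k r"
    then have "z - lam k \<noteq> 0" using slit_disjoint[of k r] by auto
    from cut_pow_of_nat[OF this]
    show "Psi k z = (z - lam k) ^ m *s (\<chi> i. powser (\<lambda>l. b l $ i) (z - lam k))"
      using r(6)[OF z] by (simp only:)
  qed
qed

lemma is_reg_Psi:
  assumes "A1 $ k $ k \<in> \<int>"
  shows "is_reg lam \<eta> k (Psi k)"
proof (cases rule: diagonal_cases[of k])
  case (nat N)
  then show ?thesis using is_Psi[of k] unfolding is_Psi_def by blast
next
  case (neg m)
  obtain r b w where "r > 0" "r \<le> gap k" "geometric_bound b" "b 0 = w *s axis k 1" "w \<noteq> 0"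
    "(\<lambda>z. (z - lam k) ^ m *s (\<chi> i. powser (\<lambda>l. b l $ i) (z - lam k))) vec_holomorphic_on ball (lam k) r"
    "\<And>z. z \<in> slit k r \<Longrightarrow> Psi k z = (z - lam k) ^ m *s (\<chi> i. powser (\<lambda>l. b l $ i) (z - lam k))"
    using that by (rule Psi_neg[OF neg])
  then show ?thesis by (intro is_regI)
qed (use assms in simp)

text \<open>Phrased through the cases of the definition so that it can be decided before anything is
  known about \<open>Psing k\<close>; \<open>singular_iff\<close> identifies it with
  \<open>Psing k\<close> not being identically zero.\<close>

definition singular :: "'n \<Rightarrow> bool" where
  "singular k \<longleftrightarrow> (\<forall>m. A1 $ k $ k + 1 + of_nat m \<noteq> 0) \<or> (\<exists>\<phi>. is_log_solution lam A1 \<eta> k (Psi k) \<phi>)"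

lemma Psing_nonint: "A1 $ k $ k \<notin> \<int> \<Longrightarrow> z \<in> P \<Longrightarrow> Psing k z = Psi k z"
  using is_Psing[of k] unfolding is_Psi_sing_def by blast

lemma Psing_nat: "A1 $ k $ k = of_nat N \<Longrightarrow> is_log_pole_solution lam A1 \<eta> k N (Psi k) (Psing k)"
  using is_Psing[of k] unfolding is_Psi_sing_def by blast

lemma Psing_neg:
  assumes "A1 $ k $ k + 1 + of_nat m = 0"
  shows "singular k \<Longrightarrow> is_log_solution lam A1 \<eta> k (Psi k) (Psing k)"
    and "\<not> singular k \<Longrightarrow> z \<in> P \<Longrightarrow> Psing k z = 0"
proof -
  let ?N = "- int m - 1"
  have N: "A1 $ k $ k = of_int ?N \<and> ?N < 0" using diagonal_integer(1)[OF assms] by simp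
  have "\<forall>N::int. A1 $ k $ k = of_int N \<and> N < 0 \<longrightarrow> (if \<exists>\<phi>'. is_log_solution lam A1 \<eta> k (Psi k) \<phi>'
         then is_log_solution lam A1 \<eta> k (Psi k) (Psing k) else (\<forall>z \<in> P. Psing k z = 0))"
    using is_Psing[of k] unfolding is_Psi_sing_def by (elim conjE)
  note * = mp[OF spec[OF this, of ?N] N]
  show "is_log_solution lam A1 \<eta> k (Psi k) (Psing k)" if "singular k"
  proof -
    have "\<exists>\<phi>'. is_log_solution lam A1 \<eta> k (Psi k) \<phi>'" using that assms unfolding singular_def by blast
    then show ?thesis using * by simp
  qed
  show "Psing k z = 0" if "\<not> singular k" "z \<in> P"
  proof -
    have "\<not> (\<exists>\<phi>'. is_log_solution lam A1 \<eta> k (Psi k) \<phi>')" using that unfolding singular_def by blast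
    then show ?thesis using * that by simp
  qed
qed

lemma Psing_not_singular: "\<not> singular k \<Longrightarrow> z \<in> P \<Longrightarrow> Psing k z = 0"
  using Psing_neg(2)[of k] unfolding singular_def by blast

lemma solution_Psing: "is_solution lam A1 P (Psing k)"
proof (cases rule: diagonal_cases[of k])
  case nonint
  show ?thesis by (rule is_solution_cong[OF solution_Psi[of k] open_cut_plane Psing_nonint[OF nonint]])
next
  case (nat N)
  show ?thesis using Psing_nat[OF nat] unfolding is_log_pole_solution_def by (elim conjE)
next
  case (neg m)
  show ?thesis
  proof (cases "singular k")
    case True
    show ?thesis using Psing_neg(1)[OF neg True] unfolding is_log_solution_def by (elim conjE)
  next
    case False
    show ?thesis by (rule is_solution_cong[OF is_solution_zero open_cut_plane Psing_not_singular[OF False]])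
  qed
qed

lemma jump_near_cong:
  assumes "jump_near k f g" "\<And>z. z \<in> P \<Longrightarrow> f' z = f z" "\<And>z. z \<in> P \<Longrightarrow> g' z = g z"
  shows "jump_near k f' g'"
proof -
  obtain r F where r: "r > 0" "r \<le> gap k" "F vec_holomorphic_on right_half k r"
    "\<And>z. z \<in> right_half k r \<Longrightarrow> yc \<eta> z < yc \<eta> (lam k) \<Longrightarrow> F z = f z"
    "\<And>z. z \<in> right_half k r \<Longrightarrow> yc \<eta> z > yc \<eta> (lam k) \<Longrightarrow> F z = f z + g z"
    using jump_nearE[OF assms(1) zero_less_one] by metis
  show ?thesis
    by (rule jump_nearI[OF r(1,3)]) (use r(4,5) assms(2,3) slit_subset(1) in \<open>force+\<close>)
qed

lemma jump_near_eq:
  assumes "jump_near k f g" "jump_near k f g'"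
  shows "\<exists>z\<in>P. g z = g' z"
proof -
  obtain r where r: "r > 0" "r \<le> gap k"
    "\<And>z. z \<in> right_half k r \<Longrightarrow> yc \<eta> z > yc \<eta> (lam k) \<Longrightarrow> g z = g' z"
    using jump_near_unique[OF assms] by metis
  obtain z where z: "z \<in> right_half k r" "yc \<eta> z > yc \<eta> (lam k)" using right_half_offset(2)[OF r(1)] by blast
  then have "z \<in> P" using right_half_mem_slit[OF r(2) z(1)] slit_subset(1)[of k r] by auto
  then show ?thesis using r(3) z by blast
qed

lemma alpha_nonzero: "alpha A1 k \<noteq> 0"
proof (cases "A1 $ k $ k \<in> \<int>")
  case False
  have "exp (- 2 * of_real pi * \<i> * A1 $ k $ k) \<noteq> 1"
  proof
    assume "exp (- 2 * of_real pi * \<i> * A1 $ k $ k) = 1"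
    then have "Re (- 2 * of_real pi * \<i> * A1 $ k $ k) = 0 \<and>
      (\<exists>n::int. Im (- 2 * of_real pi * \<i> * A1 $ k $ k) = of_int (2 * n) * pi)"
      unfolding exp_eq_1 .
    moreover have "Re (- 2 * of_real pi * \<i> * A1 $ k $ k) = 2 * pi * Im (A1 $ k $ k)"
      "Im (- 2 * of_real pi * \<i> * A1 $ k $ k) = - (2 * pi * Re (A1 $ k $ k))" by simp_all
    ultimately obtain n :: int where n: "2 * pi * Im (A1 $ k $ k) = 0" "- (2 * pi * Re (A1 $ k $ k)) = of_int (2 * n) * pi"
      by metis
    have "pi * (2 * (Re (A1 $ k $ k) + of_int n)) = - (- (2 * pi * Re (A1 $ k $ k))) + of_int (2 * n) * pi"
      by (simp add: distrib_left)
    also have "\<dots> = 0" unfolding n(2) by simp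
    finally have "Re (A1 $ k $ k) = of_int (- n)" by simp
    then have "A1 $ k $ k = of_int (- n)" using n(1) by (simp add: complex_eq_iff)
    then show False using False by (metis Ints_of_int)
  qed
  then show ?thesis using False by (simp add: alpha_def)
qed (simp add: alpha_def)

lemma exp_diagonal: "exp (- 2 * of_real pi * \<i> * A1 $ k $ k) = (if A1 $ k $ k \<in> \<int> then 1 else 1 + alpha A1 k)"
proof (cases "A1 $ k $ k \<in> \<int>")
  case True
  then obtain n where n: "A1 $ k $ k = of_int n" by (elim Ints_cases)
  have "exp (- 2 * of_real pi * \<i> * A1 $ k $ k) = 1"
    unfolding exp_eq_1 n by (auto intro!: exI[of _ "- n"])
  then show ?thesis using True by simp
qed (simp add: alpha_def)

lemma jump_Psing_nat:
  assumes N: "A1 $ k $ k = of_nat N"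
  shows "jump_near k (Psing k) (\<lambda>z. (2 * of_real pi * \<i>) *s Psi k z)"
proof -
  obtain p where p: "p 0 = fact N *s axis k 1" and
    reg: "is_reg lam \<eta> k (\<lambda>z. Psing k z - cut_ln \<eta> (z - lam k) *s Psi k z
        - (1 / (z - lam k) ^ (N + 1)) *s (\<Sum>l\<le>N. (z - lam k) ^ l *s p l))"
    using Psing_nat[OF N] unfolding is_log_pole_solution_def by blast
  let ?pole = "\<lambda>z. (1 / (z - lam k) ^ (N + 1)) *s (\<Sum>l\<le>N. (z - lam k) ^ l *s p l)"
  have "?pole vec_holomorphic_on right_half k 1"
    by (intro vec_holomorphic_intros holomorphic_intros) (auto simp: right_half_def)
  then have "jump_near k ?pole (\<lambda>z. 0)" by (rule jump_nearI[OF zero_less_one]) auto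
  from jump_near_add_scale[OF jump_near_add_scale[OF jump_near_is_reg[OF reg]
        jump_near_cut_ln[OF is_reg_Psi[OF diagonal_integer(4)[OF N]]], of 1] this, of 1]
  show ?thesis by (rule jump_near_cong) simp_all
qed

text \<open>This is the origin of \<open>alpha\<close>: for a nonintegral entry the power is
  multiplied by \<open>1 + alpha A1 k\<close>, and for an integral entry the logarithm in
  \<open>Psing k\<close> contributes \<open>2 * pi * \<i>\<close> times \<open>Psi k\<close>, while
  poles and regular terms cross the cut unchanged.\<close>

lemma jump_Psing:
  assumes "singular k"
  shows "jump_near k (Psing k) (\<lambda>z. alpha A1 k *s Psi k z)"
proof (cases rule: diagonal_cases[of k])
  case nonint
  obtain w where w: "w \<noteq> 0" "has_expansion lam \<eta> k (w *s axis k 1) (- A1 $ k $ k - 1) (Psi k)"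
    using expansion_nonint[OF nonint] by blast
  obtain r b where r: "r > 0" "r \<le> gap k" "geometric_bound b" "b 0 = w *s axis k 1"
    "(\<lambda>z. \<chi> i. powser (\<lambda>l. b l $ i) (z - lam k)) vec_holomorphic_on ball (lam k) r"
    "\<And>z. z \<in> slit k r \<Longrightarrow> Psi k z = cut_pow \<eta> (z - lam k) (- A1 $ k $ k - 1) *s (\<chi> i. powser (\<lambda>l. b l $ i) (z - lam k))"
    using that by (rule has_expansionE[OF w(2)])
  have "jump_near k (Psi k) (\<lambda>z. (exp (2 * of_real pi * \<i> * (- A1 $ k $ k - 1)) - 1) *s Psi k z)"
    by (rule jump_near_cut_pow[OF r(1,5,6)])
  moreover have "exp (2 * of_real pi * \<i> * (- A1 $ k $ k - 1)) - 1 = alpha A1 k"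
  proof -
    have "2 * of_real pi * \<i> * (- A1 $ k $ k - 1) = - 2 * of_real pi * \<i> * A1 $ k $ k - 2 * of_real pi * \<i>"
      by (simp add: algebra_simps)
    then have "exp (2 * of_real pi * \<i> * (- A1 $ k $ k - 1)) = exp (- 2 * of_real pi * \<i> * A1 $ k $ k)"
      by (simp only: exp_diff exp_two_pi_i div_by_1)
    then show ?thesis using nonint by (simp add: alpha_def)
  qed
  ultimately have "jump_near k (Psi k) (\<lambda>z. alpha A1 k *s Psi k z)" by simp
  then show ?thesis by (rule jump_near_cong) (simp_all add: Psing_nonint[OF nonint])
next
  case (nat N)
  then show ?thesis using jump_Psing_nat[OF nat] by (simp add: alpha_def)
next
  case (neg m)
  have reg: "is_reg lam \<eta> k (\<lambda>z. Psing k z - cut_ln \<eta> (z - lam k) *s Psi k z)"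
    using Psing_neg(1)[OF neg assms] unfolding is_log_solution_def by (elim conjE)
  from jump_near_add_scale[OF jump_near_is_reg[OF reg]
        jump_near_cut_ln[OF is_reg_Psi[OF diagonal_integer(3)[OF neg]]], of 1]
  show ?thesis by (rule jump_near_cong) (simp_all add: alpha_def diagonal_integer(3)[OF neg])
qed

text \<open>Multiplication by \<open>(z - lam k) ^ (N + 1)\<close> turns both sides into holomorphic
  functions that agree at \<open>lam k\<close>; one of them is zero there and the other is
  \<open>c *s p 0\<close>.\<close>

lemma is_reg_pole:
  assumes reg: "is_reg lam \<eta> k (\<lambda>z. c *s ((1 / (z - lam k) ^ (N + 1)) *s (\<Sum>l\<le>N. (z - lam k) ^ l *s p l)))"
    and p: "p 0 \<noteq> 0"
  shows "c = 0"
proof -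
  obtain r h where h0: "r > 0" "r \<le> gap k" "r \<le> 1" and h: "h vec_holomorphic_on ball (lam k) r"
    "\<And>z. z \<in> slit k r \<Longrightarrow> c *s ((1 / (z - lam k) ^ (N + 1)) *s (\<Sum>l\<le>N. (z - lam k) ^ l *s p l)) = h z"
    using that by (rule is_regE[OF reg zero_less_one])
  have "(lam k - lam k) ^ (N + 1) *s h (lam k) - c *s (\<Sum>l\<le>N. (lam k - lam k) ^ l *s p l) = 0"
  proof (rule zero_on_slit_imp_zero[where z = "lam k" and k = k and r = r and
      h = "\<lambda>z. (z - lam k) ^ (N + 1) *s h z - c *s (\<Sum>l\<le>N. (z - lam k) ^ l *s p l)"])
    show "(\<lambda>z. (z - lam k) ^ (N + 1) *s h z - c *s (\<Sum>l\<le>N. (z - lam k) ^ l *s p l)) vec_holomorphic_on ball (lam k) r"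
      by (intro vec_holomorphic_intros holomorphic_intros h(1))
    fix z assume z: "z \<in> slit k r"
    then have nz: "(z - lam k) ^ (N + 1) \<noteq> 0" using slit_disjoint[of k r] by auto
    have "(z - lam k) ^ (N + 1) *s h z = ((z - lam k) ^ (N + 1) * (c * (1 / (z - lam k) ^ (N + 1)))) *s (\<Sum>l\<le>N. (z - lam k) ^ l *s p l)"
      unfolding h(2)[OF z, symmetric] by (simp only: vector_smult_assoc)
    also have "(z - lam k) ^ (N + 1) * (c * (1 / (z - lam k) ^ (N + 1))) = c" using nz by (simp del: power_Suc add: field_simps)
    finally show "(z - lam k) ^ (N + 1) *s h z - c *s (\<Sum>l\<le>N. (z - lam k) ^ l *s p l) = 0" by simp
  qed (use h0 in auto)
  moreover have "(\<Sum>l\<le>N. (lam k - lam k) ^ l *s p l) = (\<Sum>l\<le>N. if l = 0 then p l else 0)"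
    by (intro sum.cong) auto
  ultimately have "c *s p 0 = 0" by simp
  then show ?thesis using p by (metis vector_mul_eq_0)
qed

text \<open>A regular \<open>Psing k\<close> would have no jump, so \<open>Psi k\<close> would
  vanish at a point and hence everywhere. Only a natural diagonal entry allows that, and then
  \<open>Psing k\<close> is, up to a regular term, a pole with nonzero leading coefficient.\<close>

lemma Psing_not_reg:
  assumes s: "singular k" and reg: "is_reg lam \<eta> k (\<lambda>z. c *s Psing k z)"
  shows "c = 0"
proof (rule ccontr)
  assume c: "c \<noteq> 0"
  have reg1: "is_reg lam \<eta> k (Psing k)"
    using is_reg_scale[OF reg, of "1 / c"] c by simp
  obtain z where z: "z \<in> P" "alpha A1 k *s Psi k z = 0"
    using jump_near_eq[OF jump_Psing[OF s] jump_near_is_reg[OF reg1]] by blast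
  then have "Psi k z = 0" using alpha_nonzero[of k] by (metis vector_mul_eq_0)
  then have zero: "Psi k w = 0" if "w \<in> P" for w by (rule solution_zero[OF solution_Psi z(1) _ that])
  show False
  proof (cases rule: diagonal_cases[of k])
    case nonint then show ?thesis using Psi_nonzero[of k] zero by blast
  next
    case (neg m) then show ?thesis using Psi_nonzero[of k m] zero by blast
  next
    case (nat N)
    obtain p where p: "p 0 = fact N *s axis k 1" and
      reg2: "is_reg lam \<eta> k (\<lambda>z. Psing k z - cut_ln \<eta> (z - lam k) *s Psi k z
        - (1 / (z - lam k) ^ (N + 1)) *s (\<Sum>l\<le>N. (z - lam k) ^ l *s p l))"
      using Psing_nat[OF nat] unfolding is_log_pole_solution_def by blast
    have "is_reg lam \<eta> k (\<lambda>z. 1 *s ((1 / (z - lam k) ^ (N + 1)) *s (\<Sum>l\<le>N. (z - lam k) ^ l *s p l)))"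
      by (rule is_reg_cong[OF is_reg_diff_scale[OF reg1 reg2, of 1] zero_less_one])
        (use zero slit_subset(1) in auto)
    from is_reg_pole[OF this] p axis_nonzero[of "fact N" k] show False by simp
  qed
qed

lemma singular_iff: "singular k \<longleftrightarrow> (\<exists>z\<in>P. Psing k z \<noteq> 0)"
proof
  assume s: "singular k"
  show "\<exists>z\<in>P. Psing k z \<noteq> 0"
  proof (rule ccontr)
    assume "\<not> ?thesis"
    then have "is_reg lam \<eta> k (\<lambda>z. 1 *s Psing k z)"
      by (intro is_reg_cong[OF is_reg_zero zero_less_one]) (use slit_subset(1) in auto)
    from Psing_not_reg[OF s this] show False by simp
  qed
qed (use Psing_not_singular in blast)

lemma connection: "singular j \<Longrightarrow> is_reg lam \<eta> j (\<lambda>z. Psi k z - C $ j $ k *s Psing j z)"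
  and connection_zero: "\<not> singular j \<Longrightarrow> C $ j $ k = 0"
proof -
  have *: "if \<forall>z \<in> P. Psing j z = 0 then C $ j $ k = 0
            else is_reg lam \<eta> j (\<lambda>z. Psi k z - C $ j $ k *s Psing j z)"
    using is_C unfolding is_connection_matrix_def by blast
  show "singular j \<Longrightarrow> is_reg lam \<eta> j (\<lambda>z. Psi k z - C $ j $ k *s Psing j z)"
    using * unfolding singular_iff by (metis (no_types, lifting))
  show "\<not> singular j \<Longrightarrow> C $ j $ k = 0"
    using * unfolding singular_iff by (metis (no_types, lifting))
qed

text \<open>Both cases feed \<open>local_decomposition\<close>. Without resonance the basis is
  \<open>Psing k\<close> together with \<open>n - 1\<close> regular solutions. With resonance
  \<open>Psi k\<close> itself is regular, and the other \<open>n - 1\<close> solutions carry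
  multiples of the logarithmic term; a solution in which this term survives forces
  \<open>Psing k\<close> to be a genuine logarithmic solution.\<close>

lemma solution_decomposition:
  assumes f: "is_solution lam A1 P f"
  obtains c where "is_reg lam \<eta> k (\<lambda>z. f z - c *s Psing k z)" "\<not> singular k \<Longrightarrow> c = 0"
proof (cases "\<forall>m. A1 $ k $ k + 1 + of_nat m \<noteq> 0")
  case True
  then have s: "singular k" by (simp add: singular_def)
  have "\<exists>r h. r > 0 \<and> is_solution lam A1 (ball (lam k) r) h \<and> (\<forall>i'. i' \<noteq> k \<longrightarrow> h (lam k) $ i' = (axis i 1 :: complex^'n) $ i')" for i
    using regular_local_solution[of k "axis i 1"] True by (metis (no_types, lifting))
  then obtain r h where rh: "\<And>i. r i > 0" "\<And>i. is_solution lam A1 (ball (lam k) (r i)) (h i)"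
    "\<And>i i'. i' \<noteq> k \<Longrightarrow> h i (lam k) $ i' = (axis i 1 :: complex^'n) $ i'"
    by metis
  define \<rho> where "\<rho> = Min (insert (gap k) (range r))"
  have \<rho>: "\<rho> > 0" "\<rho> \<le> gap k" "\<rho> \<le> r i" for i using rh(1) gap_pos[of k] by (auto simp: \<rho>_def intro: min.coboundedI2)
  \<comment> \<open>Index \<open>k\<close> is given to \<open>Psing k\<close>, with regular part
    zero and coefficient one; the other indices are regular solutions.\<close>
  define H where "H i = (if i = k then (\<lambda>z. 0) else h i)" for i
  define \<kappa> where "\<kappa> i = (if i = k then 1 else 0 :: complex)" for i
  have subb: "ball (lam k) \<rho> \<subseteq> ball (lam k) (r i)" for i using \<rho>(3)[of i] by auto
  have "\<exists>c. is_reg lam \<eta> k (\<lambda>z. f z - c *s Psing k z)"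
  proof (rule local_decomposition[OF \<rho>(1,2), where h = H and \<kappa> = \<kappa>])
    show "H i vec_holomorphic_on ball (lam k) \<rho>" for i
      using is_solution_imp_vec_holomorphic[OF rh(2) open_ball] subb[of i]
      by (auto simp: H_def vec_holomorphic_on_const intro: vec_holomorphic_on_subset)
    show "H i (lam k) $ i' = (if i = i' then 1 else 0)" if "i' \<noteq> k" for i i'
      using rh(3)[OF that, of i] that by (auto simp: H_def axis_def)
    show "is_solution lam A1 (slit k \<rho>) (\<lambda>z. H i z + \<kappa> i *s Psing k z)" for i
    proof (cases "i = k")
      case True
      then show ?thesis using is_solution_subset[OF solution_Psing slit_subset(1)] by (simp add: H_def \<kappa>_def)
    next
      case False
      then show ?thesis using is_solution_subset[OF rh(2)[of i], of "slit k \<rho>"] slit_subset(2)[of k \<rho>] subb[of i]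
        by (simp add: H_def \<kappa>_def)
    qed
    show "c = 0" if "is_reg lam \<eta> k (\<lambda>z. c *s Psing k z)" for c by (rule Psing_not_reg[OF s that])
    show "\<exists>z\<in>slit k \<rho>. H k z + \<kappa> k *s Psing k z \<noteq> 0"
    proof (rule ccontr)
      assume "\<not> ?thesis"
      then have "is_reg lam \<eta> k (\<lambda>z. 1 *s Psing k z)"
        by (intro is_reg_cong[OF is_reg_zero \<rho>(1)]) (auto simp: H_def \<kappa>_def)
      from Psing_not_reg[OF s this] show False by simp
    qed
    show "is_solution lam A1 (slit k \<rho>) f" by (rule is_solution_subset[OF f slit_subset(1)])
  qed
  then show ?thesis using that s by blast
next
  case False
  then obtain m where m: "A1 $ k $ k + 1 + of_nat m = 0" by blast
  note int = diagonal_integer(3)[OF m]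
  obtain r0 b w where b: "r0 > 0" "r0 \<le> gap k" "geometric_bound b" "b 0 = w *s axis k 1" "w \<noteq> 0"
    "(\<lambda>z. (z - lam k) ^ m *s (\<chi> i. powser (\<lambda>l. b l $ i) (z - lam k))) vec_holomorphic_on ball (lam k) r0"
    "\<And>z. z \<in> slit k r0 \<Longrightarrow> Psi k z = (z - lam k) ^ m *s (\<chi> i. powser (\<lambda>l. b l $ i) (z - lam k))"
    using that by (rule Psi_neg[OF m])
  define e where "e z = (z - lam k) ^ m *s (\<chi> i. powser (\<lambda>l. b l $ i) (z - lam k))" for z
  have e_lam: "e (lam k) $ i = 0" if "i \<noteq> k" for i
    using that b(4) by (simp add: e_def powser_0 axis_def)
  let ?L = "\<lambda>z. cut_ln \<eta> (z - lam k) *s Psi k z"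
  define Q where "Q i c r h \<longleftrightarrow> r > 0 \<and> h vec_holomorphic_on ball (lam k) r \<and>
    (\<forall>i'. i' \<noteq> k \<longrightarrow> h (lam k) $ i' = (axis i 1 :: complex^'n) $ i') \<and>
    is_solution lam A1 (slit k r) (\<lambda>z. h z + c *s ?L z)" for i c r h
  have "\<exists>c r h. Q i c r h" for i
    unfolding Q_def
    by (rule resonant_log_solution[OF m is_solution_subset[OF solution_Psi slit_subset(1)] b(1-5,7), where u = "axis i 1"])
      blast+
  then obtain c r h where Q: "\<And>i. Q i (c i) (r i) (h i)" by metis
  have rh: "r i > 0" "h i vec_holomorphic_on ball (lam k) (r i)"
    "i' \<noteq> k \<Longrightarrow> h i (lam k) $ i' = (axis i 1 :: complex^'n) $ i'"
    "is_solution lam A1 (slit k (r i)) (\<lambda>z. h i z + c i *s ?L z)" for i i'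
    using Q[of i] unfolding Q_def by auto
  define \<rho> where "\<rho> = Min (insert r0 (range r))"
  have \<rho>: "\<rho> > 0" "\<rho> \<le> gap k" "\<rho> \<le> r i" "\<rho> \<le> r0" for i
  proof -
    show "\<rho> > 0" "\<rho> \<le> r i" and r0: "\<rho> \<le> r0" using rh(1) b(1) by (auto simp: \<rho>_def intro: min.coboundedI2)
    show "\<rho> \<le> gap k" using r0 b(2) by simp
  qed
  \<comment> \<open>Here index \<open>k\<close> is given to the regular solution
    \<open>Psi k\<close>, in its holomorphic form \<open>e\<close>, with no logarithm.\<close>
  define H where "H i = (if i = k then e else h i)" for i
  define \<kappa> where "\<kappa> i = (if i = k then 0 else c i)" for i
  have subb: "ball (lam k) \<rho> \<subseteq> ball (lam k) (r i)" "ball (lam k) \<rho> \<subseteq> ball (lam k) r0" for i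
    using \<rho>(3)[of i] \<rho>(4) by auto
  have eP: "e z = Psi k z" if "z \<in> slit k \<rho>" for z 
    using b(7)[OF subsetD[OF slit_mono[OF \<rho>(4)] that]] by (simp add: e_def)
  have L0: "c = 0" if reg: "is_reg lam \<eta> k (\<lambda>z. c *s ?L z)" for c
  proof -
    have "jump_near k (\<lambda>z. 0 + c *s ?L z) (\<lambda>z. 0 + c *s ((2 * of_real pi * \<i>) *s Psi k z))"
      by (rule jump_near_add_scale[OF jump_near_is_reg[OF is_reg_zero] jump_near_cut_ln[OF is_reg_Psi[OF int]]])
    then have "jump_near k (\<lambda>z. c *s ?L z) (\<lambda>z. c *s ((2 * of_real pi * \<i>) *s Psi k z))" by simp
    from jump_near_eq[OF this jump_near_is_reg[OF reg]] obtain z where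
      z: "z \<in> P" "c *s ((2 * of_real pi * \<i>) *s Psi k z) = 0" by blast
    show "c = 0"
    proof (rule ccontr)
      assume "c \<noteq> 0"
      then have "Psi k z = 0" using z(2) by (simp add: vec_eq_iff)
      then show False using solution_zero[OF solution_Psi z(1)] Psi_nonzero[of k m] m by blast
    qed
  qed
  have "\<exists>c. is_reg lam \<eta> k (\<lambda>z. f z - c *s ?L z)"
  proof (rule local_decomposition[OF \<rho>(1,2), where h = H and \<kappa> = \<kappa>])
    show "H i vec_holomorphic_on ball (lam k) \<rho>" for i
      using vec_holomorphic_on_subset[OF rh(2)[of i] subb(1)] vec_holomorphic_on_subset[OF b(6) subb(2)]
      by (simp add: H_def e_def[abs_def])
    show "H i (lam k) $ i' = (if i = i' then 1 else 0)" if "i' \<noteq> k" for i i'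
      using rh(3)[OF that, of i] that e_lam[OF that] by (auto simp: H_def axis_def)
    show "is_solution lam A1 (slit k \<rho>) (\<lambda>z. H i z + \<kappa> i *s ?L z)" for i
    proof (cases "i = k")
      case True
      have "is_solution lam A1 (slit k \<rho>) e"
        by (rule is_solution_cong[OF is_solution_subset[OF solution_Psi slit_subset(1)] open_slit eP])
      then show ?thesis using True by (simp add: H_def \<kappa>_def)
    next
      case False
      then show ?thesis using is_solution_subset[OF rh(4)[of i] slit_mono[OF \<rho>(3)[of i]]]
        by (simp add: H_def \<kappa>_def)
    qed
    show "c = 0" if "is_reg lam \<eta> k (\<lambda>z. c *s ?L z)" for c by (rule L0[OF that])
    show "\<exists>z\<in>slit k \<rho>. H k z + \<kappa> k *s ?L z \<noteq> 0"
    proof (rule ccontr)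
      assume n: "\<not> ?thesis"
      obtain z where z: "z \<in> slit k \<rho>" using slit_nonempty[OF \<rho>(1,2)] by blast
      have "H k z + \<kappa> k *s ?L z = Psi k z" using eP[OF z] by (simp add: H_def \<kappa>_def)
      then have "Psi k z = 0" using n z by metis
      from solution_zero[OF solution_Psi subsetD[OF slit_subset(1) z] this]
      show False using Psi_nonzero[of k m] m by blast
    qed
    show "is_solution lam A1 (slit k \<rho>) f" by (rule is_solution_subset[OF f slit_subset(1)])
  qed
  then obtain c where c: "is_reg lam \<eta> k (\<lambda>z. f z - c *s ?L z)" by (elim exE)
  show ?thesis
  proof (cases "c = 0")
    case True
    show ?thesis
    proof (rule that[of 0])
      show "is_reg lam \<eta> k (\<lambda>z. f z - 0 *s Psing k z)" using c True by simp
    qed simp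
  next
    case False
    \<comment> \<open>Dividing by \<open>c\<close> normalizes the logarithmic term. Existence of
      this solution excludes the branch of the definition in which \<open>Psing k\<close> is zero,
      so the term can be exchanged for \<open>Psing k\<close>.\<close>
    have "is_log_solution lam A1 \<eta> k (Psi k) (\<lambda>z. (1 / c) *s f z)"
      unfolding is_log_solution_def
    proof
      show "is_solution lam A1 P (\<lambda>z. (1 / c) *s f z)" by (rule is_solution_scale[OF f])
      show "is_reg lam \<eta> k (\<lambda>z. (1 / c) *s f z - ?L z)"
        by (rule is_reg_cong[OF is_reg_scale[OF c, of "1 / c"] zero_less_one])
          (use False in \<open>simp add: vec_eq_iff field_simps\<close>)
    qed
    then have s: "singular k" unfolding singular_def by blast
    have "is_reg lam \<eta> k (\<lambda>z. Psing k z - ?L z)"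
      using Psing_neg(1)[OF m s] unfolding is_log_solution_def by (elim conjE)
    from is_reg_diff_scale[OF c this, of c]
    have "is_reg lam \<eta> k (\<lambda>z. f z - c *s Psing k z)"
      by (rule is_reg_cong[OF _ zero_less_one]) (simp add: vec_eq_iff algebra_simps)
    then show ?thesis using that s by blast
  qed
qed

lemma jump_solution:
  assumes "is_reg lam \<eta> k (\<lambda>z. f z - c *s Psing k z)" "\<not> singular k \<Longrightarrow> c = 0"
  shows "jump_near k f (\<lambda>z. (alpha A1 k * c) *s Psi k z)"
proof (cases "singular k")
  case True
  from jump_near_add_scale[OF jump_near_is_reg[OF assms(1)] jump_Psing[OF True], of c]
  show ?thesis by (rule jump_near_cong) (simp_all add: mult.commute)
next
  case False
  then have c: "c = 0" by (rule assms(2))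
  from jump_near_is_reg[OF assms(1)] show ?thesis by (rule jump_near_cong) (simp_all add: c)
qed

text \<open>For an integral entry \<open>C $ k $ k = 0\<close>, since \<open>Psi k\<close> is
  regular at \<open>lam k\<close>; otherwise it is \<open>1\<close>, since \<open>Psi k\<close> is
  its own singular solution. The diagonal of the monodromy matrix thereby follows the pattern of its
  other entries.\<close>

lemma alpha_C_diagonal: "1 + alpha A1 k * C $ k $ k = exp (- 2 * of_real pi * \<i> * A1 $ k $ k)"
proof (cases "A1 $ k $ k \<in> \<int>")
  case True
  have "C $ k $ k = 0"
  proof (cases "singular k")
    case s: True
    have "is_reg lam \<eta> k (\<lambda>z. C $ k $ k *s Psing k z)"
      by (rule is_reg_cong[OF is_reg_diff_scale[OF is_reg_Psi[OF True] connection[OF s], of 1 k] zero_less_one]) simp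
    then show ?thesis by (rule Psing_not_reg[OF s])
  qed (rule connection_zero)
  then show ?thesis using True exp_diagonal by simp
next
  case False
  then have s: "singular k" unfolding singular_def using diagonal_integer(3) by blast
  have "is_reg lam \<eta> k (\<lambda>z. (1 - C $ k $ k) *s Psing k z)"
    by (rule is_reg_cong[OF connection[OF s, of k] zero_less_one])
      (use Psing_nonint[OF False] slit_subset(1) in \<open>force simp: vec_eq_iff algebra_simps\<close>)
  then have "1 - C $ k $ k = 0" by (rule Psing_not_reg[OF s])
  then show ?thesis using False exp_diagonal by simp
qed

end

section \<open>Crossing a cut\<close>

context distinguished
begin

lemma vec_holomorphic_P: "is_solution lam A1 P f \<Longrightarrow> S \<subseteq> P \<Longrightarrow> f vec_holomorphic_on S"
  by (rule vec_holomorphic_on_subset[OF is_solution_imp_vec_holomorphic[OF _ open_cut_plane]])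

text \<open>\<open>f\<close> continues anticlockwise across the cut \<open>L\<^sub>k\<close> to \<open>f + a \<Psi>\<^sub>k\<close>, at all points of \<open>L\<^sub>k\<close>.\<close>

definition crosses :: "'n \<Rightarrow> (complex \<Rightarrow> complex^'n) \<Rightarrow> complex \<Rightarrow> bool" where
  "crosses k f a \<longleftrightarrow> (\<forall>U F. open U \<longrightarrow> convex U \<longrightarrow> lam k \<notin> U \<longrightarrow>
     (\<forall>i. i \<noteq> k \<longrightarrow> U \<inter> cut_ray (lam i) \<eta> = {}) \<longrightarrow> U \<inter> cut_ray (lam k) \<eta> \<noteq> {} \<longrightarrow>
     F vec_holomorphic_on U \<longrightarrow> (\<forall>z\<in>U. yc \<eta> z < yc \<eta> (lam k) \<longrightarrow> F z = f z) \<longrightarrow>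
     (\<forall>z\<in>U. yc \<eta> (lam k) < yc \<eta> z \<longrightarrow> F z = f z + a *s Psi k z))"

lemma crossesD:
  assumes "crosses k f a" "open U" "convex U" "lam k \<notin> U"
    "\<And>i. i \<noteq> k \<Longrightarrow> U \<inter> cut_ray (lam i) \<eta> = {}" "U \<inter> cut_ray (lam k) \<eta> \<noteq> {}"
    "F vec_holomorphic_on U" "\<And>z. z \<in> U \<Longrightarrow> yc \<eta> z < yc \<eta> (lam k) \<Longrightarrow> F z = f z"
    "z \<in> U" "yc \<eta> (lam k) < yc \<eta> z"
  shows "F z = f z + a *s Psi k z"
  using assms unfolding crosses_def by blast

lemma open_meets_both_sides:
  assumes "open V" "q \<in> V"
  shows "\<exists>z\<in>V. yc \<eta> z < yc \<eta> q" "\<exists>z\<in>V. yc \<eta> q < yc \<eta> z"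
proof -
  obtain e where e: "e > 0" "ball q e \<subseteq> V" using assms open_contains_ball by blast
  have y: "yc \<eta> (q + of_real t * (\<i> * cis \<eta>)) = yc \<eta> q + t" for t
    using yc_polar[of \<eta> 0 t] by (simp add: yc_add)
  have b: "q + of_real t * (\<i> * cis \<eta>) \<in> V" if "\<bar>t\<bar> < e" for t
    using that by (intro subsetD[OF e(2)]) (simp add: dist_norm norm_mult)
  show "\<exists>z\<in>V. yc \<eta> z < yc \<eta> q"
    by (rule bexI[OF _ b[of "-(e/2)"]]) (use e(1) y[of "-(e/2)"] in auto)
  show "\<exists>z\<in>V. yc \<eta> q < yc \<eta> z"
    by (rule bexI[OF _ b[of "e/2"]]) (use e(1) y[of "e/2"] in auto)
qed

text \<open>The jump is known only near the tip of the cut. A solution on the strip \<open>T\<close>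
  around the open cut extends the local continuation, so the same jump holds along the whole cut;
  any other continuation agrees with it by the identity theorem.\<close>

lemma crosses_jump:
  assumes f: "is_solution lam A1 P f" and j: "jump_near k f (\<lambda>z. a *s Psi k z)"
  shows "crosses k f a"
proof -
  obtain r F0 where r: "r > 0" "r \<le> gap k" "r \<le> 1" and F0: "F0 vec_holomorphic_on right_half k r"
    "\<And>z. z \<in> right_half k r \<Longrightarrow> yc \<eta> z < yc \<eta> (lam k) \<Longrightarrow> F0 z = f z"
    "\<And>z. z \<in> right_half k r \<Longrightarrow> yc \<eta> z > yc \<eta> (lam k) \<Longrightarrow> F0 z = f z + a *s Psi k z"
    using that by (rule jump_nearE[OF j zero_less_one])
  \<comment> \<open>The half-strip to the right of \<open>lam k\<close> of half-width
    \<open>gap k\<close>: convex, containing the cut without its tip, and free of singular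
    points.\<close>
  define T where "T = {z. xc \<eta> (lam k) < xc \<eta> z} \<inter> {z. yc \<eta> z < yc \<eta> (lam k) + gap k} \<inter> {z. yc \<eta> (lam k) - gap k < yc \<eta> z}"
  let ?lo = "{z. yc \<eta> z < yc \<eta> (lam k)}" and ?hi = "{z. yc \<eta> (lam k) < yc \<eta> z}"
  let ?g = "\<lambda>z. f z + a *s Psi k z"
  have g: "is_solution lam A1 P ?g" by (intro is_solution_add is_solution_scale f solution_Psi)
  have T: "open T" "convex T" unfolding T_def by (intro open_Int convex_Int open_convex_halfplanes)+
  have lohi: "open ?lo" "convex ?lo" "open ?hi" "convex ?hi" by (rule open_convex_halfplanes)+
  have Tgap: "\<bar>yc \<eta> z - yc \<eta> (lam k)\<bar> < gap k" if "z \<in> T" for z using that by (auto simp: T_def)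
  have TP: "z \<in> P" if "z \<in> T" "yc \<eta> z \<noteq> yc \<eta> (lam k)" for z
    using mem_cut_plane_near[OF Tgap[OF that(1)]] that(2) by simp
  have Tdisj: "T \<inter> range lam = {}"
  proof -
    have "lam i \<notin> T" for i
    proof
      assume i: "lam i \<in> T"
      show False using Tgap[OF i] gap_le[of i k] i by (cases "i = k") (auto simp: T_def)
    qed
    then show ?thesis by blast
  qed
  have rT: "right_half k r \<subseteq> T"
  proof
    fix z assume z: "z \<in> right_half k r"
    then have "\<bar>yc \<eta> z - yc \<eta> (lam k)\<bar> < r" by (intro abs_yc_less) (simp add: right_half_def)
    then show "z \<in> T" using z r(2) by (auto simp: T_def right_half_def)
  qed
  obtain p where p: "p \<in> right_half k r" "yc \<eta> p < yc \<eta> (lam k)" using right_half_offset(1)[OF r(1)] by blast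
  obtain p' where p': "p' \<in> right_half k r" "yc \<eta> p' > yc \<eta> (lam k)" using right_half_offset(2)[OF r(1)] by blast
  obtain F1 where F1: "is_solution lam A1 T F1" "F1 p = f p"
    using is_solution_exists_on_convex[OF T Tdisj subsetD[OF rT p(1)]] by blast
  have F1hol: "F1 vec_holomorphic_on T" by (rule is_solution_imp_vec_holomorphic[OF F1(1) T(1)])
  have sub: "T \<inter> ?lo \<subseteq> P" "T \<inter> ?hi \<subseteq> P" using TP by auto
  have disj: "(T \<inter> ?lo) \<inter> range lam = {}" "(T \<inter> ?hi) \<inter> range lam = {}" using Tdisj by auto
  have lo: "F1 z = f z" if "z \<in> T \<inter> ?lo" for z
    by (rule is_solution_unique_Int[OF is_solution_subset[OF f sub(1)] F1(1) _ _ disj(1) T, of p, symmetric])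
      (use that F1(2) p rT lohi T in \<open>auto intro: open_Int convex_Int\<close>)
  have F10: "F1 z = F0 z" if "z \<in> right_half k r" for z
  proof (rule vec_analytic_continuation[of "right_half k r \<inter> ?lo" "right_half k r"])
    show "open (right_half k r \<inter> ?lo)" by (intro open_Int open_right_half lohi)
    show "F1 w = F0 w" if "w \<in> right_half k r \<inter> ?lo" for w using lo F0(2) that rT by auto
    show "right_half k r \<inter> ?lo \<noteq> {}" using p by blast
  qed (use that open_right_half convex_connected[OF convex_right_half] F0(1) vec_holomorphic_on_subset[OF F1hol rT] in auto)
  have hi: "F1 z = ?g z" if "z \<in> T \<inter> ?hi" for z
  proof -
    have "F1 p' = ?g p'" using F10[OF p'(1)] F0(3)[OF p'] by simp
    then show ?thesis
      by (intro is_solution_unique_Int[OF is_solution_subset[OF g sub(2)] F1(1) _ _ disj(2) T, of p', symmetric])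
        (use that p' rT lohi T in \<open>auto intro: open_Int convex_Int\<close>)
  qed
  show ?thesis unfolding crosses_def
  proof (intro allI impI ballI)
    fix U F z
    assume U: "open U" "convex U" "lam k \<notin> U" "\<forall>i. i \<noteq> k \<longrightarrow> U \<inter> cut_ray (lam i) \<eta> = {}"
      "U \<inter> cut_ray (lam k) \<eta> \<noteq> {}"
      and F: "F vec_holomorphic_on U" "\<forall>z\<in>U. yc \<eta> z < yc \<eta> (lam k) \<longrightarrow> F z = f z"
      and z: "z \<in> U" "yc \<eta> (lam k) < yc \<eta> z"
    \<comment> \<open>The point where \<open>U\<close> meets the cut is not the tip, so it lies in
      \<open>T\<close>; near it both sides of the cut are available in \<open>U\<close> and in
      \<open>T\<close>.\<close>
    obtain q where q: "q \<in> U" "yc \<eta> q = yc \<eta> (lam k)" "xc \<eta> (lam k) \<le> xc \<eta> q"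
      using U(5) mem_cut_ray_iff by blast
    have "xc \<eta> q \<noteq> xc \<eta> (lam k)" using q(1,2) U(3) xc_yc_eqI[of \<eta> q "lam k"] by metis
    then have qT: "q \<in> T" using q gap_pos[of k] by (auto simp: T_def)
    have V: "open (U \<inter> T)" "convex (U \<inter> T)" "q \<in> U \<inter> T" using U T q qT by (auto intro: convex_Int)
    have V1: "U \<inter> T \<inter> ?lo \<noteq> {}" "U \<inter> T \<inter> ?hi \<noteq> {}"
      using open_meets_both_sides[OF V(1,3)] q(2) by auto
    have FF1: "F w = F1 w" if "w \<in> U \<inter> T" for w
    proof (rule vec_analytic_continuation[of "U \<inter> T \<inter> ?lo" "U \<inter> T"])
      show "open (U \<inter> T \<inter> ?lo)" by (intro open_Int U T lohi)
      show "F w = F1 w" if "w \<in> U \<inter> T \<inter> ?lo" for w using lo F(2) that by auto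
      show "F vec_holomorphic_on U \<inter> T" by (rule vec_holomorphic_on_subset[OF F(1)]) blast
      show "F1 vec_holomorphic_on U \<inter> T" by (rule vec_holomorphic_on_subset[OF F1hol]) blast
    qed (use that V V1 convex_connected in auto)
    have UP: "U \<inter> ?hi \<subseteq> P"
    proof
      fix w assume w: "w \<in> U \<inter> ?hi"
      have "w \<notin> cut_ray (lam i) \<eta>" for i
      proof (cases "i = k")
        case True then show ?thesis using w by (simp add: mem_cut_ray_iff)
      next
        case False then show ?thesis using w U(4) by blast
      qed
      then show "w \<in> P" unfolding cut_plane_def by blast
    qed
    \<comment> \<open>\<open>U\<close> may leave \<open>T\<close>, but its part above the cut is
      convex and inside the cut plane, so the identity spreads over that part.\<close>
    show "F z = ?g z"
    proof (rule vec_analytic_continuation[of "U \<inter> T \<inter> ?hi" "U \<inter> ?hi" F ?g])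
      show "open (U \<inter> T \<inter> ?hi)" "open (U \<inter> ?hi)" by (intro open_Int U T lohi)+
      show "connected (U \<inter> ?hi)" by (intro convex_connected convex_Int U lohi)
      show "F vec_holomorphic_on U \<inter> ?hi" by (rule vec_holomorphic_on_subset[OF F(1)]) blast
      show "?g vec_holomorphic_on U \<inter> ?hi" by (rule vec_holomorphic_P[OF g UP])
      show "F w = ?g w" if "w \<in> U \<inter> T \<inter> ?hi" for w using FF1[of w] hi[of w] that by auto
    qed (use V1 z in auto)
  qed
qed

lemma crosses_exists:
  assumes "is_solution lam A1 P f"
  shows "\<exists>a. crosses k f a"
proof -
  obtain c where c: "is_reg lam \<eta> k (\<lambda>z. f z - c *s Psing k z)" "\<not> singular k \<Longrightarrow> c = 0"
    using solution_decomposition[OF assms] by blast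
  from crosses_jump[OF assms jump_solution[OF c]] show ?thesis by blast
qed

section \<open>Combinations of the distinguished solutions and crossing a stack of cuts\<close>

lemma column_Psi_matrix: "column k (Psi_matrix Psi z) = Psi k z"
  by (simp add: Psi_matrix_def column_def vec_eq_iff)

lemma solution_Psi_mult: "is_solution lam A1 P (\<lambda>z. Psi_matrix Psi z *v v)"
  by (rule is_solution_matrix_vector_mult) (simp add: column_Psi_matrix solution_Psi)

lemma Psi_matrix_mult: "Psi_matrix Psi z *v v = (\<Sum>k\<in>UNIV. v $ k *s Psi k z)"
  unfolding matrix_mult_sum column_Psi_matrix ..

text \<open>By linearity \<open>(C *v v) $ j\<close> is the coefficient of \<open>Psing j\<close> in
  the combination with coefficients \<open>v\<close>; this is how \<open>C\<close> acquires its
  meaning as a matrix.\<close>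

lemma is_reg_Psi_mult:
  shows "is_reg lam \<eta> j (\<lambda>z. Psi_matrix Psi z *v v - (C *v v) $ j *s Psing j z)"
    and "\<not> singular j \<Longrightarrow> (C *v v) $ j = 0"
proof -
  show z: "(C *v v) $ j = 0" if "\<not> singular j"
    using connection_zero[OF that] by (simp add: matrix_vector_mult_def)
  show "is_reg lam \<eta> j (\<lambda>z. Psi_matrix Psi z *v v - (C *v v) $ j *s Psing j z)"
  proof (cases "singular j")
    case True
    have "is_reg lam \<eta> j (\<lambda>z. \<Sum>k\<in>UNIV. v $ k *s (Psi k z - C $ j $ k *s Psing j z))"
      by (intro is_reg_sum connection True)
    then show ?thesis
    proof (rule is_reg_cong[OF _ zero_less_one])
      fix z
      have "(C *v v) $ j = (\<Sum>k\<in>UNIV. v $ k * C $ j $ k)" by (simp add: matrix_vector_mult_def mult.commute)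
      then show "Psi_matrix Psi z *v v - (C *v v) $ j *s Psing j z
          = (\<Sum>k\<in>UNIV. v $ k *s (Psi k z - C $ j $ k *s Psing j z))"
        unfolding Psi_matrix_mult
        by (simp add: vec_eq_iff sum_distrib_right right_diff_distrib sum_subtractf mult.assoc)
    qed
  next
    case False
    obtain c where c: "is_reg lam \<eta> j (\<lambda>z. Psi_matrix Psi z *v v - c *s Psing j z)" "\<not> singular j \<Longrightarrow> c = 0"
      using solution_decomposition[OF solution_Psi_mult] by blast
    show ?thesis using c(1) c(2)[OF False] z[OF False] by simp
  qed
qed

lemma crosses_Psi_mult: "crosses k (\<lambda>z. Psi_matrix Psi z *v v) (alpha A1 k * (C *v v) $ k)"
  by (rule crosses_jump[OF solution_Psi_mult jump_solution]) (use is_reg_Psi_mult in blast)+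

text \<open>The coefficient picked up at a cut depends on those from the lower cuts only, so they
  can be chosen by well-founded recursion on height.\<close>

lemma choice_along_yc:
  assumes "\<And>a b k r. (\<And>i. yc \<eta> (lam i) < yc \<eta> (lam k) \<Longrightarrow> a i = b i) \<Longrightarrow> Q a k r = Q b k r"
    and "\<And>a k. \<exists>r. Q a k r"
  shows "\<exists>a. \<forall>k. Q a k (a k)"
proof -
  let ?R = "{(i, k). yc \<eta> (lam i) < yc \<eta> (lam k)}"
  have "?R \<subseteq> inv_image less_than (\<lambda>k. card {i. yc \<eta> (lam i) < yc \<eta> (lam k)})"
    by (auto intro!: psubset_card_mono)
  then have wf: "wf ?R" by (rule wf_subset[OF wf_inv_image[OF wf_less_than]])
  show ?thesis
  proof (rule dependent_wf_choice[OF wf])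
    show "Q a k r = Q b k r" if "\<And>i. (i, k) \<in> ?R \<Longrightarrow> a i = b i" for a b k r
      by (rule assms(1)) (use that in blast)
  qed (rule assms(2))
qed

text \<open>Induction on the number of cuts below \<open>z\<close>. Each \<open>a k\<close> is the
  crossing coefficient of the function already modified by the lower cuts, so the jumps of the
  previously added \<open>Psi i\<close> are included in it.\<close>

lemma right_halfplane_expansion:
  assumes f: "is_solution lam A1 P f" and G: "is_solution lam A1 {z. B < xc \<eta> z} G"
    and B: "\<And>k. xc \<eta> (lam k) < B" and y0: "\<And>k. y0 \<le> yc \<eta> (lam k)"
    and eq: "\<And>z. B < xc \<eta> z \<Longrightarrow> yc \<eta> z < y0 \<Longrightarrow> G z = f z"
    and a: "\<And>k. crosses k (\<lambda>z. f z + (\<Sum>i | yc \<eta> (lam i) < yc \<eta> (lam k). a i *s Psi i z)) (a k)"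
    and z: "B < xc \<eta> z" "z \<in> P"
  shows "G z = f z + (\<Sum>i | yc \<eta> (lam i) < yc \<eta> z. a i *s Psi i z)"
proof -
  have Hdisj: "{z. B < xc \<eta> z} \<inter> range lam = {}" 
  proof -
    have "lam k \<notin> {z. B < xc \<eta> z}" for k using B[of k] by simp
    then show ?thesis by blast
  qed
  have Ghol: "G vec_holomorphic_on {z. B < xc \<eta> z}"
    by (rule is_solution_imp_vec_holomorphic[OF G open_convex_halfplanes(3)])
  have Pneq: "yc \<eta> z \<noteq> yc \<eta> (lam k)" if "z \<in> P" "B < xc \<eta> z" for z k
    using that B[of k] by (auto simp: mem_cut_plane_iff)
  show ?thesis
    using z
  proof (induction "card {i. yc \<eta> (lam i) < yc \<eta> z}" arbitrary: z rule: less_induct)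
    case less
    show ?case
    proof (cases "{i. yc \<eta> (lam i) < yc \<eta> z} = {}")
      case True
      \<comment> \<open>Agreement is given only below \<open>y0\<close>, which may be far under the
        lowest cut; uniqueness on the convex quadrant below all cuts closes the distance.\<close>
      define ymin where "ymin = Min (range (\<lambda>k. yc \<eta> (lam k)))"
      have ymin: "ymin \<le> yc \<eta> (lam k)" "y0 \<le> ymin" for k using y0 by (auto simp: ymin_def)
      have "ymin \<in> range (\<lambda>k. yc \<eta> (lam k))" unfolding ymin_def by (rule Min_in) auto
      then obtain k where "ymin = yc \<eta> (lam k)" by blast
      then have z: "yc \<eta> z < ymin" using True Pneq[OF less.prems(2,1), of k] by (metis empty_iff linorder_neqE mem_Collect_eq)
      let ?S = "{z. B < xc \<eta> z} \<inter> {z. yc \<eta> z < ymin}"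
      have S: "open ?S" "convex ?S" by (intro open_Int convex_Int open_convex_halfplanes)+
      have SP: "?S \<subseteq> P" using ymin(1) by (auto simp: mem_cut_plane_iff) (metis less_le_not_le)
      have Sd: "?S \<inter> range lam = {}" using Hdisj by blast
      define p where "p = of_real (B + 1) * cis \<eta> + of_real (y0 - 1) * (\<i> * cis \<eta>)"
      have p: "xc \<eta> p = B + 1" "yc \<eta> p = y0 - 1" unfolding p_def by (rule xc_polar, rule yc_polar)
      have "G z = f z"
        by (rule is_solution_unique_Int[OF is_solution_subset[OF f SP] G S Sd open_convex_halfplanes(3,4), of p, symmetric])
          (use p z ymin eq[of p] less.prems in auto)
      then show ?thesis using True by simp
    next
      case False
      define I where "I = {i. yc \<eta> (lam i) < yc \<eta> z}"
      have "Max ((\<lambda>i. yc \<eta> (lam i)) ` I) \<in> (\<lambda>i. yc \<eta> (lam i)) ` I"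
        using False by (intro Max_in) (auto simp: I_def)
      then obtain k where k: "k \<in> I" "Max ((\<lambda>i. yc \<eta> (lam i)) ` I) = yc \<eta> (lam k)" by auto
      have kmax: "yc \<eta> (lam i) \<le> yc \<eta> (lam k)" if "i \<in> I" for i
        unfolding k(2)[symmetric] using that by (intro Max_ge) auto
      let ?J = "{i. yc \<eta> (lam i) < yc \<eta> (lam k)}"
      have kz: "yc \<eta> (lam k) < yc \<eta> z" using k(1) by (simp add: I_def)
      have I: "I = insert k ?J"
      proof (rule Set.set_eqI)
        fix i show "i \<in> I \<longleftrightarrow> i \<in> insert k ?J"
          using kmax[of i] kz yc_lam_neq[of i k] k(1) by (cases "i = k") (auto simp: I_def)
      qed
      \<comment> \<open>The part of the right half-plane between the levels of the two neighbouring
        cuts, with the \<open>k\<close>-th cut in between; its points below that cut have one cut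
        fewer beneath them, and the induction hypothesis applies there.\<close>
      define U where "U = {z. B < xc \<eta> z} \<inter> (\<Inter>i\<in>UNIV - {k}.
        if yc \<eta> (lam i) < yc \<eta> (lam k) then {z. yc \<eta> (lam i) < yc \<eta> z} else {z. yc \<eta> z < yc \<eta> (lam i)})"
      have U: "open U" "convex U" unfolding U_def
        by (intro open_Int convex_Int open_INT convex_INT; simp add: open_convex_halfplanes)+
      have Umem: "w \<in> U \<longleftrightarrow> B < xc \<eta> w \<and> (\<forall>i. i \<noteq> k \<longrightarrow>
          (if yc \<eta> (lam i) < yc \<eta> (lam k) then yc \<eta> (lam i) < yc \<eta> w else yc \<eta> w < yc \<eta> (lam i)))" for w
        unfolding U_def by auto
      have zU: "z \<in> U" unfolding Umem
      proof (intro conjI allI impI)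
        fix i assume i: "i \<noteq> k"
        show "if yc \<eta> (lam i) < yc \<eta> (lam k) then yc \<eta> (lam i) < yc \<eta> z else yc \<eta> z < yc \<eta> (lam i)"
        proof (cases "i \<in> I")
          case True
          then have "yc \<eta> (lam i) < yc \<eta> (lam k)" using kmax[OF True] yc_lam_neq[OF i] by simp
          then show ?thesis using True by (simp add: I_def)
        next
          case False
          then have "yc \<eta> z < yc \<eta> (lam i)" using Pneq[OF less.prems(2,1), of i] by (simp add: I_def)
          then show ?thesis using kz by simp
        qed
      qed (rule less.prems)
      define q where "q = of_real (B + 1) * cis \<eta> + of_real (yc \<eta> (lam k)) * (\<i> * cis \<eta>)"
      have q: "xc \<eta> q = B + 1" "yc \<eta> q = yc \<eta> (lam k)" unfolding q_def by (rule xc_polar, rule yc_polar)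
      have qU: "q \<in> U" unfolding Umem q using yc_lam_neq by (auto simp: not_less less_le)
      have qc: "q \<in> cut_ray (lam k) \<eta>" unfolding mem_cut_ray_iff q using B[of k] by simp
      have "G z = (f z + (\<Sum>i\<in>?J. a i *s Psi i z)) + a k *s Psi k z"
      proof (rule crossesD[OF a U(1,2) _ _ _ _ _ zU kz])
        show "lam k \<notin> U" unfolding Umem using B[of k] by simp
        show "U \<inter> cut_ray (lam i) \<eta> = {}" if "i \<noteq> k" for i
        proof -
          have "w \<notin> cut_ray (lam i) \<eta>" if "w \<in> U" for w
            using that \<open>i \<noteq> k\<close> unfolding Umem mem_cut_ray_iff by (metis less_irrefl)
          then show ?thesis by blast
        qed
        show "U \<inter> cut_ray (lam k) \<eta> \<noteq> {}" using qU qc by blast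
        show "G vec_holomorphic_on U" by (rule vec_holomorphic_on_subset[OF Ghol]) (auto simp: U_def)
        fix w assume w: "w \<in> U" "yc \<eta> w < yc \<eta> (lam k)"
        have below: "{i. yc \<eta> (lam i) < yc \<eta> w} = ?J"
        proof (rule Set.set_eqI)
          fix i show "i \<in> {i. yc \<eta> (lam i) < yc \<eta> w} \<longleftrightarrow> i \<in> ?J"
            using w unfolding Umem by (cases "i = k") (auto split: if_splits dest!: spec[of _ i])
        qed
        have wB: "B < xc \<eta> w" using w(1) unfolding Umem by simp
        have "yc \<eta> w \<noteq> yc \<eta> (lam i)" for i
          using w unfolding Umem by (cases "i = k") (metis less_irrefl)+
        then have wP: "w \<in> P" by (simp add: mem_cut_plane_iff)
        have "card {i. yc \<eta> (lam i) < yc \<eta> w} < card {i. yc \<eta> (lam i) < yc \<eta> z}"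
          unfolding below I[unfolded I_def] by (rule psubset_card_mono) auto
        from less.hyps[OF this wB wP] show "G w = f w + (\<Sum>i\<in>?J. a i *s Psi i w)" by (simp add: below)
      qed
      also have "\<dots> = f z + (\<Sum>i\<in>I. a i *s Psi i z)" unfolding I by (subst sum.insert) auto
      finally show ?thesis by (simp add: I_def)
    qed
  qed
qed

end

section \<open>Single-valued solutions near infinity\<close>

text \<open>For \<open>z powi (- \<mu> - 1)\<close> times a series in \<open>1 / z\<close> the
  system requires \<open>b 0\<close> to be an eigenvector for \<open>\<mu>\<close>, and then
  \<open>M (Suc l) *v b (Suc l) = \<nu> (Suc l) *s D (b l)\<close>. Taking the largest integer
  eigenvalue makes all \<open>M (Suc l)\<close> invertible, so no logarithm can arise.\<close>

lemma series_at_infinity: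
  fixes lam :: "'n::finite \<Rightarrow> complex" and A1 :: "complex^'n^'n"
  assumes "is_eigenvalue A1 (of_int m)"
  obtains R g \<delta> where "R > 0" "is_solution lam A1 {z. R < cmod z} g"
    "\<delta> > 0" "\<And>w. w \<noteq> 0 \<Longrightarrow> cmod w < \<delta> \<Longrightarrow> g (1 / w) \<noteq> 0"
proof -
  define n where "n = real CARD('n)"
  define S where "S = mat_norm1 A1"
  have n: "n \<ge> 1" unfolding n_def by (simp add: Suc_le_eq)
  have S: "S \<ge> 0" unfolding S_def by (rule mat_norm1_nonneg)
  have A1_le: "norm1 (A1 *v x) \<le> n * (S * norm1 x)" for x
    unfolding n_def S_def by (rule norm1_le[OF cmod_matrix_vector_mult_le])
  have norm1_scale: "norm1 (c *s x) = cmod c * norm1 x" for c and x :: "complex^'n"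
    unfolding norm1_def by (simp add: norm_mult sum_distrib_left)
  have norm1_pos: "norm1 x > 0" if "x \<noteq> 0" for x :: "complex^'n"
  proof -
    from that obtain i where "x $ i \<noteq> 0" by (auto simp: vec_eq_iff)
    then have "cmod (x $ i) > 0" by simp
    also have "\<dots> \<le> norm1 x" by (rule cmod_le_norm1)
    finally show ?thesis .
  qed
  define E where "E = {m::int. is_eigenvalue A1 (of_int m)}"
  have bound: "\<bar>real_of_int m\<bar> \<le> n * S" if "m \<in> E" for m
  proof -
    from that obtain v where v: "v \<noteq> 0" "A1 *v v = of_int m *s v" unfolding E_def is_eigenvalue_def by blast
    have "\<bar>real_of_int m\<bar> * norm1 v \<le> (n * S) * norm1 v"
      using A1_le[of v] unfolding v(2) norm1_scale by simp
    then show ?thesis using norm1_pos[OF v(1)] by simp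
  qed
  \<comment> \<open>An eigenvalue is bounded by a matrix norm, so there are finitely many integer
    ones and a largest one exists.\<close>
  have "E \<subseteq> {- \<lceil>n * S\<rceil>..\<lceil>n * S\<rceil>}"
  proof
    fix m assume "m \<in> E"
    from bound[OF this] show "m \<in> {- \<lceil>n * S\<rceil>..\<lceil>n * S\<rceil>}" by (auto simp: abs_le_iff) linarith+
  qed
  then have finE: "finite E" by (rule finite_subset) simp
  define \<mu> where "\<mu> = Max E"
  have "m \<in> E" using assms by (simp add: E_def)
  then have "\<mu> \<in> E" unfolding \<mu>_def using finE by (intro Max_in) auto
  then obtain v where v: "v \<noteq> 0" "A1 *v v = of_int \<mu> *s v" unfolding E_def is_eigenvalue_def by blast
  have notE: "\<mu> + int l \<notin> E" if "l > 0" for l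
  proof
    assume "\<mu> + int l \<in> E"
    from Max_ge[OF finE this] that show False by (simp add: \<mu>_def)
  qed
  define \<nu> where "\<nu> l = (of_int \<mu> + of_nat l :: complex)" for l
  define M where "M l = mat (\<nu> l) - A1" for l
  have Mmult: "M l *v x = \<nu> l *s x - A1 *v x" for l x
  proof -
    have "mat (\<nu> l) *v x = \<nu> l *s x"
      by (simp add: vec_eq_iff matrix_vector_mult_def mat_def if_distrib[of "\<lambda>c. c * _"] cong: if_cong)
    then show ?thesis by (simp add: M_def matrix_vector_mult_diff_rdistrib)
  qed
  have Mker: "x = 0" if "M (Suc l) *v x = 0" for l x
  proof (rule ccontr)
    assume "x \<noteq> 0"
    moreover have "A1 *v x = of_int (\<mu> + int (Suc l)) *s x" using that by (simp add: Mmult \<nu>_def)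
    ultimately have "\<mu> + int (Suc l) \<in> E" unfolding E_def is_eigenvalue_def by blast
    then show False using notE[of "Suc l"] by simp
  qed
  have "invertible (M (Suc l))" for l
    unfolding invertible_left_inverse matrix_left_invertible_ker using Mker by blast
  then have surj: "\<exists>x. M (Suc l) *v x = y" for l y
    unfolding invertible_right_inverse matrix_right_invertible_surjective by (metis surjD)
  define D :: "complex^'n \<Rightarrow> complex^'n" where "D x = (\<chi> i. lam i * x $ i)" for x
  define b where "b = rec_nat v (\<lambda>l x. SOME y. M (Suc l) *v y = \<nu> (Suc l) *s D x)"
  have b0: "b 0 = v" by (simp add: b_def)
  have bS: "M (Suc l) *v b (Suc l) = \<nu> (Suc l) *s D (b l)" for l
    unfolding b_def using someI_ex[OF surj] by simp
  define \<Lambda> where "\<Lambda> = (\<Sum>i\<in>UNIV. cmod (lam i))"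
  have \<Lambda>: "cmod (lam i) \<le> \<Lambda>" "\<Lambda> \<ge> 0" for i
    unfolding \<Lambda>_def by (rule member_le_sum) (auto intro: sum_nonneg)
  have D_le: "norm1 (D x) \<le> \<Lambda> * norm1 x" for x
    unfolding norm1_def D_def sum_distrib_left
    by (intro sum_mono) (auto simp: norm_mult intro!: mult_right_mono \<Lambda>)
  have norm1_tri: "norm1 (x + y) \<le> norm1 x + norm1 y" for x y :: "complex^'n"
    unfolding norm1_def sum.distrib[symmetric] by (intro sum_mono) (simp add: norm_triangle_ineq)
  have step: "cmod (\<nu> (Suc l)) * norm1 (b (Suc l)) \<le> cmod (\<nu> (Suc l)) * (\<Lambda> * norm1 (b l)) + n * (S * norm1 (b (Suc l)))" for l
  proof -
    have "\<nu> (Suc l) *s b (Suc l) = \<nu> (Suc l) *s D (b l) + A1 *v b (Suc l)"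
      using bS[of l] unfolding Mmult by (metis diff_add_cancel)
    then have "cmod (\<nu> (Suc l)) * norm1 (b (Suc l)) \<le> cmod (\<nu> (Suc l)) * norm1 (D (b l)) + norm1 (A1 *v b (Suc l))"
      using norm1_tri[of "\<nu> (Suc l) *s D (b l)" "A1 *v b (Suc l)"] by (metis norm1_scale)
    also have "\<dots> \<le> cmod (\<nu> (Suc l)) * (\<Lambda> * norm1 (b l)) + n * (S * norm1 (b (Suc l)))"
      by (intro add_mono mult_left_mono D_le A1_le) simp
    finally show ?thesis .
  qed
  \<comment> \<open>Beyond \<open>L\<close> the modulus of \<open>\<nu> (Suc l)\<close> is at least
    \<open>2 * (n * S)\<close>; half of the left side of \<open>step\<close> then absorbs the term
    with \<open>A1\<close>, which gives the factor \<open>2 * \<Lambda>\<close>.\<close>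
  obtain L where L: "real L \<ge> 2 * (n * S) + \<bar>real_of_int \<mu>\<bar> + 1" using real_arch_simple by blast
  have large: "norm1 (b (Suc l)) \<le> 2 * \<Lambda> * norm1 (b l)" if "l \<ge> L" for l
  proof -
    have "\<nu> (Suc l) = of_real (real_of_int \<mu> + real (Suc l))" by (simp add: \<nu>_def)
    then have "cmod (\<nu> (Suc l)) = \<bar>real_of_int \<mu> + real (Suc l)\<bar>" by (metis norm_of_real)
    moreover have "real (Suc l) \<ge> real L" using that by simp
    ultimately have nu: "cmod (\<nu> (Suc l)) \<ge> 2 * (n * S)" "cmod (\<nu> (Suc l)) > 0"
      using L n S by (smt (verit) mult_nonneg_nonneg)+
    have "2 * (n * S) * norm1 (b (Suc l)) \<le> cmod (\<nu> (Suc l)) * norm1 (b (Suc l))"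
      by (rule mult_right_mono[OF nu(1) norm1_nonneg])
    then have "cmod (\<nu> (Suc l)) * norm1 (b (Suc l)) \<le> cmod (\<nu> (Suc l)) * (2 * \<Lambda> * norm1 (b l))"
      using step[of l] by (simp add: algebra_simps)
    then show ?thesis using nu(2) by simp
  qed
  define q where "q = (\<lambda>l. norm1 (b (Suc l)) / norm1 (b l))"
  \<comment> \<open>The finitely many early ratios are added to the asymptotic factor. If
    \<open>b l = 0\<close>, the ratio carries no information, but then \<open>b (Suc l) = 0\<close>
    by injectivity of \<open>M (Suc l)\<close>.\<close>
  define A where "A = 2 * \<Lambda> + (\<Sum>l<L. q l)"
  have q0: "q l \<ge> 0" for l unfolding q_def by (intro divide_nonneg_nonneg norm1_nonneg)
  have all: "norm1 (b (Suc l)) \<le> A * (norm1 (b l) + 0 * 1 ^ l)" for l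
  proof (cases "l \<ge> L")
    case True
    have "2 * \<Lambda> * norm1 (b l) \<le> A * norm1 (b l)"
      unfolding A_def by (rule mult_right_mono[OF _ norm1_nonneg]) (use q0 in \<open>auto intro: sum_nonneg\<close>)
    then show ?thesis using large[OF True] by simp
  next
    case False
    show ?thesis
    proof (cases "b l = 0")
      case True
      then have "M (Suc l) *v b (Suc l) = 0" using bS[of l] by (simp add: D_def vec_eq_iff)
      then have "b (Suc l) = 0" by (rule Mker)
      then show ?thesis using True by (simp add: norm1_def)
    next
      case nz: False
      have "q l \<le> (\<Sum>l<L. q l)" using False q0 by (intro member_le_sum) auto
      then have "q l \<le> A" using \<Lambda>(2) by (simp add: A_def)
      then have "q l * norm1 (b l) \<le> A * norm1 (b l)" by (rule mult_right_mono[OF _ norm1_nonneg])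
      then show ?thesis using norm1_pos[OF nz] by (simp add: q_def)
    qed
  qed
  have "A \<ge> 0" unfolding A_def by (intro add_nonneg_nonneg sum_nonneg q0) (use \<Lambda>(2) in simp)
  from geometric_bound_recursion[of "\<lambda>l. norm1 (b l)" A 0 1, OF all this] obtain K \<rho> where
    K: "\<rho> > 0" "\<And>l. norm1 (b l) \<le> K * \<rho> ^ l" by auto
  have bK: "cmod (b l $ i) \<le> K * \<rho> ^ l" for l i by (rule order_trans[OF cmod_le_norm1 K(2)])
  have gb: "geometric_bound b" unfolding geometric_bound_def using K(1) bK by blast
  define k where "k w = (\<chi> i. powser (\<lambda>l. b l $ i) w)" for w
  define g where "g z = (z powi (- \<mu> - 1)) *s k (1 / z)" for z
  \<comment> \<open>The system in the variable \<open>w = 1 / z\<close>, after division by the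
    common power of \<open>z\<close>.\<close>
  have keq: "\<exists>d. ((\<lambda>w. k w $ i) has_field_derivative d) (at w) \<and>
      (lam i * w - 1) * (- (of_int \<mu> + 1) * k w $ i - w * d) = ((A1 + mat 1) *v k w) $ i"
    if w: "cmod w < 1 / \<rho>" for w i
  proof -
    obtain d where d: "(powser (\<lambda>l. b l $ i) has_field_derivative d) (at w)"
      "(\<lambda>l. of_nat (Suc l) * b (Suc l) $ i * w ^ l) sums d"
      "(\<lambda>l. of_nat l * b l $ i * w ^ l) sums (w * d)"
      by (rule powser_derivative[OF bK K(1) w])
    have s: "(\<lambda>l. b l $ i * w ^ l) sums k w $ i" for i unfolding k_def vec_lambda_beta by (rule powser_sums[OF bK K(1) w])
    define c where "c l = (of_int \<mu> + 1 + of_nat l) * b l $ i" for l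
    have "(\<lambda>l. (of_int \<mu> + 1) * (b l $ i * w ^ l) + of_nat l * b l $ i * w ^ l) sums ((of_int \<mu> + 1) * k w $ i + w * d)"
      by (intro sums_add sums_mult s d(3))
    then have c: "(\<lambda>l. c l * w ^ l) sums ((of_int \<mu> + 1) * k w $ i + w * d)"
      by (simp add: c_def algebra_simps)
    have "(\<lambda>l. (lam i * w) * (c l * w ^ l)) sums ((lam i * w) * ((of_int \<mu> + 1) * k w $ i + w * d))"
      by (rule sums_mult[OF c])
    then have "(\<lambda>l. (\<lambda>l. (case l of 0 \<Rightarrow> 0 | Suc l' \<Rightarrow> lam i * c l') * w ^ l) (Suc l)) sums ((lam i * w) * ((of_int \<mu> + 1) * k w $ i + w * d))"
      by (simp add: mult_ac)
    then have c': "(\<lambda>l. (case l of 0 \<Rightarrow> 0 | Suc l' \<Rightarrow> lam i * c l') * w ^ l) sums ((lam i * w) * ((of_int \<mu> + 1) * k w $ i + w * d))"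
      by (subst (asm) sums_Suc_iff) simp
    have "(\<lambda>l. \<Sum>j\<in>UNIV. (A1 + mat 1) $ i $ j * (b l $ j * w ^ l)) sums (\<Sum>j\<in>UNIV. (A1 + mat 1) $ i $ j * k w $ j)"
      by (intro sums_sum sums_mult s)
    moreover have "(\<Sum>j\<in>UNIV. (A1 + mat 1) $ i $ j * (b l $ j * w ^ l)) = ((A1 + mat 1) *v b l) $ i * w ^ l" for l
      unfolding matrix_vector_mult_def vec_lambda_beta sum_distrib_right by (simp add: mult.assoc)
    ultimately have rhs: "(\<lambda>l. ((A1 + mat 1) *v b l) $ i * w ^ l) sums ((A1 + mat 1) *v k w) $ i"
      by (simp add: matrix_vector_mult_def)
    have coef: "((A1 + mat 1) *v b l) $ i = c l - (case l of 0 \<Rightarrow> 0 | Suc l' \<Rightarrow> lam i * c l')" for l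
    proof (cases l)
      case 0
      then show ?thesis using v(2) by (simp add: b0 c_def matrix_vector_mult_add_rdistrib algebra_simps)
    next
      case (Suc l')
      have "A1 *v b l = \<nu> l *s b l - \<nu> l *s D (b l')" 
        using bS[of l'] unfolding Mmult Suc by (metis diff_diff_eq2 add_diff_cancel_left')
      then have "(A1 *v b l) $ i = \<nu> l * b l $ i - \<nu> l * (lam i * b l' $ i)" by (simp add: D_def)
      then have "((A1 + mat 1) *v b l) $ i = \<nu> l * b l $ i - \<nu> l * (lam i * b l' $ i) + b l $ i"
        by (simp add: matrix_vector_mult_add_rdistrib)
      then show ?thesis by (simp add: Suc c_def \<nu>_def algebra_simps)
    qed
    have "(\<lambda>l. c l * w ^ l - (case l of 0 \<Rightarrow> 0 | Suc l' \<Rightarrow> lam i * c l') * w ^ l) sums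
       (((of_int \<mu> + 1) * k w $ i + w * d) - (lam i * w) * ((of_int \<mu> + 1) * k w $ i + w * d))"
      by (rule sums_diff[OF c c'])
    then have "((A1 + mat 1) *v k w) $ i = ((of_int \<mu> + 1) * k w $ i + w * d) - (lam i * w) * ((of_int \<mu> + 1) * k w $ i + w * d)"
      using rhs unfolding coef left_diff_distrib by (rule sums_unique2[rotated])
    then show ?thesis using d(1) by (intro exI[of _ d]) (simp add: k_def algebra_simps)
  qed
  have sol: "is_solution lam A1 {z. \<rho> < cmod z} g"
    unfolding is_solution_iff
  proof
    fix z assume "z \<in> {z. \<rho> < cmod z}"
    then have z: "cmod z > \<rho>" by simp
    then have z0: "z \<noteq> 0" using K(1) by auto
    have w: "cmod (1 / z) < 1 / \<rho>" using z K(1) z0 by (simp add: norm_divide divide_strict_left_mono)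
    obtain d where d: "\<And>i. ((\<lambda>w. k w $ i) has_field_derivative d i) (at (1 / z))"
      "\<And>i. (lam i * (1 / z) - 1) * (- (of_int \<mu> + 1) * k (1 / z) $ i - (1 / z) * d i) = ((A1 + mat 1) *v k (1 / z)) $ i"
      using keq[OF w] by metis
    let ?p = "- \<mu> - 1"
    show "\<exists>D :: complex^'n. \<forall>i. ((\<lambda>w. g w $ i) has_field_derivative D $ i) (at z) \<and>
         (lam i - z) * D $ i = ((A1 + mat 1) *v g z) $ i"
    proof (intro exI[of _ "\<chi> i. (z powi ?p) * (1 / z) * (- (of_int \<mu> + 1) * k (1 / z) $ i - (1 / z) * d i)"] allI conjI)
      fix i
      have "((\<lambda>z. 1 / z) has_field_derivative (- 1 / z ^ 2)) (at z)"
        using z0 by (auto intro!: derivative_eq_intros simp: power2_eq_square)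
      from DERIV_chain2[where f = "\<lambda>w. k w $ i" and g = "\<lambda>z. 1 / z", OF d(1) this]
      have 1: "((\<lambda>z. k (1 / z) $ i) has_field_derivative d i * (- 1 / z ^ 2)) (at z)" .
      have 2: "((\<lambda>z. z powi ?p) has_field_derivative (of_int ?p * z powi (?p - 1))) (at z)"
        using z0 by (auto intro!: derivative_eq_intros)
      have 3: "z powi (p - 1) = z powi p * (1 / z)" for p :: int using z0 by (simp add: power_int_diff)
      have "((\<lambda>z. z powi ?p * k (1 / z) $ i) has_field_derivative
          (z powi ?p * (d i * (- 1 / z ^ 2)) + of_int ?p * z powi (?p - 1) * k (1 / z) $ i)) (at z)"
        by (rule DERIV_mult'[OF 2 1])
      moreover have "z powi ?p * (d i * (- 1 / z ^ 2)) + of_int ?p * z powi (?p - 1) * k (1 / z) $ i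
          = (z powi ?p) * (1 / z) * (- (of_int \<mu> + 1) * k (1 / z) $ i - (1 / z) * d i)"
        unfolding 3 using z0 by (simp add: power2_eq_square field_simps)
      ultimately show "((\<lambda>w. g w $ i) has_field_derivative
          (\<chi> i. (z powi ?p) * (1 / z) * (- (of_int \<mu> + 1) * k (1 / z) $ i - (1 / z) * d i)) $ i) (at z)"
        by (simp add: g_def)
      have "(lam i - z) * ((z powi ?p) * (1 / z) * (- (of_int \<mu> + 1) * k (1 / z) $ i - (1 / z) * d i))
        = (z powi ?p) * ((lam i * (1 / z) - 1) * (- (of_int \<mu> + 1) * k (1 / z) $ i - (1 / z) * d i))"
        using z0 by (simp add: field_simps)
      also have "\<dots> = (z powi ?p) * ((A1 + mat 1) *v k (1 / z)) $ i" unfolding d(2) ..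
      also have "\<dots> = ((A1 + mat 1) *v g z) $ i" by (simp add: g_def vector_scalar_commute)
      finally show "(lam i - z) * (\<chi> i. (z powi ?p) * (1 / z) * (- (of_int \<mu> + 1) * k (1 / z) $ i - (1 / z) * d i)) $ i
        = ((A1 + mat 1) *v g z) $ i" by simp
    qed
  qed
  obtain r where r: "r > 0" "(\<lambda>z. \<chi> i. powser (\<lambda>l. b l $ i) (z - 0)) vec_holomorphic_on ball 0 r"
    by (rule vec_holomorphic_on_powser[OF gb])
  then have "continuous_on (ball 0 r) k"
    using vec_holomorphic_on_imp_continuous_on[OF r(2)] by (simp add: k_def[abs_def])
  moreover have "k 0 \<noteq> 0" using v(1) by (simp add: k_def powser_0 b0)
  ultimately have "\<forall>\<^sub>F w in at 0. k w \<noteq> 0"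
    using r(1) by (intro tendsto_imp_eventually_ne[of k "k 0"])
      (auto simp: continuous_on_eq_continuous_at isCont_def)
  then obtain \<delta> where \<delta>: "\<delta> > 0" "\<And>w. w \<noteq> 0 \<Longrightarrow> cmod w < \<delta> \<Longrightarrow> k w \<noteq> 0"
    unfolding eventually_at by (auto simp: dist_norm)
  have "g (1 / w) \<noteq> 0" if "w \<noteq> 0" "cmod w < \<delta>" for w
    using \<delta>(2)[OF that] that(1) by (simp add: g_def vector_mul_eq_0)
  with that[OF K(1) sol \<delta>(1)] show ?thesis by blast
qed

text \<open>A Gronwall argument along rays: the coefficients are bounded by a constant over
  \<open>t\<close>, so the squared norm \<open>N2\<close> satisfies
  \<open>t * D \<le> \<kappa> * N2\<close> and its product with \<open>t powr (- \<kappa>)\<close>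
  does not increase. The squared norm is used because it is differentiable.\<close>

lemma solution_growth_at_infinity:
  fixes lam :: "'n::finite \<Rightarrow> complex" and A1 :: "complex^'n^'n"
  assumes g: "is_solution lam A1 {z. R < cmod z} g" and R: "R > 0" "\<And>i. cmod (lam i) \<le> R"
  obtains C N where "\<And>z i. 2 * R + 1 \<le> cmod z \<Longrightarrow> cmod (g z $ i) \<le> C * cmod z ^ N"
proof -
  \<comment> \<open>From \<open>2 * R\<close> on, \<open>lam i - z\<close> has modulus at least half
    that of \<open>z\<close>; the added \<open>1\<close> makes powers with larger exponents
    larger.\<close>
  define R1 where "R1 = 2 * R + 1"
  define S where "S = mat_norm1 (A1 + mat 1)"
  define n where "n = real CARD('n)"
  \<comment> \<open>One factor \<open>2\<close> comes from the bound on the denominators and one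
    from differentiating a square; \<open>n\<close> comes from bounding the squared sum norm by
    \<open>n * N2\<close>.\<close>
  define \<kappa> where "\<kappa> = 4 * S * n"
  have S: "S \<ge> 0" unfolding S_def by (rule mat_norm1_nonneg)
  have n: "n \<ge> 0" by (simp add: n_def)
  have R1: "R1 \<ge> 1" "R1 > R" "R1 > 0" using R(1) by (auto simp: R1_def)
  define N2 where "N2 z = (\<Sum>i\<in>UNIV. (cmod (g z $ i))\<^sup>2)" for z
  have "lam i \<notin> {z. R < cmod z}" for i using R(2)[of i] by simp
  then have disj: "{z. R < cmod z} \<inter> range lam = {}" by blast
  have "open {z. R < cmod z}" by (intro open_Collect_less continuous_intros)
  then have ghol: "g vec_holomorphic_on {z. R < cmod z}" by (rule is_solution_imp_vec_holomorphic[OF g])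
  have gc: "continuous_on (sphere 0 R1) g"
    using vec_holomorphic_on_imp_continuous_on[OF ghol] R1 by (auto intro: continuous_on_subset)
  have "continuous_on (sphere 0 R1) N2"
    unfolding N2_def by (intro continuous_intros gc)
  from continuous_bounded_above_on_compact[OF compact_sphere this] obtain M where
    M: "\<And>z. z \<in> sphere 0 R1 \<Longrightarrow> N2 z \<le> M" by auto
  have N20: "N2 z \<ge> 0" for z unfolding N2_def by (intro sum_nonneg) simp
  have "of_real R1 \<in> sphere (0 :: complex) R1" using R1 by simp
  then have M0: "M \<ge> 0" using M N20 order_trans by blast
  have growth: "N2 z \<le> M * cmod z powr \<kappa>" if z: "R1 \<le> cmod z" for z
  proof -
    define \<rho> where "\<rho> = cmod z"
    define e where "e = z / of_real \<rho>"
    have \<rho>: "\<rho> \<ge> R1" "\<rho> > 0" using z R1 by (auto simp: \<rho>_def)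
    have e: "cmod e = 1" "of_real \<rho> * e = z" using \<rho> by (auto simp: e_def norm_divide \<rho>_def)
    define u where "u t = g (of_real t * e)" for t
    define q where "q t = N2 (of_real t * e) * t powr (- \<kappa>)" for t
    have "q \<rho> \<le> q R1"
    proof (rule DERIV_nonpos_imp_nonincreasing[OF \<rho>(1)])
      fix t assume t: "R1 \<le> t" "t \<le> \<rho>"
      then have t0: "t > 0" using R1 by simp
      have ct: "cmod (of_real t * e) = t" using t0 e by (simp add: norm_mult)
      then have mem: "of_real t * e \<in> {z. R < cmod z}" using t R1 by simp
      define d where "d i = ((A1 + mat 1) *v u t) $ i / (lam i - of_real t * e)" for i
      have d_le: "cmod (d i) \<le> 2 * S * norm1 (u t) / t" for i
      proof -
        have "cmod (lam i - of_real t * e) \<ge> t - R"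
          using norm_triangle_ineq2[of "of_real t * e" "lam i"] ct R(2)[of i] by (simp add: norm_minus_commute)
        also have "t - R \<ge> t / 2" using t by (simp add: R1_def)
        finally have l: "cmod (lam i - of_real t * e) \<ge> t / 2" .
        have "cmod (d i) \<le> (S * norm1 (u t)) / (t / 2)"
          unfolding d_def norm_divide S_def
          by (rule frac_le[OF _ cmod_matrix_vector_mult_le _ l]) (use t0 in \<open>auto intro: mult_nonneg_nonneg mat_norm1_nonneg norm1_nonneg\<close>)
        then show ?thesis by (simp add: mult_ac)
      qed
      have du: "((\<lambda>t. u t $ i) has_vector_derivative e * d i) (at t)" for i
      proof -
        have 1: "((\<lambda>t. of_real t * e) has_vector_derivative e) (at t)"
          by (auto intro!: derivative_eq_intros simp: has_vector_derivative_def scaleR_conv_of_real)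
        have 2: "((\<lambda>w. g w $ i) has_field_derivative d i) (at (of_real t * e))"
          using g mem unfolding is_solution_iff_derivative[OF disj] d_def u_def by blast
        from field_vector_diff_chain_at[OF 1 2] show ?thesis by (simp add: u_def comp_def)
      qed
      have dsq: "((\<lambda>t. (cmod (u t $ i))\<^sup>2) has_real_derivative
          2 * (Re (u t $ i) * Re (e * d i) + Im (u t $ i) * Im (e * d i))) (at t)" for i
      proof -
        have re: "((\<lambda>t. Re (u t $ i)) has_real_derivative Re (e * d i)) (at t)"
          and im: "((\<lambda>t. Im (u t $ i)) has_real_derivative Im (e * d i)) (at t)"
          unfolding has_real_derivative_iff_has_vector_derivative
          by (rule bounded_linear.has_vector_derivative[OF bounded_linear_Re du]
              bounded_linear.has_vector_derivative[OF bounded_linear_Im du])+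
        show ?thesis unfolding cmod_power2
          by (rule derivative_eq_intros re im refl)+ (simp add: algebra_simps)
      qed
      define D where "D = (\<Sum>i\<in>UNIV. 2 * (Re (u t $ i) * Re (e * d i) + Im (u t $ i) * Im (e * d i)))"
      have dN2: "((\<lambda>t. N2 (of_real t * e)) has_real_derivative D) (at t)"
        unfolding N2_def D_def using dsq unfolding u_def by (intro DERIV_sum) auto
      have "D \<le> (\<Sum>i\<in>UNIV. 2 * (cmod (u t $ i) * (2 * S * norm1 (u t) / t)))"
        unfolding D_def
      proof (intro sum_mono mult_left_mono)
        fix i
        have "Re (u t $ i) * Re (e * d i) + Im (u t $ i) * Im (e * d i) = inner (u t $ i) (e * d i)"
          by (simp add: inner_complex_def)
        also have "\<dots> \<le> cmod (u t $ i) * cmod (e * d i)" by (rule norm_cauchy_schwarz)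
        also have "\<dots> \<le> cmod (u t $ i) * (2 * S * norm1 (u t) / t)"
          using d_le[of i] e by (intro mult_left_mono) (auto simp: norm_mult)
        finally show "Re (u t $ i) * Re (e * d i) + Im (u t $ i) * Im (e * d i)
            \<le> cmod (u t $ i) * (2 * S * norm1 (u t) / t)" .
      qed simp
      also have "\<dots> = (\<Sum>i\<in>UNIV. cmod (u t $ i) * (4 * S * norm1 (u t) / t))"
        by (intro sum.cong) auto
      also have "\<dots> = norm1 (u t) * (4 * S * norm1 (u t) / t)"
        unfolding norm1_def by (rule sum_distrib_right[symmetric])
      also have "\<dots> = 4 * S / t * (norm1 (u t))\<^sup>2" by (simp add: power2_eq_square)
      also have "\<dots> \<le> 4 * S / t * (N2 (of_real t * e) * n)"
        using S t0 sum_squared_le_sum_of_squares[where I = "UNIV :: 'n set" and f = "\<lambda>i. cmod (u t $ i)"]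
        unfolding norm1_def N2_def u_def n_def by (intro mult_left_mono) (auto simp: mult.commute)
      finally have "D \<le> \<kappa> * N2 (of_real t * e) / t" by (simp add: \<kappa>_def mult_ac)
      then have D: "t * D - \<kappa> * N2 (of_real t * e) \<le> 0" using t0 by (simp add: field_simps)
      have "(q has_real_derivative D * t powr (- \<kappa>) + N2 (of_real t * e) * (- \<kappa> * t powr (- \<kappa> - 1))) (at t)"
        unfolding q_def[abs_def]
        using DERIV_mult[OF dN2 has_real_derivative_powr[OF t0, of "- \<kappa>"]] by (simp add: algebra_simps)
      moreover have "D * t powr (- \<kappa>) + N2 (of_real t * e) * (- \<kappa> * t powr (- \<kappa> - 1))
          = t powr (- \<kappa> - 1) * (t * D - \<kappa> * N2 (of_real t * e))"
      proof -
        have "t powr (- \<kappa>) = t powr (- \<kappa> - 1) * t" using t0 powr_add[of t "- \<kappa> - 1" 1] by simp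
        then show ?thesis by (simp add: algebra_simps)
      qed
      moreover have "t powr (- \<kappa> - 1) * (t * D - \<kappa> * N2 (of_real t * e)) \<le> 0"
        using D by (intro mult_nonneg_nonpos) auto
      ultimately show "\<exists>y. (q has_real_derivative y) (at t) \<and> y \<le> 0" by metis
    qed
    also have "q R1 \<le> M * 1"
      unfolding q_def
    proof (rule mult_mono)
      show "N2 (of_real R1 * e) \<le> M" using e R1 by (intro M) (simp add: norm_mult)
      show "R1 powr (- \<kappa>) \<le> 1" using R1 S n by (simp add: powr_minus \<kappa>_def divide_simps ge_one_powr_ge_zero)
    qed (use M0 in auto)
    finally have "N2 z * \<rho> powr (- \<kappa>) \<le> M" unfolding q_def e(2) by simp
    then show ?thesis using \<rho>(2) by (simp add: powr_minus \<rho>_def divide_simps)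
  qed
  obtain N where N: "\<kappa> \<le> real N" using real_arch_simple by blast
  show ?thesis
  proof (rule that[of "sqrt M" N])
    fix z i assume "2 * R + 1 \<le> cmod z"
    then have z: "R1 \<le> cmod z" by (simp add: R1_def)
    have "(cmod (g z $ i))\<^sup>2 \<le> N2 z" unfolding N2_def by (rule member_le_sum) auto
    also have "\<dots> \<le> M * cmod z powr \<kappa>" by (rule growth[OF z])
    also have "\<dots> \<le> M * (cmod z ^ N)\<^sup>2"
    proof (rule mult_left_mono[OF _ M0])
      have z1: "cmod z \<ge> 1" using z R1 by simp
      have "cmod z powr \<kappa> \<le> cmod z powr real (2 * N)" using N z1 by (intro powr_mono) auto
      also have "\<dots> = cmod z ^ (2 * N)" 
        using z1 by (intro powr_realpow) (rule less_le_trans[OF zero_less_one])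
      finally show "cmod z powr \<kappa> \<le> (cmod z ^ N)\<^sup>2" by (simp add: power_mult[symmetric] mult.commute)
    qed
    also have "\<dots> = (sqrt M * cmod z ^ N)\<^sup>2" using M0 by (simp add: power_mult_distrib)
    finally show "cmod (g z $ i) \<le> sqrt M * cmod z ^ N"
      by (rule power2_le_imp_le) (use M0 in simp)
  qed
qed

text \<open>Order zero is included, with \<open>n = 0\<close>, so that all components that do not
  vanish identically can be treated alike.\<close>

lemma holomorphic_order_factor:
  assumes f: "f holomorphic_on ball 0 r" and z: "z \<in> ball 0 r" "f z \<noteq> 0"
  obtains n k e where "e > 0" "e \<le> r" "k holomorphic_on ball 0 e" "k 0 \<noteq> 0"
    "\<And>w. w \<in> ball 0 e \<Longrightarrow> f w = w ^ n * k w"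
proof (cases "f 0 = 0")
  case False
  have "r > 0" using z(1) by (auto intro: le_less_trans[OF norm_ge_zero])
  then show ?thesis using that[of r f 0] f False by simp
next
  case True
  have r: "r > 0" using z(1) by (auto intro: le_less_trans[OF norm_ge_zero])
  then have r0: "(0::complex) \<in> ball 0 r" by simp
  have "\<not> f constant_on ball 0 r"
    unfolding constant_on_def using True z r0 by metis
  then obtain k e n where k: "0 < n" "0 < e" "ball 0 e \<subseteq> ball (0::complex) r" "k holomorphic_on ball 0 e"
    "\<And>w. w \<in> ball 0 e \<Longrightarrow> f w = (w - 0) ^ n * k w" "\<And>w. w \<in> ball 0 e \<Longrightarrow> k w \<noteq> 0"
    using that by (rule holomorphic_factor_zero_nonconstant[OF f open_ball connected_ball r0 True])
  have sub: "ball 0 (min e r) \<subseteq> ball (0::complex) e" by auto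
  show ?thesis
  proof (rule that[of "min e r" k n])
    show "k holomorphic_on ball 0 (min e r)" by (rule holomorphic_on_subset[OF k(4) sub])
    show "k 0 \<noteq> 0" using k(2,6) by simp
    show "f w = w ^ n * k w" if "w \<in> ball 0 (min e r)" for w using k(5)[of w] that by simp
  qed (use k(2) r in auto)
qed

text \<open>That \<open>g\<close> is one function on the whole exterior makes
  \<open>w ^ N * g (1 / w)\<close> single-valued near zero, and polynomial growth makes its
  singularity removable. Extracting the lowest order gives
  \<open>g (1 / w) = w powi p *s K w\<close> with \<open>K 0 \<noteq> 0\<close>, and the system at
  \<open>w = 0\<close> says that \<open>K 0\<close> is an eigenvector of \<open>A1 + mat 1\<close>
  for \<open>p\<close>.\<close>

lemma eigenvalue_of_solution_at_infinity:
  fixes lam :: "'n::finite \<Rightarrow> complex" and A1 :: "complex^'n^'n"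
  assumes g: "is_solution lam A1 {z. R < cmod z} g" and R: "R > 0" "\<And>i. cmod (lam i) \<le> R"
    and nz: "\<And>\<rho>. \<exists>z. \<rho> < cmod z \<and> g z \<noteq> 0"
  shows "\<exists>m::int. is_eigenvalue A1 (of_int m)"
proof -
  obtain C N where growth: "\<And>z i. 2 * R + 1 \<le> cmod z \<Longrightarrow> cmod (g z $ i) \<le> C * cmod z ^ N"
    using solution_growth_at_infinity[OF g R] by blast
  define r where "r = 1 / (2 * R + 1)"
  have r: "r > 0" using R(1) by (simp add: r_def)
  have big: "cmod (1 / w) > 2 * R + 1" if "w \<in> ball 0 r - {0}" for w
    using that R(1) unfolding r_def by (auto simp: norm_divide field_simps)
  have "lam i \<notin> {z. R < cmod z}" for i using R(2)[of i] by simp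
  then have disj: "{z. R < cmod z} \<inter> range lam = {}" by blast
  have ghol: "g vec_holomorphic_on {z. R < cmod z}"
    by (rule is_solution_imp_vec_holomorphic[OF g]) (intro open_Collect_less continuous_intros)
  have "\<exists>H. H holomorphic_on ball 0 r \<and> (\<forall>w\<in>ball 0 r - {0}. H w = w ^ N * g (1 / w) $ i)" for i
  proof (rule holomorphic_on_extend_bounded[THEN iffD2])
    have "(\<lambda>z. g z $ i) \<circ> (\<lambda>w. 1 / w) holomorphic_on ball 0 r - {0}"
    proof (rule holomorphic_on_compose_gen[where t = "{z. R < cmod z}"])
      show "(\<lambda>z. g z $ i) holomorphic_on {z. R < cmod z}" using ghol unfolding vec_holomorphic_on_def by blast
      show "(\<lambda>w. 1 / w) ` (ball 0 r - {0}) \<subseteq> {z. R < cmod z}" using big R(1) by force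
    qed (intro holomorphic_intros, simp)
    then show "(\<lambda>w. w ^ N * g (1 / w) $ i) holomorphic_on ball 0 r - {0}"
      unfolding comp_def by (intro holomorphic_intros)
    show "0 \<in> interior (ball 0 r)" using r by simp
    show "\<exists>B. \<forall>\<^sub>F w in at 0. cmod (w ^ N * g (1 / w) $ i) \<le> B"
    proof (intro exI[of _ C])
      have "cmod (w ^ N * g (1 / w) $ i) \<le> C" if w: "w \<in> ball 0 r - {0}" for w
      proof -
        have "cmod (w ^ N * g (1 / w) $ i) \<le> cmod w ^ N * (C * cmod (1 / w) ^ N)"
          using growth[of "1 / w" i] big[OF w] by (simp add: norm_mult norm_power mult_left_mono)
        also have "\<dots> = C" using w by (simp add: norm_divide power_divide)
        finally show ?thesis .
      qed
      then show "\<forall>\<^sub>F w in at 0. cmod (w ^ N * g (1 / w) $ i) \<le> C"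
        unfolding eventually_at using r by (auto simp: dist_norm intro!: exI[of _ r])
    qed
  qed
  then obtain H where H: "\<And>i. H i holomorphic_on ball 0 r"
    "\<And>i w. w \<in> ball 0 r - {0} \<Longrightarrow> H i w = w ^ N * g (1 / w) $ i" by metis
  define I where "I = {i. \<exists>w\<in>ball 0 r. H i w \<noteq> 0}"
  have fac: "\<exists>n k e. e > 0 \<and> e \<le> r \<and> k holomorphic_on ball 0 e \<and> (\<forall>w\<in>ball 0 e. H i w = w ^ n * k w) \<and>
      (i \<in> I \<longleftrightarrow> k 0 \<noteq> 0)" for i
  proof (cases "i \<in> I")
    case True
    then obtain z where z: "z \<in> ball 0 r" "H i z \<noteq> 0" unfolding I_def by blast
    obtain n k e where "e > 0" "e \<le> r" "k holomorphic_on ball 0 e" "k 0 \<noteq> 0"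
      "\<And>w. w \<in> ball 0 e \<Longrightarrow> H i w = w ^ n * k w"
      using that by (rule holomorphic_order_factor[OF H(1) z])
    then show ?thesis using True by blast
  next
    case False
    then show ?thesis using r unfolding I_def by (intro exI[of _ 0] exI[of _ "\<lambda>_. 0"] exI[of _ r]) auto
  qed
  define Q where "Q i n k e \<longleftrightarrow> e > 0 \<and> e \<le> r \<and> k holomorphic_on ball 0 e \<and> (\<forall>w\<in>ball 0 e. H i w = w ^ n * k w) \<and>
      (i \<in> I \<longleftrightarrow> k 0 \<noteq> 0)" for i n k e
  have "\<exists>n k e. Q i n k e" for i using fac[of i] unfolding Q_def .
  then obtain n k e where "\<And>i. Q i (n i) (k i) (e i)" by metis
  then have k: "e i > 0" "e i \<le> r" "k i holomorphic_on ball 0 (e i)" "\<And>w. w \<in> ball 0 (e i) \<Longrightarrow> H i w = w ^ n i * k i w"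
    "i \<in> I \<longleftrightarrow> k i 0 \<noteq> 0" for i unfolding Q_def by blast+
  have "I \<noteq> {}"
  proof
    assume I0: "I = {}"
    obtain z where z: "2 * R + 1 < cmod z" "g z \<noteq> 0" using nz by blast
    then have z0: "z \<noteq> 0" "cmod z > 0" using R(1) by auto
    have "1 / z \<in> ball 0 r - {0}" using z z0 R(1) by (auto simp: r_def norm_divide divide_strict_left_mono)
    moreover have "H i (1 / z) = 0" for i using I0 \<open>1 / z \<in> ball 0 r - {0}\<close> unfolding I_def by blast
    ultimately have "g z $ i = 0" for i using H(2)[of "1 / z" i] z0 by simp
    then show False using z(2) by (simp add: vec_eq_iff)
  qed
  define n0 where "n0 = Min (n ` I)"
  have n0: "n0 \<in> n ` I" "\<And>i. i \<in> I \<Longrightarrow> n0 \<le> n i" unfolding n0_def using \<open>I \<noteq> {}\<close> by (auto intro: Min_in)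
  define e0 where "e0 = Min (range e)"
  have e0: "e0 > 0" "\<And>i. e0 \<le> e i" unfolding e0_def using k(1) by auto
  \<comment> \<open>All components are divided by the same power \<open>n0\<close>, the least order
    among those not identically zero; the component that attains it keeps a nonzero value at
    zero.\<close>
  define K where "K i w = (if i \<in> I then w ^ (n i - n0) * k i w else 0)" for i w
  have Khol: "K i holomorphic_on ball 0 e0" for i
  proof (cases "i \<in> I")
    case True
    have "k i holomorphic_on ball 0 e0" by (rule holomorphic_on_subset[OF k(3)]) (use e0(2)[of i] in auto)
    then show ?thesis using True unfolding K_def by (auto intro!: holomorphic_intros)
  qed (simp add: K_def[abs_def])
  obtain i0 where i0: "i0 \<in> I" "n i0 = n0" using n0(1) by blast
  have K0: "K i0 0 \<noteq> 0" using i0 k(5)[of i0] by (simp add: K_def)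
  define p where "p = int n0 - int N"
  have gK: "g (1 / w) $ i = w powi p * K i w" if w: "w \<in> ball 0 e0 - {0}" for w i
  proof -
    have wr: "w \<in> ball 0 r - {0}" "w \<in> ball 0 (e i)" "w \<noteq> 0" using w e0(2)[of i] k(2)[of i] by auto
    have "w ^ N * g (1 / w) $ i = H i w" using H(2)[OF wr(1)] by simp
    also have "\<dots> = w ^ n0 * K i w"
    proof (cases "i \<in> I")
      case True
      then show ?thesis using k(4)[OF wr(2)] n0(2)[OF True] by (simp add: K_def power_add[symmetric] mult.assoc[symmetric])
    next
      case False
      then show ?thesis using wr(1) unfolding I_def K_def by auto
    qed
    finally show ?thesis using wr(3) by (simp add: p_def power_int_diff field_simps)
  qed
  define A where "A = A1 + mat 1"
  have ode: "(\<Sum>j\<in>UNIV. A $ i $ j * K j w) = (1 - w * lam i) * (of_int p * K i w + w * deriv (K i) w)"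
    if w: "w \<in> ball 0 e0 - {0}" for w i
  proof -
    have w0: "w \<noteq> 0" and wr: "w \<in> ball 0 r - {0}" using w e0(2)[of i] k(2)[of i] by auto
    have mem: "1 / w \<in> {z. R < cmod z}" using big[OF wr] R(1) by simp
    have "lam i \<noteq> 1 / w" using R(2)[of i] mem by (metis mem_Collect_eq not_less)
    then have l: "lam i - 1 / w \<noteq> 0" by (simp del: right_minus_eq add: eq_iff_diff_eq_0[symmetric])
    define d where "d = ((A1 + mat 1) *v g (1 / w)) $ i / (lam i - 1 / w)"
    have 1: "((\<lambda>w. g w $ i) has_field_derivative d) (at (1 / w))"
      using g mem unfolding is_solution_iff_derivative[OF disj] d_def by blast
    have 2: "((\<lambda>w. 1 / w) has_field_derivative (- 1 / w ^ 2)) (at w)"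
      using w0 by (auto intro!: derivative_eq_intros simp: power2_eq_square)
    from DERIV_chain2[where f = "\<lambda>w. g w $ i" and g = "\<lambda>w. 1 / w", OF 1 2]
    have lhs: "((\<lambda>w. g (1 / w) $ i) has_field_derivative d * (- 1 / w ^ 2)) (at w)" .
    have "(K i has_field_derivative deriv (K i) w) (at w)"
      by (rule holomorphic_derivI[OF Khol open_ball]) (use w in auto)
    moreover have "((\<lambda>w. w powi p) has_field_derivative (of_int p * w powi (p - 1))) (at w)"
      using w0 by (auto intro!: derivative_eq_intros)
    ultimately have "((\<lambda>w. w powi p * K i w) has_field_derivative
        (w powi p * deriv (K i) w + of_int p * w powi (p - 1) * K i w)) (at w)"
      using DERIV_mult' by blast
    then have "((\<lambda>w. g (1 / w) $ i) has_field_derivative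
        (w powi p * deriv (K i) w + of_int p * w powi (p - 1) * K i w)) (at w)"
      by (rule has_field_derivative_transform_within_open[of _ _ _ "ball 0 e0 - {0}"])
        (use w gK in auto)
    from DERIV_unique[OF lhs this]
    have "d * (- 1 / w ^ 2) = w powi p * deriv (K i) w + of_int p * w powi (p - 1) * K i w" .
    also have "w powi (p - 1) = w powi p / w" using w0 by (simp add: power_int_diff)
    finally have e1: "d * (- 1 / w ^ 2) = w powi p * deriv (K i) w + of_int p * (w powi p / w) * K i w" .
    have e2: "((A1 + mat 1) *v g (1 / w)) $ i = w powi p * (\<Sum>j\<in>UNIV. A $ i $ j * K j w)"
      using gK[OF w] unfolding A_def matrix_vector_mult_def by (simp add: sum_distrib_left mult_ac)
    have "w powi p * (\<Sum>j\<in>UNIV. A $ i $ j * K j w) = d * (lam i - 1 / w)"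
      unfolding e2[symmetric] d_def using l by simp
    also have "\<dots> = (d * (- 1 / w ^ 2)) * (w * (1 - w * lam i))"
      using w0 by (simp add: power2_eq_square field_simps)
    also have "\<dots> = w powi p * ((1 - w * lam i) * (of_int p * K i w + w * deriv (K i) w))"
      unfolding e1 using w0 by (simp add: field_simps)
    finally show ?thesis using w0 by simp
  qed
  \<comment> \<open>The equation was derived for \<open>w \<noteq> 0\<close>; both sides are
    holomorphic at zero, so it persists there, and the terms with a factor \<open>w\<close>
    disappear.\<close>
  have at0: "(\<Sum>j\<in>UNIV. A $ i $ j * K j 0) = of_int p * K i 0" for i
  proof -
    have "(\<Sum>j\<in>UNIV. A $ i $ j * K j 0) = (1 - 0 * lam i) * (of_int p * K i 0 + 0 * deriv (K i) 0)"
    proof (rule analytic_continuation_open[of "ball 0 e0 - {0}" "ball 0 e0"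
          "\<lambda>w. \<Sum>j\<in>UNIV. A $ i $ j * K j w" "\<lambda>w. (1 - w * lam i) * (of_int p * K i w + w * deriv (K i) w)" 0])
      show "ball (0::complex) e0 - {0} \<noteq> {}"
      proof -
        have "of_real (e0 / 2) \<in> ball (0::complex) e0 - {0}" using e0(1) by simp
        then show ?thesis by blast
      qed
    qed (use e0(1) Khol ode in \<open>auto intro!: holomorphic_intros holomorphic_deriv open_delete\<close>)
    then show ?thesis by simp
  qed
  define x :: "complex^'n" where "x = (\<chi> i. K i 0)"
  have "A *v x = of_int p *s x" using at0 by (simp add: vec_eq_iff matrix_vector_mult_def x_def)
  then have "A1 *v x = of_int (p - 1) *s x"
    unfolding A_def matrix_vector_mult_add_rdistrib
    by (simp add: vec_eq_iff left_diff_distrib eq_diff_eq)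
  moreover have "x \<noteq> 0" using K0 by (auto simp: x_def vec_eq_iff)
  ultimately show ?thesis unfolding is_eigenvalue_def by blast
qed

section \<open>Invertibility and the eigenvalues of \<open>A\<^sub>1\<close>\<close>

context distinguished
begin

definition bnd :: real where "bnd = 1 + (\<Sum>k\<in>UNIV. cmod (lam k))"

lemma bnd: "cmod (lam k) < bnd" "\<bar>xc \<eta> (lam k)\<bar> < bnd" "\<bar>yc \<eta> (lam k)\<bar> < bnd" "bnd > 0"
proof -
  have "cmod (lam k) \<le> (\<Sum>k\<in>UNIV. cmod (lam k))" by (rule member_le_sum) auto
  then show 1: "cmod (lam k) < bnd" by (simp add: bnd_def)
  show "\<bar>xc \<eta> (lam k)\<bar> < bnd" "\<bar>yc \<eta> (lam k)\<bar> < bnd"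
    using 1 abs_xc_le[of \<eta> "lam k"] abs_yc_le[of \<eta> "lam k"] by simp_all
  show "bnd > 0" using 1 norm_ge_zero le_less_trans by blast
qed

definition pnt :: "real \<Rightarrow> real \<Rightarrow> complex" where
  "pnt s t = of_real s * cis \<eta> + of_real t * (\<i> * cis \<eta>)"

lemma xc_pnt: "xc \<eta> (pnt s t) = s" and yc_pnt: "yc \<eta> (pnt s t) = t"
  unfolding pnt_def by (rule xc_polar yc_polar)+

lemma halfplanes_subset_P:
  assumes "bnd \<le> B"
  shows "{z. xc \<eta> z < - B} \<subseteq> P" "{z. yc \<eta> z < - B} \<subseteq> P" "{z. B < yc \<eta> z} \<subseteq> P"
proof -
  have b: "- B < xc \<eta> (lam k)" "- B < yc \<eta> (lam k)" "yc \<eta> (lam k) < B" for k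
    using bnd(2,3)[of k] assms by auto
  show "{z. xc \<eta> z < - B} \<subseteq> P"
    by (auto simp: mem_cut_plane_iff intro: order.strict_trans[OF _ b(1)])
  have "yc \<eta> z \<noteq> yc \<eta> (lam k)" if "yc \<eta> z < - B \<or> B < yc \<eta> z" for z k using b(2,3)[of k] that by auto
  then show "{z. yc \<eta> z < - B} \<subseteq> P" "{z. B < yc \<eta> z} \<subseteq> P"
    by (auto simp: mem_cut_plane_iff)
qed

lemma right_halfplane_disjoint:
  assumes "bnd \<le> B"
  shows "{z. B < xc \<eta> z} \<inter> range lam = {}"
proof -
  have "lam k \<notin> {z. B < xc \<eta> z}" for k using bnd(2)[of k] assms by auto
  then show ?thesis by blast
qed

lemma below_top:
  assumes "B < yc \<eta> z" "bnd \<le> B"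
  shows "{i. yc \<eta> (lam i) < yc \<eta> z} = UNIV"
proof -
  have "yc \<eta> (lam i) < yc \<eta> z" for i using bnd(3)[of i] assms by linarith
  then show ?thesis by blast
qed

text \<open>\<open>G\<close> is the continuation of \<open>f\<close> across all cuts from below: the
  half-plane is convex and free of singular points, so the values of \<open>f\<close> below the cuts
  determine a solution on all of it.\<close>

lemma right_halfplane_solution:
  assumes f: "is_solution lam A1 P f"
  obtains G where "is_solution lam A1 {z. bnd < xc \<eta> z} G"
    "\<And>z. bnd < xc \<eta> z \<Longrightarrow> yc \<eta> z < - bnd \<Longrightarrow> G z = f z"
proof -
  let ?p = "pnt (bnd + 1) (- bnd - 1)"
  have p: "?p \<in> {z. bnd < xc \<eta> z}" by (simp add: xc_pnt)
  obtain G where G: "is_solution lam A1 {z. bnd < xc \<eta> z} G" "G ?p = f ?p"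
    using is_solution_exists_on_convex[OF open_convex_halfplanes(3,4) right_halfplane_disjoint[OF order_refl] p] by blast
  have "G z = f z" if "bnd < xc \<eta> z" "yc \<eta> z < - bnd" for z
    by (rule is_solution_unique_Int[OF G(1) is_solution_subset[OF f halfplanes_subset_P(2)[OF order_refl]]
          open_convex_halfplanes(3,4) right_halfplane_disjoint[OF order_refl] open_convex_halfplanes(5,6), of ?p])
      (use G(2) that in \<open>simp_all add: xc_pnt yc_pnt\<close>)
  with G(1) that show ?thesis by blast
qed

text \<open>If the continuation \<open>G\<close> of \<open>f\<close> across all cuts far out is \<open>f\<close> again, then \<open>f\<close> is single-valued
  near infinity.\<close>

lemma eigenvalue_of_fixed_solution:
  assumes f: "is_solution lam A1 P f" and G: "is_solution lam A1 {z. bnd < xc \<eta> z} G"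
    and lower: "\<And>z. bnd < xc \<eta> z \<Longrightarrow> yc \<eta> z < - bnd \<Longrightarrow> G z = f z"
    and q: "bnd < xc \<eta> q" "bnd < yc \<eta> q" "G q = f q" and nz: "p \<in> P" "f p \<noteq> 0"
  shows "\<exists>m::int. is_eigenvalue A1 (of_int m)"
proof -
  have sub: "{z. xc \<eta> z < - bnd} \<subseteq> P" "{z. yc \<eta> z < - bnd} \<subseteq> P" "{z. bnd < yc \<eta> z} \<subseteq> P"
    by (rule halfplanes_subset_P[OF order_refl])+
  have upper: "G z = f z" if "bnd < xc \<eta> z" "bnd < yc \<eta> z" for z
    by (rule is_solution_unique_Int[OF G is_solution_subset[OF f sub(3)] open_convex_halfplanes(3,4)
          right_halfplane_disjoint[OF order_refl] open_convex_halfplanes(7,8), of q]) (use q that in auto)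
  define g where "g z = (if bnd < xc \<eta> z then G z else f z)" for z
  have fz: "f z \<noteq> 0" if "z \<in> P" for z using solution_zero[OF f that _ nz(1)] nz(2) by blast
  have loc: "\<exists>T h. open T \<and> z \<in> T \<and> is_solution lam A1 T h \<and> (\<forall>w\<in>T. g w = h w)"
    if z: "z \<in> {z. 2 * bnd < cmod z}" for z
  proof -
    \<comment> \<open>The factor two forces one of the two coordinates to exceed \<open>bnd\<close>
      in modulus, so the exterior is covered by four half-planes on which the glued function is
      known.\<close>
    have "2 * bnd < \<bar>xc \<eta> z\<bar> + \<bar>yc \<eta> z\<bar>" using z norm_le_xc_yc[of z \<eta>] by simp
    then consider "bnd < xc \<eta> z" | "xc \<eta> z < - bnd" | "yc \<eta> z < - bnd" | "bnd < yc \<eta> z" by linarith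
    then show ?thesis
    proof cases
      case 1
      then show ?thesis
        by (intro exI[of _ "{z. bnd < xc \<eta> z}"] exI[of _ G]) (use G in \<open>auto simp: g_def open_convex_halfplanes\<close>)
    next
      case 2
      then show ?thesis using bnd(4) is_solution_subset[OF f sub(1)]
        by (intro exI[of _ "{z. xc \<eta> z < - bnd}"] exI[of _ f]) (auto simp: g_def open_convex_halfplanes)
    next
      case 3
      then show ?thesis using is_solution_subset[OF f sub(2)] lower
        by (intro exI[of _ "{z. yc \<eta> z < - bnd}"] exI[of _ f]) (auto simp: g_def open_convex_halfplanes)
    next
      case 4
      then show ?thesis using is_solution_subset[OF f sub(3)] upper
        by (intro exI[of _ "{z. bnd < yc \<eta> z}"] exI[of _ f]) (auto simp: g_def open_convex_halfplanes)
    qed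
  qed
  have gsol: "is_solution lam A1 {z. 2 * bnd < cmod z} g" by (rule is_solution_cong_local[OF loc])
  show ?thesis
  proof (rule eigenvalue_of_solution_at_infinity[OF gsol])
    show "0 < 2 * bnd" using bnd(4) by simp
    show "cmod (lam i) \<le> 2 * bnd" for i using bnd(1)[of i] bnd(4) by simp
    fix \<rho> :: real
    let ?z = "pnt (- (\<bar>\<rho>\<bar> + bnd + 1)) 0"
    have "\<bar>xc \<eta> ?z\<bar> \<le> cmod ?z" by (rule abs_xc_le)
    then have "\<rho> < cmod ?z" using bnd(4) unfolding xc_pnt by linarith
    moreover have "?z \<in> P" using sub(1) bnd(4) by (intro subsetD[OF sub(1)]) (simp add: xc_pnt)
    then have "g ?z \<noteq> 0" using fz bnd(4) by (simp add: g_def xc_pnt)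
    ultimately show "\<exists>z. \<rho> < cmod z \<and> g z \<noteq> 0" by blast
  qed
qed

lemma sum_Psi: "(\<Sum>i\<in>UNIV. a i *s Psi i z) = Psi_matrix Psi z *v (\<chi> i. a i)"
  unfolding Psi_matrix_mult by simp

lemma invertible_Psi_everywhere:
  assumes "q \<in> P" "invertible (Psi_matrix Psi q)" "z \<in> P"
  shows "invertible (Psi_matrix Psi z)"
  unfolding invertible_left_inverse matrix_left_invertible_ker
proof (intro allI impI)
  fix x assume "Psi_matrix Psi z *v x = 0"
  from solution_zero[OF solution_Psi_mult assms(3) this assms(1)]
  show "x = 0" using assms(2) unfolding invertible_left_inverse matrix_left_invertible_ker by blast
qed

text \<open>The dimension count in matrix form: for the solutions with unit values at
  \<open>q\<close>, the change under continuation is the matrix product of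
  \<open>Psi_matrix Psi q\<close> with the matrix of the coefficients \<open>a i\<close>. If the
  first factor is singular, so is the product, and a kernel vector yields a nonzero solution fixed
  by continuation.\<close>

lemma invertible_Psi_matrix:
  assumes no_ev: "\<nexists>m::int. is_eigenvalue A1 (of_int m)" and z: "z \<in> P"
  shows "invertible (Psi_matrix Psi z)"
proof -
  \<comment> \<open>A point far to the right and above all cuts, so that \<open>G q\<close> contains
    the contribution of every cut.\<close>
  define q where "q = pnt (bnd + 1) (bnd + 1)"
  have q: "bnd < xc \<eta> q" "bnd < yc \<eta> q" by (simp_all add: q_def xc_pnt yc_pnt)
  then have qP: "q \<in> P" using halfplanes_subset_P(3)[OF order_refl] by blast
  have "\<exists>Y G a. is_solution lam A1 P Y \<and> Y q = axis i 1 \<and> is_solution lam A1 {z. bnd < xc \<eta> z} G \<and>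
     (\<forall>z. bnd < xc \<eta> z \<longrightarrow> yc \<eta> z < - bnd \<longrightarrow> G z = Y z) \<and> G q = axis i 1 + Psi_matrix Psi q *v a" for i
  proof -
    obtain Y where Y: "is_solution lam A1 P Y" "Y q = axis i 1" using is_solution_exists[OF qP] by blast
    obtain G where G: "is_solution lam A1 {z. bnd < xc \<eta> z} G"
      "\<And>z. bnd < xc \<eta> z \<Longrightarrow> yc \<eta> z < - bnd \<Longrightarrow> G z = Y z"
      using right_halfplane_solution[OF Y(1)] by blast
    have sol: "is_solution lam A1 P (\<lambda>z. Y z + (\<Sum>i\<in>I. a i *s Psi i z))" for a I
      by (intro is_solution_add Y is_solution_sum is_solution_scale solution_Psi)
    have "\<exists>a. \<forall>k. crosses k (\<lambda>z. Y z + (\<Sum>i | yc \<eta> (lam i) < yc \<eta> (lam k). a i *s Psi i z)) (a k)"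
    proof (rule choice_along_yc)
      fix a b :: "'n \<Rightarrow> complex" and k r
      assume "\<And>i. yc \<eta> (lam i) < yc \<eta> (lam k) \<Longrightarrow> a i = b i"
      then have "(\<Sum>i | yc \<eta> (lam i) < yc \<eta> (lam k). a i *s Psi i z) = (\<Sum>i | yc \<eta> (lam i) < yc \<eta> (lam k). b i *s Psi i z)" for z
        by (intro sum.cong) auto
      then show "crosses k (\<lambda>z. Y z + (\<Sum>i | yc \<eta> (lam i) < yc \<eta> (lam k). a i *s Psi i z)) r
         = crosses k (\<lambda>z. Y z + (\<Sum>i | yc \<eta> (lam i) < yc \<eta> (lam k). b i *s Psi i z)) r" by simp
    qed (rule crosses_exists[OF sol])
    then obtain a where a: "\<forall>k. crosses k (\<lambda>z. Y z + (\<Sum>i | yc \<eta> (lam i) < yc \<eta> (lam k). a i *s Psi i z)) (a k)"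
      by (elim exE)
    have "G q = Y q + (\<Sum>i | yc \<eta> (lam i) < yc \<eta> q. a i *s Psi i q)"
    proof (rule right_halfplane_expansion[OF Y(1) G(1)])
      show "xc \<eta> (lam k) < bnd" "- bnd \<le> yc \<eta> (lam k)" for k using bnd(2,3)[of k] by auto
    qed (use G(2) a q qP in auto)
    then have "G q = axis i 1 + Psi_matrix Psi q *v (\<chi> i. a i)"
      unfolding below_top[OF q(2) order_refl] sum_Psi Y(2) .
    with Y G show ?thesis by blast
  qed
  then obtain Y G a where Y: "\<And>i. is_solution lam A1 P (Y i)" "\<And>i. Y i q = axis i 1"
    and G: "\<And>i. is_solution lam A1 {z. bnd < xc \<eta> z} (G i)"
      "\<And>i z. bnd < xc \<eta> z \<Longrightarrow> yc \<eta> z < - bnd \<Longrightarrow> G i z = Y i z"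
      "\<And>i. G i q = axis i 1 + Psi_matrix Psi q *v a i" by metis
  have "invertible (Psi_matrix Psi q)"
  proof (rule ccontr)
    assume sing: "\<not> invertible (Psi_matrix Psi q)"
    define M :: "complex^'n^'n" where "M = (\<chi> j i. a i $ j)"
    have colM: "column i M = a i" for i by (simp add: M_def column_def vec_eq_iff)
    have "det (Psi_matrix Psi q ** M) = 0"
      using sing by (simp add: det_mul invertible_det_nz)
    then obtain x where x: "x \<noteq> 0" "(Psi_matrix Psi q ** M) *v x = 0"
      using invertible_det_nz[of "Psi_matrix Psi q ** M"]
      unfolding invertible_left_inverse matrix_left_invertible_ker by blast
    let ?f = "\<lambda>z. \<Sum>i\<in>UNIV. x $ i *s Y i z" and ?G = "\<lambda>z. \<Sum>i\<in>UNIV. x $ i *s G i z"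
    have xs: "(\<Sum>i\<in>UNIV. x $ i *s axis i 1) = x" by (rule basis_expansion)
    have fq: "?f q = x" unfolding Y(2) by (rule xs)
    have "?G q = (\<Sum>i\<in>UNIV. x $ i *s axis i 1) + Psi_matrix Psi q *v (\<Sum>i\<in>UNIV. x $ i *s a i)"
      unfolding G(3) by (simp add: vector_add_ldistrib sum.distrib vec.linear_sum[OF matrix_vector_mul_linear_gen] vector_scalar_commute)
    also have "(\<Sum>i\<in>UNIV. x $ i *s a i) = M *v x" unfolding matrix_mult_sum colM ..
    also have "Psi_matrix Psi q *v (M *v x) = 0" using x(2) by (simp add: matrix_vector_mul_assoc)
    finally have Gq: "?G q = ?f q" unfolding xs fq by simp
    have "\<exists>m::int. is_eigenvalue A1 (of_int m)"
    proof (rule eigenvalue_of_fixed_solution[where f = ?f and G = ?G and q = q and p = q])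
      show "is_solution lam A1 P ?f" "is_solution lam A1 {z. bnd < xc \<eta> z} ?G"
        by (intro is_solution_sum is_solution_scale Y G)+
      show "?G z = ?f z" if "bnd < xc \<eta> z" "yc \<eta> z < - bnd" for z using G(2)[OF that] by simp
      show "?G q = ?f q" by (rule Gq)
      show "?f q \<noteq> 0" using fq x(1) by simp
    qed (use q qP in auto)
    then show False using no_ev by blast
  qed
  from invertible_Psi_everywhere[OF qP this z] show ?thesis .
qed

lemma invertible_C:
  assumes no_ev: "\<nexists>m::int. is_eigenvalue A1 (of_int m)"
  shows "invertible C"
  unfolding invertible_left_inverse matrix_left_invertible_ker
proof (intro allI impI, rule ccontr)
  fix v assume v: "C *v v = 0" "v \<noteq> 0"
  let ?f = "\<lambda>z. Psi_matrix Psi z *v v"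
  obtain G where G: "is_solution lam A1 {z. bnd < xc \<eta> z} G"
    "\<And>z. bnd < xc \<eta> z \<Longrightarrow> yc \<eta> z < - bnd \<Longrightarrow> G z = ?f z"
    using right_halfplane_solution[OF solution_Psi_mult] by blast
  define q where "q = pnt (bnd + 1) (bnd + 1)"
  have q: "bnd < xc \<eta> q" "bnd < yc \<eta> q" by (simp_all add: q_def xc_pnt yc_pnt)
  then have qP: "q \<in> P" using halfplanes_subset_P(3)[OF order_refl] by blast
  have "crosses k ?f 0" for k using crosses_Psi_mult[of k v] v(1) by simp
  then have cr: "crosses k (\<lambda>z. ?f z + (\<Sum>i | yc \<eta> (lam i) < yc \<eta> (lam k). 0 *s Psi i z)) 0" for k by simp
  have "G q = ?f q + (\<Sum>i | yc \<eta> (lam i) < yc \<eta> q. 0 *s Psi i q)"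
  proof (rule right_halfplane_expansion[OF solution_Psi_mult G(1)])
    show "xc \<eta> (lam k) < bnd" "- bnd \<le> yc \<eta> (lam k)" for k using bnd(2,3)[of k] by auto
  qed (use G(2) cr q qP in auto)
  then have Gq: "G q = ?f q" by simp
  have "?f q \<noteq> 0"
    using invertible_Psi_matrix[OF no_ev qP] v(2) unfolding invertible_left_inverse matrix_left_invertible_ker by blast
  from eigenvalue_of_fixed_solution[OF solution_Psi_mult G(1) G(2) q Gq qP this] no_ev
  show False by blast
qed

text \<open>If the combination vanishes, its singular part at each \<open>lam j\<close> is regular,
  which forces the coefficient of \<open>Psing j\<close> to be zero. Hence an invertible
  \<open>C\<close> makes the distinguished solutions independent.\<close>

lemma Psi_mult_zero:
  assumes "p \<in> P" "Psi_matrix Psi p *v v = 0"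
  shows "C *v v = 0"
proof -
  have zero: "Psi_matrix Psi z *v v = 0" if "z \<in> P" for z
    by (rule solution_zero[OF solution_Psi_mult assms that])
  have "(C *v v) $ j = 0" for j
  proof (cases "singular j")
    case True
    have "is_reg lam \<eta> j (\<lambda>z. (C *v v) $ j *s Psing j z)"
      by (rule is_reg_cong[OF is_reg_scale[OF is_reg_Psi_mult(1)[of j v], of "-1"] zero_less_one])
        (use zero slit_subset(1) in \<open>auto simp: vec_eq_iff\<close>)
    then show ?thesis by (rule Psing_not_reg[OF True])
  qed (rule is_reg_Psi_mult(2))
  then show ?thesis by (simp add: vec_eq_iff)
qed

lemma not_invertible_C:
  assumes ev: "is_eigenvalue A1 (of_int m)"
  shows "\<not> invertible C"
proof
  assume "invertible C"
  then have Cker: "v = 0" if "C *v v = 0" for v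
    using that unfolding invertible_left_inverse matrix_left_invertible_ker by blast
  have inv: "invertible (Psi_matrix Psi p)" if "p \<in> P" for p
    unfolding invertible_left_inverse matrix_left_invertible_ker
    using Psi_mult_zero[OF that] Cker by blast
  obtain R g \<delta> where R: "R > 0" and g: "is_solution lam A1 {z. R < cmod z} g"
    and \<delta>: "\<delta> > 0" "\<And>w. w \<noteq> 0 \<Longrightarrow> cmod w < \<delta> \<Longrightarrow> g (1 / w) \<noteq> 0"
    using that by (rule series_at_infinity[OF ev])
  define B where "B = max R bnd"
  have B: "bnd \<le> B" "R \<le> B" "B > 0" using R by (auto simp: B_def)
  have sub: "{z. xc \<eta> z < - B} \<subseteq> P" "{z. yc \<eta> z < - B} \<subseteq> P" "{z. B < yc \<eta> z} \<subseteq> P"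
    by (rule halfplanes_subset_P[OF B(1)])+
  have far: "{z. xc \<eta> z < - B} \<subseteq> {z. R < cmod z}" "{z. yc \<eta> z < - B} \<subseteq> {z. R < cmod z}"
    "{z. B < yc \<eta> z} \<subseteq> {z. R < cmod z}" "{z. B < xc \<eta> z} \<subseteq> {z. R < cmod z}"
  proof -
    have "R < cmod z" if "xc \<eta> z < - B \<or> yc \<eta> z < - B \<or> B < yc \<eta> z \<or> B < xc \<eta> z" for z
      using that B(2) abs_xc_le[of \<eta> z] abs_yc_le[of \<eta> z] by linarith
    then show "{z. xc \<eta> z < - B} \<subseteq> {z. R < cmod z}" "{z. yc \<eta> z < - B} \<subseteq> {z. R < cmod z}"
      "{z. B < yc \<eta> z} \<subseteq> {z. R < cmod z}" "{z. B < xc \<eta> z} \<subseteq> {z. R < cmod z}" by auto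
  qed
  have disjP: "S \<inter> range lam = {}" if "S \<subseteq> P" for S using that cut_plane_disjoint by blast
  define p where "p = pnt 0 (- B - 1)"
  have p: "yc \<eta> p < - B" by (simp add: p_def yc_pnt)
  then have pP: "p \<in> P" using sub(2) by blast
  obtain v where v: "Psi_matrix Psi p *v v = g p"
    using inv[OF pP] unfolding invertible_right_inverse matrix_right_invertible_surjective by (metis surjD)
  let ?f = "\<lambda>z. Psi_matrix Psi z *v v"
  note f = solution_Psi_mult[of v]
  note U = is_solution_unique_Int[OF is_solution_subset[OF f] is_solution_subset[OF g]]
  \<comment> \<open>The comparison goes around the cuts on their left through three half-planes in
    the cut plane. The series is one function on the whole exterior, so it also serves as the
    continuation on the right half-plane.\<close>
  have lower: "?f z = g z" if "yc \<eta> z < - B" for z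
    by (rule U[OF sub(2) far(2) open_convex_halfplanes(5,6) disjP[OF sub(2)] open_convex_halfplanes(5,6), of p])
      (use v p that in auto)
  have left: "?f z = g z" if "xc \<eta> z < - B" for z
    by (rule U[OF sub(1) far(1) open_convex_halfplanes(1,2) disjP[OF sub(1)] open_convex_halfplanes(1,2), of "pnt (- B - 1) (- B - 1)"])
      (use lower that in \<open>auto simp: xc_pnt yc_pnt\<close>)
  have upper: "?f z = g z" if "B < yc \<eta> z" for z
    by (rule U[OF sub(3) far(3) open_convex_halfplanes(7,8) disjP[OF sub(3)] open_convex_halfplanes(7,8), of "pnt (- B - 1) (B + 1)"])
      (use left that in \<open>auto simp: xc_pnt yc_pnt\<close>)
  \<comment> \<open>The coefficient vector of the combination reached after crossing all cuts below
    the \<open>k\<close>-th one; the next crossing coefficient is computed from it with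
    \<open>C\<close>.\<close>
  define vv where "vv a k = v + (\<chi> i. if yc \<eta> (lam i) < yc \<eta> (lam k) then a i else 0)" for a and k :: 'n
  have "\<exists>a. \<forall>k. a k = alpha A1 k * (C *v vv a k) $ k"
  proof (rule choice_along_yc[where Q = "\<lambda>a k r. r = alpha A1 k * (C *v vv a k) $ k"])
    fix a b :: "'n \<Rightarrow> complex" and k r
    assume "\<And>i. yc \<eta> (lam i) < yc \<eta> (lam k) \<Longrightarrow> a i = b i"
    then have "vv a k = vv b k" by (simp add: vv_def vec_eq_iff)
    then show "(r = alpha A1 k * (C *v vv a k) $ k) = (r = alpha A1 k * (C *v vv b k) $ k)" by simp
  qed blast
  then obtain a where a: "\<forall>k. a k = alpha A1 k * (C *v vv a k) $ k" by (elim exE)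
  have fvv: "?f z + (\<Sum>i | yc \<eta> (lam i) < yc \<eta> (lam k). a i *s Psi i z) = Psi_matrix Psi z *v vv a k" for z k
  proof -
    have "(\<Sum>i | yc \<eta> (lam i) < yc \<eta> (lam k). a i *s Psi i z)
        = (\<Sum>i\<in>UNIV. (if yc \<eta> (lam i) < yc \<eta> (lam k) then a i else 0) *s Psi i z)"
      by (intro sum.mono_neutral_cong_left) auto
    then show ?thesis unfolding vv_def sum_Psi by (simp add: matrix_vector_right_distrib)
  qed
  have cr: "crosses k (\<lambda>z. ?f z + (\<Sum>i | yc \<eta> (lam i) < yc \<eta> (lam k). a i *s Psi i z)) (a k)" for k
    unfolding fvv using crosses_Psi_mult[of k "vv a k"] a by simp
  define q where "q = pnt (B + 1) (B + 1)"
  have q: "B < xc \<eta> q" "B < yc \<eta> q" by (simp_all add: q_def xc_pnt yc_pnt)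
  then have qP: "q \<in> P" using sub(3) by blast
  have "g q = ?f q + (\<Sum>i | yc \<eta> (lam i) < yc \<eta> q. a i *s Psi i q)"
  proof (rule right_halfplane_expansion[OF f is_solution_subset[OF g far(4)] _ _ _ cr q(1) qP])
    show "xc \<eta> (lam k) < B" "- B \<le> yc \<eta> (lam k)" for k using bnd(2,3)[of k] B(1) by auto
  qed (use lower in auto)
  \<comment> \<open>Above all cuts the series again equals the original combination, so the total
    contribution of the cuts is zero, and independence makes every crossing coefficient
    zero.\<close>
  then have "Psi_matrix Psi q *v (\<chi> i. a i) = 0"
    unfolding below_top[OF q(2) B(1)] sum_Psi using upper[OF q(2)] by simp
  then have "(\<chi> i. a i) = 0"
    using inv[OF qP] unfolding invertible_left_inverse matrix_left_invertible_ker by blast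
  then have a0: "a k = 0" for k by (simp add: vec_eq_iff)
  have "vv a k = v" for k by (simp add: vv_def a0 vec_eq_iff)
  then have "(C *v v) $ k = 0" for k using a a0 alpha_nonzero[of k] by (metis mult_eq_0_iff)
  then have "C *v v = 0" by (simp add: vec_eq_iff)
  then have "v = 0" by (rule Cker)
  \<comment> \<open>A point below all cuts where \<open>g\<close> equals the zero combination, yet
    so far out that \<open>g\<close> cannot vanish.\<close>
  define t where "t = B + 1 + 1 / \<delta>"
  have t: "t > B" "t > 1 / \<delta>" "t > 0" using \<delta>(1) B(3) by (auto simp: t_def add_pos_pos)
  have cz: "cmod (pnt 0 (- t)) = t" using t(3) by (simp add: pnt_def norm_mult)
  then have z0: "pnt 0 (- t) \<noteq> 0" using t(3) by auto
  have "1 / t < \<delta>" using t(2,3) \<delta>(1) by (simp add: field_simps)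
  then have "g (1 / (1 / pnt 0 (- t))) \<noteq> 0" using z0 cz by (intro \<delta>(2)) (auto simp: norm_divide)
  moreover have "g (pnt 0 (- t)) = 0" using lower[of "pnt 0 (- t)"] t(1) \<open>v = 0\<close> by (simp add: yc_pnt)
  ultimately show False by simp
qed

lemma invertible_C_iff: "invertible C \<longleftrightarrow> (\<nexists>m::int. is_eigenvalue A1 (of_int m))"
  using invertible_C not_invertible_C by blast

lemma fundamental_matrix:
  assumes "\<nexists>m::int. is_eigenvalue A1 (of_int m)"
  shows "is_fundamental_matrix lam A1 P (Psi_matrix Psi)"
  unfolding is_fundamental_matrix_def column_Psi_matrix
  using solution_Psi invertible_Psi_matrix[OF assms] by blast

end

section \<open>Analytic continuation along paths\<close>

lemma continues_along_cong:
  assumes "continues_along \<gamma> Y Z" "\<forall>\<^sub>F w in nhds (\<gamma> 0). Y w = Y' w" "\<forall>\<^sub>F w in nhds (\<gamma> 1). Z w = Z' w"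
  shows "continues_along \<gamma> Y' Z'"
proof -
  obtain F where F: "\<forall>t\<in>{0..1}. \<forall>i j. (\<lambda>w. F t w $ i $ j) analytic_on {\<gamma> t}"
      "\<forall>t\<in>{0..1}. \<exists>\<delta>>0. \<forall>s\<in>{0..1}. \<bar>s - t\<bar> < \<delta> \<longrightarrow> (\<forall>\<^sub>F w in nhds (\<gamma> s). F s w = F t w)"
      "\<forall>\<^sub>F w in nhds (\<gamma> 0). F 0 w = Y w" "\<forall>\<^sub>F w in nhds (\<gamma> 1). F 1 w = Z w"
    using assms(1) unfolding continues_along_def by (elim exE conjE)
  have "\<forall>\<^sub>F w in nhds (\<gamma> 0). F 0 w = Y' w" using F(3) assms(2) by eventually_elim simp
  moreover have "\<forall>\<^sub>F w in nhds (\<gamma> 1). F 1 w = Z' w" using F(4) assms(3) by eventually_elim simp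
  ultimately show ?thesis unfolding continues_along_def using F(1,2) by (intro exI[of _ F] conjI)
qed

lemma continues_along_constant:
  assumes "open S" "path_image \<gamma> \<subseteq> S" "\<And>i j. (\<lambda>w. Y w $ i $ j) holomorphic_on S"
  shows "continues_along \<gamma> Y Y"
  unfolding continues_along_def
proof (intro exI[of _ "\<lambda>t. Y"] conjI ballI allI)
  fix t :: real and i j assume "t \<in> {0..1}"
  then have "{\<gamma> t} \<subseteq> S" using assms(2) by (auto simp: path_image_def)
  moreover have "(\<lambda>w. Y w $ i $ j) analytic_on S" using assms(1,3) by (simp add: analytic_on_open)
  ultimately show "(\<lambda>w. Y w $ i $ j) analytic_on {\<gamma> t}" by (rule analytic_on_subset[rotated])
qed (auto intro: exI[of _ 1])

lemma continues_along_reverse: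
  assumes "continues_along \<gamma> Y Z"
  shows "continues_along (reversepath \<gamma>) Z Y"
proof -
  obtain F where F: "\<forall>t\<in>{0..1}. \<forall>i j. (\<lambda>w. F t w $ i $ j) analytic_on {\<gamma> t}"
      "\<forall>t\<in>{0..1}. \<exists>\<delta>>0. \<forall>s\<in>{0..1}. \<bar>s - t\<bar> < \<delta> \<longrightarrow> (\<forall>\<^sub>F w in nhds (\<gamma> s). F s w = F t w)"
      "\<forall>\<^sub>F w in nhds (\<gamma> 0). F 0 w = Y w" "\<forall>\<^sub>F w in nhds (\<gamma> 1). F 1 w = Z w"
    using assms(1) unfolding continues_along_def by (elim exE conjE)
  show ?thesis unfolding continues_along_def
  proof (intro exI[of _ "\<lambda>t. F (1 - t)"] conjI ballI)
    fix t :: real assume t: "t \<in> {0..1}"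
    then have t': "1 - t \<in> {0..1}" by auto
    show "\<forall>i j. (\<lambda>w. F (1 - t) w $ i $ j) analytic_on {reversepath \<gamma> t}"
      using F(1) t' by (simp add: reversepath_def)
    obtain \<delta> where \<delta>: "\<delta> > 0" "\<forall>s\<in>{0..1}. \<bar>s - (1 - t)\<bar> < \<delta> \<longrightarrow> (\<forall>\<^sub>F w in nhds (\<gamma> s). F s w = F (1 - t) w)"
      using F(2) t' by blast
    have "\<forall>\<^sub>F w in nhds (reversepath \<gamma> s). F (1 - s) w = F (1 - t) w" if "s \<in> {0..1}" "\<bar>s - t\<bar> < \<delta>" for s
      using bspec[OF \<delta>(2), of "1 - s"] that by (auto simp: reversepath_def abs_minus_commute)
    then show "\<exists>\<delta>>0. \<forall>s\<in>{0..1}. \<bar>s - t\<bar> < \<delta> \<longrightarrow> (\<forall>\<^sub>F w in nhds (reversepath \<gamma> s). F (1 - s) w = F (1 - t) w)"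
      using \<delta>(1) by (intro exI[of _ \<delta>]) simp
  qed (use F(3,4) in \<open>simp_all add: reversepath_def\<close>)
qed

lemma continues_along_mult_right:
  fixes Y Z :: "complex \<Rightarrow> complex^'n^'m" and M :: "complex^'k^'n"
  assumes "continues_along \<gamma> Y Z"
  shows "continues_along \<gamma> (\<lambda>z. Y z ** M) (\<lambda>z. Z z ** M)"
proof -
  obtain F where F: "\<forall>t\<in>{0..1}. \<forall>i j. (\<lambda>w. F t w $ i $ j) analytic_on {\<gamma> t}"
      "\<forall>t\<in>{0..1}. \<exists>\<delta>>0. \<forall>s\<in>{0..1}. \<bar>s - t\<bar> < \<delta> \<longrightarrow> (\<forall>\<^sub>F w in nhds (\<gamma> s). F s w = F t w)"
      "\<forall>\<^sub>F w in nhds (\<gamma> 0). F 0 w = Y w" "\<forall>\<^sub>F w in nhds (\<gamma> 1). F 1 w = Z w"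
    using assms(1) unfolding continues_along_def by (elim exE conjE)
  show ?thesis unfolding continues_along_def
  proof (intro exI[of _ "\<lambda>t w. F t w ** M"] conjI ballI allI)
    fix t :: real and i j assume t: "t \<in> {0..1}"
    show "(\<lambda>w. (F t w ** M) $ i $ j) analytic_on {\<gamma> t}"
      unfolding matrix_matrix_mult_def vec_lambda_beta
      using F(1) t by (intro analytic_on_sum analytic_on_mult analytic_on_const) auto
  next
    fix t :: real assume t: "t \<in> {0..1}"
    obtain \<delta> where \<delta>: "\<delta> > 0" "\<forall>s\<in>{0..1}. \<bar>s - t\<bar> < \<delta> \<longrightarrow> (\<forall>\<^sub>F w in nhds (\<gamma> s). F s w = F t w)"
      using F(2) t by blast
    have "\<forall>\<^sub>F w in nhds (\<gamma> s). F s w ** M = F t w ** M" if "s \<in> {0..1}" "\<bar>s - t\<bar> < \<delta>" for s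
    proof -
      have "\<forall>\<^sub>F w in nhds (\<gamma> s). F s w = F t w" using \<delta>(2) that by blast
      then show ?thesis by eventually_elim simp
    qed
    then show "\<exists>\<delta>>0. \<forall>s\<in>{0..1}. \<bar>s - t\<bar> < \<delta> \<longrightarrow> (\<forall>\<^sub>F w in nhds (\<gamma> s). F s w ** M = F t w ** M)"
      using \<delta>(1) by blast
  next
    show "\<forall>\<^sub>F w in nhds (\<gamma> 0). F 0 w ** M = Y w ** M" using F(3) by eventually_elim simp
    show "\<forall>\<^sub>F w in nhds (\<gamma> 1). F 1 w ** M = Z w ** M" using F(4) by eventually_elim simp
  qed
qed

text \<open>Away from the junction the two families are only reparametrized. At the junction both
  families represent the germ of \<open>Z\<close>, and continuity of the second path keeps its
  beginning inside the open set where they coincide.\<close>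

lemma continues_along_join:
  assumes 1: "continues_along \<gamma>1 Y Z" and 2: "continues_along \<gamma>2 Z W"
    and p: "path \<gamma>2" "pathfinish \<gamma>1 = pathstart \<gamma>2"
  shows "continues_along (\<gamma>1 +++ \<gamma>2) Y W"
proof -
  obtain F where F: "\<forall>t\<in>{0..1}. \<forall>i j. (\<lambda>w. F t w $ i $ j) analytic_on {\<gamma>1 t}"
      "\<forall>t\<in>{0..1}. \<exists>\<delta>>0. \<forall>s\<in>{0..1}. \<bar>s - t\<bar> < \<delta> \<longrightarrow> (\<forall>\<^sub>F w in nhds (\<gamma>1 s). F s w = F t w)"
      "\<forall>\<^sub>F w in nhds (\<gamma>1 0). F 0 w = Y w" "\<forall>\<^sub>F w in nhds (\<gamma>1 1). F 1 w = Z w"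
    using 1 unfolding continues_along_def by (elim exE conjE)
  obtain G where G: "\<forall>t\<in>{0..1}. \<forall>i j. (\<lambda>w. G t w $ i $ j) analytic_on {\<gamma>2 t}"
      "\<forall>t\<in>{0..1}. \<exists>\<delta>>0. \<forall>s\<in>{0..1}. \<bar>s - t\<bar> < \<delta> \<longrightarrow> (\<forall>\<^sub>F w in nhds (\<gamma>2 s). G s w = G t w)"
      "\<forall>\<^sub>F w in nhds (\<gamma>2 0). G 0 w = Z w" "\<forall>\<^sub>F w in nhds (\<gamma>2 1). G 1 w = W w"
    using 2 unfolding continues_along_def by (elim exE conjE)
  define H where "H t = (if t \<le> 1/2 then F (2 * t) else G (2 * t - 1))" for t :: real
  let ?g = "\<gamma>1 +++ \<gamma>2"
  have gl: "?g t = \<gamma>1 (2 * t)" if "t \<le> 1/2" for t using that by (simp add: joinpaths_def)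
  have gr: "?g t = \<gamma>2 (2 * t - 1)" if "t > 1/2" for t using that by (simp add: joinpaths_def)
  show ?thesis unfolding continues_along_def
  proof (intro exI[of _ H] conjI ballI)
    fix t :: real assume t: "t \<in> {0..1}"
    show "\<forall>i j. (\<lambda>w. H t w $ i $ j) analytic_on {?g t}"
    proof (cases "t \<le> 1/2")
      case True
      then have "2 * t \<in> {0..1}" using t by auto
      then show ?thesis unfolding gl[OF True] H_def using F(1) True by simp
    next
      case False
      then have "2 * t - 1 \<in> {0..1}" using t by auto
      moreover have "t > 1/2" using False by simp
      ultimately show ?thesis unfolding gr[OF \<open>t > 1/2\<close>] H_def using G(1) False by simp
    qed
    show "\<exists>\<delta>>0. \<forall>s\<in>{0..1}. \<bar>s - t\<bar> < \<delta> \<longrightarrow> (\<forall>\<^sub>F w in nhds (?g s). H s w = H t w)"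
    proof (cases "t > 1/2")
      case True
      then have "2 * t - 1 \<in> {0..1}" using t by auto
      then obtain \<delta> where \<delta>: "\<delta> > 0" "\<forall>s\<in>{0..1}. \<bar>s - (2 * t - 1)\<bar> < \<delta> \<longrightarrow> (\<forall>\<^sub>F w in nhds (\<gamma>2 s). G s w = G (2 * t - 1) w)"
        using G(2) by blast
      show ?thesis
      proof (intro exI[of _ "min (\<delta> / 2) (t - 1/2)"] conjI ballI impI)
        fix s :: real assume s: "s \<in> {0..1}" "\<bar>s - t\<bar> < min (\<delta> / 2) (t - 1/2)"
        then have s2: "s > 1/2" by linarith
        have "\<bar>(2 * s - 1) - (2 * t - 1)\<bar> < \<delta>" using s(2) by linarith
        then have "\<forall>\<^sub>F w in nhds (\<gamma>2 (2 * s - 1)). G (2 * s - 1) w = G (2 * t - 1) w"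
          using bspec[OF \<delta>(2), of "2 * s - 1"] s s2 by simp
        then show "\<forall>\<^sub>F w in nhds (?g s). H s w = H t w"
          unfolding gr[OF s2] H_def using s2 True by simp
      qed (use \<delta>(1) True in simp)
    next
      case False
      then have "2 * t \<in> {0..1}" using t by auto
      then obtain \<delta> where \<delta>: "\<delta> > 0" "\<forall>s\<in>{0..1}. \<bar>s - 2 * t\<bar> < \<delta> \<longrightarrow> (\<forall>\<^sub>F w in nhds (\<gamma>1 s). F s w = F (2 * t) w)"
        using F(2) by blast
      have left: "\<forall>\<^sub>F w in nhds (?g s). H s w = H t w" if s: "s \<in> {0..1}" "\<bar>s - t\<bar> < \<delta> / 2" "s \<le> 1/2" for s
      proof -
        have "\<bar>2 * s - 2 * t\<bar> < \<delta>" using s(2) by linarith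
        then have "\<forall>\<^sub>F w in nhds (\<gamma>1 (2 * s)). F (2 * s) w = F (2 * t) w"
          using bspec[OF \<delta>(2), of "2 * s"] s by simp
        then show ?thesis unfolding gl[OF s(3)] H_def using s(3) False by simp
      qed
      show ?thesis
      proof (cases "t = 1/2")
        case False
        with \<open>\<not> t > 1/2\<close> have t2: "t < 1/2" by simp
        show ?thesis
        proof (intro exI[of _ "min (\<delta> / 2) (1/2 - t)"] conjI ballI impI)
          fix s :: real assume s: "s \<in> {0..1}" "\<bar>s - t\<bar> < min (\<delta> / 2) (1/2 - t)"
          then show "\<forall>\<^sub>F w in nhds (?g s). H s w = H t w" by (intro left) linarith+
        qed (use \<delta>(1) t2 in simp)
      next
        case True
        \<comment> \<open>At the junction \<open>H\<close> follows the first family, so for slightly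
          later parameters the second family has to be compared with \<open>F 1\<close>, by way of
          \<open>G 0\<close> and the common set \<open>V\<close>.\<close>
        obtain \<epsilon> where \<epsilon>: "\<epsilon> > 0" "\<forall>s\<in>{0..1}. \<bar>s - 0\<bar> < \<epsilon> \<longrightarrow> (\<forall>\<^sub>F w in nhds (\<gamma>2 s). G s w = G 0 w)"
          using G(2) by (metis atLeastAtMost_iff le_numeral_extra(3) zero_le_one)
        have "\<gamma>1 1 = \<gamma>2 0" using p(2) by (simp add: pathfinish_def pathstart_def)
        then have "\<forall>\<^sub>F w in nhds (\<gamma>2 0). F 1 w = Z w" using F(4) by simp
        with G(3) have "\<forall>\<^sub>F w in nhds (\<gamma>2 0). G 0 w = F 1 w" by eventually_elim simp
        then obtain V where V: "open V" "\<gamma>2 0 \<in> V" "\<And>w. w \<in> V \<Longrightarrow> G 0 w = F 1 w"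
          unfolding eventually_nhds by blast
        have "continuous_on {0..1} \<gamma>2" using p(1) by (simp add: path_def)
        moreover obtain e where e: "e > 0" "ball (\<gamma>2 0) e \<subseteq> V" using V(1,2) open_contains_ball by blast
        ultimately obtain d where d: "d > 0" "\<And>s. s \<in> {0..1} \<Longrightarrow> dist s 0 < d \<Longrightarrow> dist (\<gamma>2 s) (\<gamma>2 0) < e"
          unfolding continuous_on_iff by (metis atLeastAtMost_iff le_numeral_extra(3) zero_le_one)
        show ?thesis
        proof (intro exI[of _ "min (\<delta> / 2) (min (\<epsilon> / 2) (d / 2))"] conjI ballI impI)
          fix s :: real assume s: "s \<in> {0..1}" "\<bar>s - t\<bar> < min (\<delta> / 2) (min (\<epsilon> / 2) (d / 2))"
          show "\<forall>\<^sub>F w in nhds (?g s). H s w = H t w"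
          proof (cases "s \<le> 1/2")
            case le: True
            then show ?thesis using s by (intro left) linarith+
          next
            case False
            then have s2: "s > 1/2" by simp
            have s3: "2 * s - 1 \<in> {0..1}" "\<bar>2 * s - 1 - 0\<bar> < \<epsilon>" "\<bar>2 * s - 1\<bar> < d"
              using s s2 True by auto
            have 1: "\<forall>\<^sub>F w in nhds (\<gamma>2 (2 * s - 1)). G (2 * s - 1) w = G 0 w"
              using \<epsilon>(2) s3 by blast
            have "\<gamma>2 (2 * s - 1) \<in> V" using d(2)[of "2 * s - 1"] s3 e(2) by (auto simp: dist_commute)
            then have 2: "\<forall>\<^sub>F w in nhds (\<gamma>2 (2 * s - 1)). G 0 w = F 1 w"
              unfolding eventually_nhds using V(1,3) by blast
            from 1 2 have "\<forall>\<^sub>F w in nhds (\<gamma>2 (2 * s - 1)). G (2 * s - 1) w = F 1 w"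
              by eventually_elim simp
            moreover have "H s = G (2 * s - 1)" using s2 by (simp add: H_def)
            moreover have "2 * t = 1" "t \<le> 1/2" using \<open>t = 1/2\<close> by simp_all
            then have "H t = F 1" unfolding H_def by (metis)
            ultimately show ?thesis unfolding gr[OF s2] by simp
          qed
        qed (use \<delta>(1) \<epsilon>(1) d(1) in simp)
      qed
    qed
  next
    show "\<forall>\<^sub>F w in nhds (?g 0). H 0 w = Y w" using F(3) by (simp add: H_def joinpaths_def)
    show "\<forall>\<^sub>F w in nhds (?g 1). H 1 w = W w" using G(4) by (simp add: H_def joinpaths_def)
  qed
qed

lemma group_GL: "group (GL :: (complex^'n^'n) monoid)"
proof (rule groupI)
  fix x :: "complex^'n^'n" assume "x \<in> carrier GL"
  then obtain y where y: "x ** y = mat 1" "y ** x = mat 1" unfolding GL_def invertible_def by auto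
  then have "invertible y" unfolding invertible_def by blast
  then show "\<exists>y\<in>carrier GL. y \<otimes>\<^bsub>GL\<^esub> x = \<one>\<^bsub>GL\<^esub>" using y by (intro bexI[of _ y]) (simp_all add: GL_def)
qed (auto simp: GL_def matrix_mul_assoc invertible_mult invertible_def[of "mat 1"] intro: exI[of _ "mat 1"])

lemma mat_analytic_continuation:
  fixes F G :: "complex \<Rightarrow> complex^'n^'m"
  assumes "open W" "W \<noteq> {}" "W \<subseteq> S" "open S" "connected S"
    and "\<And>i j. (\<lambda>w. F w $ i $ j) holomorphic_on S" "\<And>i j. (\<lambda>w. G w $ i $ j) holomorphic_on S"
    and "\<And>z. z \<in> W \<Longrightarrow> F z = G z" and "z \<in> S"
  shows "F z = G z"
proof -
  have "F z $ i $ j = G z $ i $ j" for i j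
    by (rule analytic_continuation_open[of W S "\<lambda>z. F z $ i $ j" "\<lambda>z. G z $ i $ j"]) (use assms in auto)
  then show ?thesis by (simp add: vec_eq_iff)
qed

section \<open>The monodromy group\<close>

context distinguished
begin

abbreviation "\<Psi> \<equiv> Psi_matrix Psi"
abbreviation "Mon k \<equiv> monodromy_matrix A1 C k"

section \<open>The monodromy matrices and the group they generate\<close>

lemma column_mult: "column j (A ** B) = A *v column j B"
  by (simp add: vec_eq_iff column_def matrix_matrix_mult_def matrix_vector_mult_def)

lemma eq_columnsI: "(\<And>j. column j A = column j B) \<Longrightarrow> A = B"
  by (simp add: vec_eq_iff column_def)

text \<open>The monodromy matrix is the identity plus \<open>alpha A1 k\<close> times row
  \<open>k\<close> of \<open>C\<close>, placed in row \<open>k\<close>; the diagonal entry fits by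
  \<open>alpha_C_diagonal\<close>.\<close>

lemma Mon_mult: "Mon k *v v = v + (alpha A1 k * (C *v v) $ k) *s axis k 1"
proof -
  have "(Mon k *v v) $ i = (v + (alpha A1 k * (C *v v) $ k) *s axis k 1) $ i" for i
  proof (cases "i = k")
    case False
    then have "(Mon k *v v) $ i = (\<Sum>j\<in>UNIV. if j = i then v $ j else 0)"
      unfolding matrix_vector_mult_def monodromy_matrix_def vec_lambda_beta by (intro sum.cong) auto
    then show ?thesis using False by (simp add: axis_def)
  next
    case True
    have "(Mon k *v v) $ k = (\<Sum>j\<in>UNIV. (if j = k then v $ j else 0) + alpha A1 k * (C $ k $ j * v $ j))"
      unfolding matrix_vector_mult_def monodromy_matrix_def vec_lambda_beta alpha_C_diagonal[of k, symmetric]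
      by (intro sum.cong) (auto simp: algebra_simps)
    also have "\<dots> = v $ k + alpha A1 k * (C *v v) $ k"
      by (simp add: sum.distrib matrix_vector_mult_def sum_distrib_left)
    finally show ?thesis using True by (simp add: axis_def)
  qed
  then show ?thesis by (simp add: vec_eq_iff)
qed

text \<open>A kernel vector is supported at \<open>k\<close>, where the matrix acts by the
  exponential on its diagonal, which is not zero.\<close>

lemma invertible_Mon: "invertible (Mon k)"
  unfolding invertible_left_inverse matrix_left_invertible_ker
proof (intro allI impI)
  fix v assume v: "Mon k *v v = 0"
  have c: "v $ i + (alpha A1 k * (C *v v) $ k) * (axis k 1 :: complex^'n) $ i = 0" for i
    using v unfolding Mon_mult by (simp add: vec_eq_iff)
  have off: "v $ i = 0" if "i \<noteq> k" for i using c[of i] that by (simp add: axis_def)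
  have "(C *v v) $ k = (\<Sum>j\<in>UNIV. if j = k then C $ k $ k * v $ k else 0)"
    unfolding matrix_vector_mult_def vec_lambda_beta by (intro sum.cong) (auto simp: off)
  then have "(1 + alpha A1 k * C $ k $ k) * v $ k = 0" using c[of k] by (simp add: axis_def algebra_simps)
  then have "v $ k = 0" unfolding alpha_C_diagonal by simp
  with off have "v $ i = 0" for i by (cases "i = k") auto
  then show "v = 0" by (simp add: vec_eq_iff)
qed

abbreviation "Gr \<equiv> generate GL (range (\<lambda>k. Mon k))"

lemma range_Mon_subset: "range (\<lambda>k. Mon k) \<subseteq> carrier GL"
  using invertible_Mon by (auto simp: GL_def)

lemma Gr_mult: "N \<in> Gr \<Longrightarrow> N' \<in> Gr \<Longrightarrow> N ** N' \<in> Gr"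
  using generate.eng[of N GL _ N'] by (simp add: GL_def)

lemma Gr_one: "mat 1 \<in> Gr"
  using generate.one[of GL] by (simp add: GL_def)

lemma Mon_inverse:
  obtains N where "N \<in> Gr" "N = inv\<^bsub>GL\<^esub> (Mon k)" "Mon k ** N = mat 1" "N ** Mon k = mat 1"
proof (rule that[of "inv\<^bsub>GL\<^esub> (Mon k)"])
  have m: "Mon k \<in> carrier GL" using range_Mon_subset by blast
  show "inv\<^bsub>GL\<^esub> (Mon k) \<in> Gr" by (rule generate.inv) simp
  show "Mon k ** inv\<^bsub>GL\<^esub> (Mon k) = mat 1" using group.r_inv[OF group_GL m] by (simp add: GL_def)
  show "inv\<^bsub>GL\<^esub> (Mon k) ** Mon k = mat 1" using group.l_inv[OF group_GL m] by (simp add: GL_def)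
qed simp

lemma Psi_entries_holomorphic: "S \<subseteq> P \<Longrightarrow> (\<lambda>w. (\<Psi> w ** N) $ i $ j) holomorphic_on S"
proof -
  assume S: "S \<subseteq> P"
  have "(\<lambda>w. (\<Psi> w ** N) $ i $ j) = (\<lambda>w. (\<Psi> w *v column j N) $ i)"
    by (simp add: matrix_matrix_mult_def matrix_vector_mult_def column_def)
  then show ?thesis using vec_holomorphic_P[OF solution_Psi_mult[of "column j N"] S]
    unfolding vec_holomorphic_on_def by simp
qed

text \<open>Column by column the added multiple of \<open>Psi k\<close> is \<open>\<Psi>\<close>
  applied to a multiple of the \<open>k\<close>-th unit vector; so the new factor stands between
  \<open>\<Psi>\<close> and \<open>N\<close>.\<close>

lemma crosses_matrix:
  assumes U: "open U" "convex U" "lam k \<notin> U"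
    "\<And>i. i \<noteq> k \<Longrightarrow> U \<inter> cut_ray (lam i) \<eta> = {}" "U \<inter> cut_ray (lam k) \<eta> \<noteq> {}"
    and F: "\<And>i j. (\<lambda>w. F w $ i $ j) holomorphic_on U"
    "\<And>z. z \<in> U \<Longrightarrow> yc \<eta> z < yc \<eta> (lam k) \<Longrightarrow> F z = \<Psi> z ** N"
    and z: "z \<in> U" "yc \<eta> (lam k) < yc \<eta> z"
  shows "F z = \<Psi> z ** (Mon k ** N)"
proof (rule eq_columnsI)
  fix j
  have "column j (F z) = \<Psi> z *v column j N + (alpha A1 k * (C *v column j N) $ k) *s Psi k z"
  proof (rule crossesD[OF crosses_Psi_mult U _ _ z])
    show "(\<lambda>z. column j (F z)) vec_holomorphic_on U"
      unfolding vec_holomorphic_on_def using F(1) by (simp add: column_def)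
    show "column j (F w) = \<Psi> w *v column j N" if "w \<in> U" "yc \<eta> w < yc \<eta> (lam k)" for w
      using F(2)[OF that] by (simp add: column_mult)
  qed
  also have "Psi k z = \<Psi> z *v axis k 1"
  proof -
    have "(\<Sum>i\<in>UNIV. (axis k 1 :: complex^'n) $ i *s Psi i z) = (\<Sum>i\<in>UNIV. if i = k then Psi i z else 0)"
      by (intro sum.cong) (auto simp: axis_def)
    then show ?thesis unfolding Psi_matrix_mult by simp
  qed
  also have "\<Psi> z *v column j N + (alpha A1 k * (C *v column j N) $ k) *s (\<Psi> z *v axis k 1) = \<Psi> z *v (Mon k *v column j N)"
    unfolding Mon_mult matrix_vector_right_distrib vector_scalar_commute ..
  finally show "column j (F z) = column j (\<Psi> z ** (Mon k ** N))" by (simp add: column_mult)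
qed

text \<open>Cuts occupy finitely many levels, so a small shift across the cut direction avoids them
  all.\<close>

lemma open_meets_P:
  assumes "open V" "q \<in> V"
  shows "\<exists>w\<in>V. w \<in> P"
proof -
  obtain e where e: "e > 0" "ball q e \<subseteq> V" using assms open_contains_ball by blast
  have "infinite {0<..<e}" using e(1) by simp
  then have "{0<..<e} - range (\<lambda>k. yc \<eta> (lam k) - yc \<eta> q) \<noteq> {}"
    by (metis finite_Diff2 finite.emptyI finite_imageI finite_class.finite_UNIV)
  then obtain t where "t \<in> {0<..<e}" "t \<notin> range (\<lambda>k. yc \<eta> (lam k) - yc \<eta> q)" by blast
  then have t: "0 < t" "t < e" "\<And>k. t \<noteq> yc \<eta> (lam k) - yc \<eta> q" by auto
  let ?w = "q + of_real t * (\<i> * cis \<eta>)"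
  have "yc \<eta> ?w = yc \<eta> q + t" using yc_polar[of \<eta> 0 t] by (simp add: yc_add)
  then have "?w \<in> P" using t(3) by (auto simp: mem_cut_plane_iff algebra_simps)
  moreover have "?w \<in> V" using t by (intro subsetD[OF e(2)]) (simp add: dist_norm norm_mult)
  ultimately show ?thesis by blast
qed

text \<open>Convex sets in which continuation can involve a single cut. \<open>U\<close> may or may
  not meet that cut, so that one notion covers all points of a path.\<close>

definition adapted :: "'n \<Rightarrow> complex set \<Rightarrow> bool" where
  "adapted k U \<longleftrightarrow> open U \<and> convex U \<and> U \<inter> range lam = {} \<and> (\<forall>i. i \<noteq> k \<longrightarrow> U \<inter> cut_ray (lam i) \<eta> = {})"

lemma adapted_ball:
  assumes "p \<notin> range lam"
  obtains r k where "r > 0" "adapted k (ball p r)" "\<And>i. yc \<eta> p = yc \<eta> (lam i) \<Longrightarrow> i = k"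
proof -
  have "\<exists>k. \<forall>i. yc \<eta> p = yc \<eta> (lam i) \<longrightarrow> i = k" using yc_lam_neq by metis
  then obtain k where k: "\<And>i. yc \<eta> p = yc \<eta> (lam i) \<Longrightarrow> i = k" by blast
  define d where "d i = (if i = k then dist p (lam k) else \<bar>yc \<eta> p - yc \<eta> (lam i)\<bar>)" for i
  define r where "r = Min (range d)"
  have "d i > 0" for i using k[of i] assms by (auto simp: d_def)
  then have r: "r > 0" "\<And>i. r \<le> d i" by (auto simp: r_def)
  have y: "yc \<eta> z \<noteq> yc \<eta> (lam i)" if "z \<in> ball p r" "i \<noteq> k" for z i
    using abs_yc_less[OF that(1)] r(2)[of i] that(2) by (auto simp: d_def)
  have "lam i \<notin> ball p r" for i
  proof (cases "i = k")
    case True then show ?thesis using r(2)[of k] by (simp add: d_def)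
  next
    case False then show ?thesis using y[of "lam i" i] by blast
  qed
  moreover have "ball p r \<inter> cut_ray (lam i) \<eta> = {}" if "i \<noteq> k" for i
    using y that by (auto simp: mem_cut_ray_iff)
  ultimately have "adapted k (ball p r)" unfolding adapted_def by auto
  with that r(1) k show ?thesis by blast
qed

text \<open>A point of the cut plane on the line of the \<open>k\<close>-th cut lies to the left of
  \<open>lam k\<close>. The segment from it to a point of the cut would pass through
  \<open>lam k\<close>, although \<open>U\<close> is convex and avoids \<open>lam k\<close>.\<close>

lemma adapted_sides:
  assumes U: "adapted k U" "U \<inter> cut_ray (lam k) \<eta> \<noteq> {}" and z: "z \<in> U" "z \<in> P"
  shows "yc \<eta> z < yc \<eta> (lam k) \<or> yc \<eta> (lam k) < yc \<eta> z"
proof (rule ccontr)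
  assume "\<not> ?thesis"
  then have y: "yc \<eta> z = yc \<eta> (lam k)" by simp
  then have x: "xc \<eta> z < xc \<eta> (lam k)" using z(2) by (simp add: mem_cut_plane_iff)
  obtain q where q: "q \<in> U" "yc \<eta> q = yc \<eta> (lam k)" "xc \<eta> (lam k) \<le> xc \<eta> q"
    using U(2) mem_cut_ray_iff by blast
  define t where "t = (xc \<eta> (lam k) - xc \<eta> z) / (xc \<eta> q - xc \<eta> z)"
  have t: "0 \<le> t" "t \<le> 1" "t * (xc \<eta> q - xc \<eta> z) = xc \<eta> (lam k) - xc \<eta> z"
    using x q(3) by (auto simp: t_def)
  have m: "xc \<eta> (t *\<^sub>R w) = t * xc \<eta> w" "yc \<eta> (t *\<^sub>R w) = t * yc \<eta> w" for t w
    by (simp_all add: xc_def yc_def)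
  have "lam k = (1 - t) *\<^sub>R z + t *\<^sub>R q"
    by (rule xc_yc_eqI[of \<eta>]; unfold xc_add yc_add m; use t(3) y q(2) in \<open>simp add: algebra_simps\<close>)
  then have "lam k \<in> closed_segment z q" unfolding in_segment using t by blast
  then have "lam k \<in> U" using U(1) z(1) q(1) unfolding adapted_def by (meson closed_segment_subset subsetD)
  then show False using U(1) unfolding adapted_def by blast
qed

lemma adapted_halves:
  assumes "adapted k U"
  shows "U \<inter> {z. yc \<eta> z < yc \<eta> (lam k)} \<subseteq> P" "U \<inter> {z. yc \<eta> (lam k) < yc \<eta> z} \<subseteq> P"
proof -
  have "z \<in> P" if "z \<in> U" "yc \<eta> z \<noteq> yc \<eta> (lam k)" for z
  proof -
    have "z \<notin> cut_ray (lam i) \<eta>" for i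
    proof (cases "i = k")
      case True then show ?thesis using that by (simp add: mem_cut_ray_iff)
    next
      case False then show ?thesis using assms that unfolding adapted_def by blast
    qed
    then show ?thesis unfolding cut_plane_def by blast
  qed
  then show "U \<inter> {z. yc \<eta> z < yc \<eta> (lam k)} \<subseteq> P" "U \<inter> {z. yc \<eta> (lam k) < yc \<eta> z} \<subseteq> P" by auto
qed

text \<open>The columns of \<open>H\<close> are solutions on all of \<open>U\<close> with the values
  of \<open>\<Psi> ** N\<close> at one point below the cut; \<open>crosses_matrix\<close> then
  describes them above it.\<close>

lemma adapted_continuation:
  fixes N :: "complex^'n^'n"
  assumes U: "adapted k U" "U \<inter> cut_ray (lam k) \<eta> \<noteq> {}"
  obtains H where "\<And>i j. (\<lambda>w. H w $ i $ j) holomorphic_on U"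
    "\<And>z. z \<in> U \<Longrightarrow> yc \<eta> z < yc \<eta> (lam k) \<Longrightarrow> H z = \<Psi> z ** N"
    "\<And>z. z \<in> U \<Longrightarrow> yc \<eta> (lam k) < yc \<eta> z \<Longrightarrow> H z = \<Psi> z ** (Mon k ** N)"
proof -
  have U': "open U" "convex U" "U \<inter> range lam = {}" using U(1) by (auto simp: adapted_def)
  let ?lo = "{z. yc \<eta> z < yc \<eta> (lam k)}"
  have sub: "U \<inter> ?lo \<subseteq> P" by (rule adapted_halves[OF U(1)])
  obtain q where q: "q \<in> U" "yc \<eta> q = yc \<eta> (lam k)" using U(2) mem_cut_ray_iff by blast
  obtain c where c: "c \<in> U" "yc \<eta> c < yc \<eta> (lam k)" using open_meets_both_sides(1)[OF U'(1) q(1)] q(2) by auto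
  have "\<exists>h. is_solution lam A1 U h \<and> h c = column j (\<Psi> c ** N)" for j
    using is_solution_exists_on_convex[OF U' c(1)] by metis
  then obtain h where h: "\<And>j. is_solution lam A1 U (h j)" "\<And>j. h j c = column j (\<Psi> c ** N)" by metis
  define H :: "complex \<Rightarrow> complex^'n^'n" where "H z = (\<chi> i j. h j z $ i)" for z
  have colH: "column j (H z) = h j z" for j z by (simp add: H_def column_def vec_eq_iff)
  have hol: "(\<lambda>w. H w $ i $ j) holomorphic_on U" for i j
    using is_solution_imp_vec_holomorphic[OF h(1)[of j] U'(1)] unfolding vec_holomorphic_on_def H_def by simp
  have lo: "H z = \<Psi> z ** N" if z: "z \<in> U" "yc \<eta> z < yc \<eta> (lam k)" for z
  proof (rule eq_columnsI)
    fix j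
    have "h j z = \<Psi> z *v column j N"
    proof (rule is_solution_unique_Int[OF h(1) is_solution_subset[OF solution_Psi_mult sub] U', of c])
      show "open (U \<inter> ?lo)" "convex (U \<inter> ?lo)" by (intro open_Int convex_Int U' open_convex_halfplanes)+
      show "h j c = \<Psi> c *v column j N" unfolding h(2) column_mult ..
    qed (use c z in auto)
    then show "column j (H z) = column j (\<Psi> z ** N)" by (simp add: colH column_mult)
  qed
  have hi: "H z = \<Psi> z ** (Mon k ** N)" if "z \<in> U" "yc \<eta> (lam k) < yc \<eta> z" for z
    by (rule crosses_matrix[of U k H N z]) (use U U' hol lo that in \<open>auto simp: adapted_def\<close>)
  show ?thesis by (rule that[OF hol lo hi])
qed

text \<open>Within an adapted set the germs of \<open>F\<close> on the two sides of the cut differ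
  by a factor \<open>Mon k\<close>, so membership of the matrix in the generated group is
  preserved.\<close>

lemma adapted_germs:
  assumes U: "adapted k U" and F: "\<And>i j. (\<lambda>w. F w $ i $ j) holomorphic_on U"
    and w1: "w1 \<in> U" "w1 \<in> P" "N \<in> Gr" "\<forall>\<^sub>F z in nhds w1. F z = \<Psi> z ** N"
    and w2: "w2 \<in> U" "w2 \<in> P"
  shows "\<exists>N'\<in>Gr. \<forall>\<^sub>F z in nhds w2. F z = \<Psi> z ** N'"
proof -
  have U': "open U" "convex U" "U \<inter> range lam = {}" using U by (auto simp: adapted_def)
  obtain V where V: "open V" "w1 \<in> V" "\<And>z. z \<in> V \<Longrightarrow> F z = \<Psi> z ** N"
    using w1(4) unfolding eventually_nhds by blast
  have spread: "F z = \<Psi> z ** N" if S: "open S" "convex S" "S \<subseteq> U" "S \<subseteq> P" "w1 \<in> S" and z: "z \<in> S" for S z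
    by (rule mat_analytic_continuation[of "S \<inter> V" S])
      (use S z V holomorphic_on_subset[OF F S(3)] Psi_entries_holomorphic[OF S(4)] w1 in \<open>auto intro: convex_connected\<close>)
  have germ: "\<forall>\<^sub>F z in nhds w2. F z = \<Psi> z ** N'"
    if "open S" "w2 \<in> S" "\<And>z. z \<in> S \<Longrightarrow> F z = \<Psi> z ** N'" for S N'
    unfolding eventually_nhds using that by blast
  show ?thesis
  proof (cases "U \<inter> cut_ray (lam k) \<eta> = {}")
    case True
    then have "U \<inter> cut_ray (lam i) \<eta> = {}" for i using U by (cases "i = k") (auto simp: adapted_def)
    then have "U \<subseteq> P" unfolding cut_plane_def by blast
    then show ?thesis using germ[OF U'(1) w2(1)] spread[OF U'(1,2) _ _ w1(1)] w1(3) by blast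
  next
    case False
    let ?lo = "U \<inter> {z. yc \<eta> z < yc \<eta> (lam k)}" and ?hi = "U \<inter> {z. yc \<eta> (lam k) < yc \<eta> z}"
    have oc: "open ?lo" "convex ?lo" "open ?hi" "convex ?hi"
      by (intro open_Int convex_Int U' open_convex_halfplanes)+
    have key: "\<exists>N0\<in>Gr. (\<forall>z\<in>?lo. F z = \<Psi> z ** N0) \<and> (\<forall>z\<in>?hi. F z = \<Psi> z ** (Mon k ** N0))"
      using adapted_sides[OF U False w1(1,2)]
    proof
      assume "yc \<eta> w1 < yc \<eta> (lam k)"
      then have lo: "F z = \<Psi> z ** N" if "z \<in> ?lo" for z
        using spread[OF oc(1,2) _ adapted_halves(1)[OF U] _ that] w1(1) by blast
      have "F z = \<Psi> z ** (Mon k ** N)" if "z \<in> ?hi" for z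
        by (rule crosses_matrix[of U k F N z]) (use U U' False F lo that in \<open>auto simp: adapted_def\<close>)
      with lo w1(3) show ?thesis by blast
    next
      assume hiw: "yc \<eta> (lam k) < yc \<eta> w1"
      then have hi: "F z = \<Psi> z ** N" if "z \<in> ?hi" for z
        using spread[OF oc(3,4) _ adapted_halves(2)[OF U] _ that] w1(1) by blast
      obtain M' where M': "M' \<in> Gr" "M' = inv\<^bsub>GL\<^esub> (Mon k)" "Mon k ** M' = mat 1" "M' ** Mon k = mat 1" by (rule Mon_inverse)
      have MN: "Mon k ** (M' ** N) = N" by (simp add: matrix_mul_assoc M'(3))
      \<comment> \<open>Crossing clockwise is reduced to crossing anticlockwise: starting below the
        cut with the inverse factor gives \<open>\<Psi> ** N\<close> above it, and the identity
        theorem shows that this continuation is \<open>F\<close>.\<close>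
      obtain H where H: "\<And>i j. (\<lambda>w. H w $ i $ j) holomorphic_on U"
        "\<And>z. z \<in> U \<Longrightarrow> yc \<eta> z < yc \<eta> (lam k) \<Longrightarrow> H z = \<Psi> z ** (M' ** N)"
        "\<And>z. z \<in> U \<Longrightarrow> yc \<eta> (lam k) < yc \<eta> z \<Longrightarrow> H z = \<Psi> z ** (Mon k ** (M' ** N))"
        using that by (rule adapted_continuation[OF U False, of "M' ** N"])
      have "F z = H z" if "z \<in> U" for z
        by (rule mat_analytic_continuation[of ?hi U])
          (use oc U' w1 hiw F H hi that in \<open>auto simp: MN intro: convex_connected\<close>)
      then have "F z = \<Psi> z ** (M' ** N)" if "z \<in> ?lo" for z using H(2) that by simp
      moreover have "M' ** N \<in> Gr" by (rule Gr_mult[OF M'(1) w1(3)])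
      ultimately show ?thesis using hi MN by metis
    qed
    then obtain N0 where N0: "N0 \<in> Gr" "\<forall>z\<in>?lo. F z = \<Psi> z ** N0" "\<forall>z\<in>?hi. F z = \<Psi> z ** (Mon k ** N0)" by blast
    have "Mon k \<in> Gr" by (rule generate.incl) simp
    then have "Mon k ** N0 \<in> Gr" using N0(1) by (rule Gr_mult)
    then show ?thesis
      using adapted_sides[OF U False w2] N0 germ[OF oc(1)] germ[OF oc(3)] w2(1) by blast
  qed
qed

end

section \<open>Loops and the two inclusions between the groups\<close>

context distinguished
begin

lemma path_in_P_avoids: "path_image \<gamma> \<subseteq> P \<Longrightarrow> path_image \<gamma> \<subseteq> - range lam"
  using cut_plane_disjoint by blast

lemma path_in_P:
  assumes "z \<in> P" "w \<in> P"
  obtains \<gamma> where "path \<gamma>" "pathstart \<gamma> = z" "pathfinish \<gamma> = w" "path_image \<gamma> \<subseteq> P"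
proof -
  have "path_connected P" by (simp add: connected_open_path_connected open_cut_plane connected_cut_plane)
  then show ?thesis using that assms unfolding path_connected_def by blast
qed

lemma continues_in_P: "path_image \<gamma> \<subseteq> P \<Longrightarrow> continues_along \<gamma> (\<lambda>z. \<Psi> z ** N) (\<lambda>z. \<Psi> z ** N)"
  by (rule continues_along_constant[OF open_cut_plane _ Psi_entries_holomorphic]) auto

lemma mem_monodromy_group_iff:
  "M \<in> monodromy_group lam z0 \<Psi> \<longleftrightarrow> (\<exists>\<gamma>. path \<gamma> \<and> pathstart \<gamma> = z0 \<and> pathfinish \<gamma> = z0 \<and>
     path_image \<gamma> \<subseteq> - range lam \<and> continues_along \<gamma> (\<lambda>z. \<Psi> z ** mat 1) (\<lambda>z. \<Psi> z ** M))"
  unfolding monodromy_group_def by simp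

text \<open>Later continuation inserts its matrix directly after \<open>\<Psi>\<close>, so the loop
  for \<open>N\<close> is run before the loop for \<open>M\<close>.\<close>

lemma monodromy_group_mult:
  assumes "M \<in> monodromy_group lam z0 \<Psi>" "N \<in> monodromy_group lam z0 \<Psi>"
  shows "M ** N \<in> monodromy_group lam z0 \<Psi>"
proof -
  obtain \<gamma> where g: "path \<gamma>" "pathstart \<gamma> = z0" "pathfinish \<gamma> = z0" "path_image \<gamma> \<subseteq> - range lam"
    "continues_along \<gamma> (\<lambda>z. \<Psi> z ** mat 1) (\<lambda>z. \<Psi> z ** M)"
    using assms(1) unfolding mem_monodromy_group_iff by (elim exE conjE)
  obtain \<delta> where d: "path \<delta>" "pathstart \<delta> = z0" "pathfinish \<delta> = z0" "path_image \<delta> \<subseteq> - range lam"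
    "continues_along \<delta> (\<lambda>z. \<Psi> z ** mat 1) (\<lambda>z. \<Psi> z ** N)"
    using assms(2) unfolding mem_monodromy_group_iff by (elim exE conjE)
  have "continues_along \<gamma> (\<lambda>z. \<Psi> z ** N) (\<lambda>z. \<Psi> z ** (M ** N))"
    using continues_along_mult_right[OF g(5), of N] by (simp add: matrix_mul_assoc)
  from continues_along_join[OF d(5) this g(1)]
  have "continues_along (\<delta> +++ \<gamma>) (\<lambda>z. \<Psi> z ** mat 1) (\<lambda>z. \<Psi> z ** (M ** N))" using g d by simp
  then show ?thesis unfolding mem_monodromy_group_iff
    using g d by (intro exI[of _ "\<delta> +++ \<gamma>"]) (auto simp: path_image_join)
qed

lemma monodromy_group_inverse:
  assumes "M \<in> monodromy_group lam z0 \<Psi>" "M ** N = mat 1"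
  shows "N \<in> monodromy_group lam z0 \<Psi>"
proof -
  obtain \<gamma> where g: "path \<gamma>" "pathstart \<gamma> = z0" "pathfinish \<gamma> = z0" "path_image \<gamma> \<subseteq> - range lam"
    "continues_along \<gamma> (\<lambda>z. \<Psi> z ** mat 1) (\<lambda>z. \<Psi> z ** M)"
    using assms(1) unfolding mem_monodromy_group_iff by (elim exE conjE)
  have "continues_along (reversepath \<gamma>) (\<lambda>z. (\<Psi> z ** M) ** N) (\<lambda>z. (\<Psi> z ** mat 1) ** N)"
    by (rule continues_along_mult_right[OF continues_along_reverse[OF g(5)]])
  then have "continues_along (reversepath \<gamma>) (\<lambda>z. \<Psi> z ** mat 1) (\<lambda>z. \<Psi> z ** N)"
    by (simp add: matrix_mul_assoc[symmetric] assms(2))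
  then show ?thesis unfolding mem_monodromy_group_iff
    using g by (intro exI[of _ "reversepath \<gamma>"]) auto
qed

text \<open>The loop runs inside the cut plane to the lower side of \<open>L\<^sub>k\<close>, crosses \<open>L\<^sub>k\<close> along a short segment,
  and returns inside the cut plane.\<close>

lemma Mon_in_monodromy_group:
  assumes z0: "z0 \<in> P"
  shows "Mon k \<in> monodromy_group lam z0 \<Psi>"
proof -
  define q where "q = offset k 1 0"
  have q: "xc \<eta> q = xc \<eta> (lam k) + 1" "yc \<eta> q = yc \<eta> (lam k)" by (simp_all add: q_def xc_offset yc_offset)
  have "q \<noteq> lam i" for i
    using q yc_lam_neq[of i k] by (cases "i = k") auto
  then have "q \<notin> range lam" by blast
  then obtain r k' where r: "r > 0" "adapted k' (ball q r)" "\<And>i. yc \<eta> q = yc \<eta> (lam i) \<Longrightarrow> i = k'"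
    using adapted_ball by blast
  have "k' = k" using r(3)[of k] q(2) by simp
  let ?U = "ball q r"
  have U: "adapted k ?U" using r(2) \<open>k' = k\<close> by simp
  have qU: "q \<in> ?U" using r(1) by simp
  have "q \<in> cut_ray (lam k) \<eta>" using q by (simp add: mem_cut_ray_iff)
  then have ray: "?U \<inter> cut_ray (lam k) \<eta> \<noteq> {}" using qU by blast
  obtain c where c: "c \<in> ?U" "yc \<eta> c < yc \<eta> (lam k)" using open_meets_both_sides(1)[OF open_ball qU] q(2) by auto
  obtain d where d: "d \<in> ?U" "yc \<eta> (lam k) < yc \<eta> d" using open_meets_both_sides(2)[OF open_ball qU] q(2) by auto
  have cP: "c \<in> P" and dP: "d \<in> P" using adapted_halves[OF U] c d by auto
  obtain H where H: "\<And>i j. (\<lambda>w. H w $ i $ j) holomorphic_on ?U"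
    "\<And>z. z \<in> ?U \<Longrightarrow> yc \<eta> z < yc \<eta> (lam k) \<Longrightarrow> H z = \<Psi> z ** mat 1"
    "\<And>z. z \<in> ?U \<Longrightarrow> yc \<eta> (lam k) < yc \<eta> z \<Longrightarrow> H z = \<Psi> z ** (Mon k ** mat 1)"
    using that by (rule adapted_continuation[OF U ray, of "mat 1"])
  have seg: "path_image (linepath c d) \<subseteq> ?U"
    unfolding path_image_linepath by (rule closed_segment_subset[OF c(1) d(1) convex_ball])
  have "continues_along (linepath c d) H H" by (rule continues_along_constant[OF open_ball seg H(1)])
  then have L: "continues_along (linepath c d) (\<lambda>z. \<Psi> z ** mat 1) (\<lambda>z. \<Psi> z ** Mon k)"
  proof (rule continues_along_cong)
    have "open (?U \<inter> {z. yc \<eta> z < yc \<eta> (lam k)})" "open (?U \<inter> {z. yc \<eta> (lam k) < yc \<eta> z})"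
      by (intro open_Int open_ball open_convex_halfplanes)+
    then show "\<forall>\<^sub>F w in nhds (linepath c d 0). H w = \<Psi> w ** mat 1" "\<forall>\<^sub>F w in nhds (linepath c d 1). H w = \<Psi> w ** Mon k"
      unfolding eventually_nhds using H(2,3) c d by (auto simp: linepath_def)
  qed
  obtain g where g: "path g" "pathstart g = z0" "pathfinish g = c" "path_image g \<subseteq> P" using path_in_P[OF z0 cP] .
  obtain h where h: "path h" "pathstart h = d" "pathfinish h = z0" "path_image h \<subseteq> P" using path_in_P[OF dP z0] .
  have "continues_along (linepath c d +++ h) (\<lambda>z. \<Psi> z ** mat 1) (\<lambda>z. \<Psi> z ** Mon k)"
    by (rule continues_along_join[OF L continues_in_P[OF h(4)] h(1)]) (simp add: h)
  then have "continues_along (g +++ (linepath c d +++ h)) (\<lambda>z. \<Psi> z ** mat 1) (\<lambda>z. \<Psi> z ** Mon k)"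
    by (rule continues_along_join[OF continues_in_P[OF g(4)]]) (use g h in auto)
  moreover have "path_image (linepath c d) \<subseteq> - range lam" using seg U unfolding adapted_def by blast
  ultimately show ?thesis unfolding mem_monodromy_group_iff
    using g h path_in_P_avoids[OF g(4)] path_in_P_avoids[OF h(4)]
    by (intro exI[of _ "g +++ (linepath c d +++ h)"]) (auto simp: path_image_join)
qed

lemma generate_subset_monodromy_group:
  assumes z0: "z0 \<in> P"
  shows "Gr \<subseteq> monodromy_group lam z0 \<Psi>"
proof
  fix M assume "M \<in> Gr"
  then show "M \<in> monodromy_group lam z0 \<Psi>"
  proof (induction rule: generate.induct)
    case one
    have "path_image (linepath z0 z0) \<subseteq> P" using z0 by simp
    then show ?case unfolding mem_monodromy_group_iff
      using continues_in_P[of "linepath z0 z0" "mat 1"] path_in_P_avoids[of "linepath z0 z0"]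
      by (intro exI[of _ "linepath z0 z0"]) (simp add: GL_def)
  next
    case (incl h)
    then show ?case using Mon_in_monodromy_group[OF z0] by blast
  next
    case (inv h)
    then obtain k where k: "h = Mon k" by blast
    obtain N where N: "N \<in> Gr" "N = inv\<^bsub>GL\<^esub> (Mon k)" "Mon k ** N = mat 1" "N ** Mon k = mat 1" by (rule Mon_inverse)
    show ?case using monodromy_group_inverse[OF Mon_in_monodromy_group[OF z0] N(3)] N(2) k by simp
  next
    case (eng h1 h2)
    then show ?case using monodromy_group_mult by (simp add: GL_def)
  qed
qed

text \<open>Connectedness of the unit interval propagates the statement that the current germ is
  \<open>\<Psi> ** N\<close> with \<open>N\<close> in the group. Invertibility of
  \<open>\<Psi>\<close> at the base point finally identifies \<open>N\<close> with the given
  matrix.\<close>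

lemma monodromy_group_subset_generate:
  assumes inv: "\<And>z. z \<in> P \<Longrightarrow> invertible (\<Psi> z)" and z0: "z0 \<in> P"
  shows "monodromy_group lam z0 \<Psi> \<subseteq> Gr"
proof
  fix M assume "M \<in> monodromy_group lam z0 \<Psi>"
  then obtain \<gamma> where g: "path \<gamma>" "pathstart \<gamma> = z0" "pathfinish \<gamma> = z0" "path_image \<gamma> \<subseteq> - range lam"
    "continues_along \<gamma> (\<lambda>z. \<Psi> z ** mat 1) (\<lambda>z. \<Psi> z ** M)"
    unfolding mem_monodromy_group_iff by (elim exE conjE)
  obtain F where F: "\<forall>t\<in>{0..1}. \<forall>i j. (\<lambda>w. F t w $ i $ j) analytic_on {\<gamma> t}"
      "\<forall>t\<in>{0..1}. \<exists>\<delta>>0. \<forall>s\<in>{0..1}. \<bar>s - t\<bar> < \<delta> \<longrightarrow> (\<forall>\<^sub>F w in nhds (\<gamma> s). F s w = F t w)"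
      "\<forall>\<^sub>F w in nhds (\<gamma> 0). F 0 w = \<Psi> w ** mat 1" "\<forall>\<^sub>F w in nhds (\<gamma> 1). F 1 w = \<Psi> w ** M"
    using g(5) unfolding continues_along_def by (elim exE conjE)
  have g01: "\<gamma> 0 = z0" "\<gamma> 1 = z0" using g(2,3) by (simp_all add: pathstart_def pathfinish_def)
  define good where "good t w \<longleftrightarrow> (\<exists>N\<in>Gr. \<forall>\<^sub>F z in nhds w. F t z = \<Psi> z ** N)" for t w
  \<comment> \<open>The path may touch or follow a cut, where \<open>\<Psi>\<close> has no usable
    germ; the statement therefore concerns all points of the cut plane near
    \<open>\<gamma> t\<close>.\<close>
  define Good where "Good t \<longleftrightarrow> (\<forall>\<^sub>F w in nhds (\<gamma> t). w \<in> P \<longrightarrow> good t w)" for t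
  have good_cong: "good t w" if a: "good s w" "\<forall>\<^sub>F z in nhds w. F s z = F t z" for s t w
  proof -
    obtain N where N: "N \<in> Gr" "\<forall>\<^sub>F z in nhds w. F s z = \<Psi> z ** N" using a(1) unfolding good_def by blast
    have "\<forall>\<^sub>F z in nhds w. F t z = \<Psi> z ** N" using N(2) a(2) by eventually_elim simp
    then show ?thesis unfolding good_def using N(1) by blast
  qed
  have "Good 1"
  proof (rule connected_induction_simple[of "{0..1::real}" 0 1 Good])
    have "\<forall>\<^sub>F w in nhds (\<gamma> 0). \<forall>\<^sub>F z in nhds w. F 0 z = \<Psi> z ** mat 1"
      using F(3) by (simp add: eventually_eventually)
    then show "Good 0"
      unfolding Good_def
    proof eventually_elim
      case (elim w)
      then show ?case unfolding good_def using Gr_one by blast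
    qed
  next
    fix t :: real assume t: "t \<in> {0..1}"
    have "\<gamma> t \<notin> range lam" using g(4) t unfolding path_image_def by blast
    then obtain r k where r: "r > 0" "adapted k (ball (\<gamma> t) r)" using adapted_ball by blast
    have "\<exists>e>0. (\<lambda>w. F t w $ i $ j) holomorphic_on ball (\<gamma> t) e" for i j
      using F(1) t by (simp add: analytic_on_def)
    then obtain e where e: "\<And>i j. e i j > 0" "\<And>i j. (\<lambda>w. F t w $ i $ j) holomorphic_on ball (\<gamma> t) (e i j)" by metis
    define \<rho> where "\<rho> = Min (insert r (range (\<lambda>(i, j). e i j)))"
    have \<rho>: "\<rho> > 0" "\<rho> \<le> r" using r(1) e(1) by (auto simp: \<rho>_def)
    have \<rho>e: "\<rho> \<le> e i j" for i j
      unfolding \<rho>_def by (rule Min_le) (auto intro!: image_eqI[of _ _ "(i, j)"])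
    let ?U = "ball (\<gamma> t) \<rho>"
    have sub: "?U \<subseteq> ball (\<gamma> t) r" using \<rho>(2) by auto
    have U: "adapted k ?U"
      unfolding adapted_def
    proof (intro conjI allI impI open_ball convex_ball)
      show "?U \<inter> range lam = {}" using sub r(2) unfolding adapted_def by blast
      show "?U \<inter> cut_ray (lam i) \<eta> = {}" if "i \<noteq> k" for i
      proof -
        have "ball (\<gamma> t) r \<inter> cut_ray (lam i) \<eta> = {}" using r(2) that unfolding adapted_def by blast
        then show ?thesis using sub by blast
      qed
    qed
    have FU: "(\<lambda>w. F t w $ i $ j) holomorphic_on ?U" for i j
      by (rule holomorphic_on_subset[OF e(2)]) (use \<rho>e[of i j] in auto)
    obtain \<delta> where \<delta>: "\<delta> > 0" "\<And>s. s \<in> {0..1} \<Longrightarrow> \<bar>s - t\<bar> < \<delta> \<Longrightarrow> (\<forall>\<^sub>F w in nhds (\<gamma> s). F s w = F t w)"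
      using F(2) t by blast
    have "continuous_on {0..1} \<gamma>" using g(1) by (simp add: path_def)
    then obtain \<delta>' where \<delta>': "\<delta>' > 0" "\<And>s. s \<in> {0..1} \<Longrightarrow> dist s t < \<delta>' \<Longrightarrow> dist (\<gamma> s) (\<gamma> t) < \<rho>"
      using t \<rho>(1) unfolding continuous_on_iff by blast
    \<comment> \<open>\<open>R\<close> refers to the fixed element \<open>F t\<close> and the fixed
      disc \<open>?U\<close>, not to \<open>s\<close>; proving every nearby \<open>Good s\<close>
      equivalent to \<open>R\<close> makes \<open>Good\<close> locally constant along the
      path.\<close>
    define R where "R \<longleftrightarrow> (\<forall>w\<in>?U. w \<in> P \<longrightarrow> good t w)"
    have all: "R" if a: "w1 \<in> ?U" "w1 \<in> P" "good t w1" for w1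
    proof -
      obtain N where N: "N \<in> Gr" "\<forall>\<^sub>F z in nhds w1. F t z = \<Psi> z ** N" using a(3) unfolding good_def by blast
      show ?thesis unfolding R_def
      proof (intro ballI impI)
        fix w assume "w \<in> ?U" "w \<in> P"
        then show "good t w" unfolding good_def by (rule adapted_germs[OF U FU a(1,2) N])
      qed
    qed
    have equiv: "Good s \<longleftrightarrow> R" if s: "s \<in> {0..1}" "dist s t < min \<delta> \<delta>'" for s
    proof -
      have "\<gamma> s \<in> ?U" using \<delta>'(2)[OF s(1)] s(2) by (simp add: dist_commute)
      then have "\<forall>\<^sub>F w in nhds (\<gamma> s). w \<in> ?U" by (intro eventually_nhds_in_open) auto
      moreover have "\<forall>\<^sub>F w in nhds (\<gamma> s). F s w = F t w" using \<delta>(2)[OF s(1)] s(2) by (simp add: dist_real_def)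
      ultimately have ev: "\<forall>\<^sub>F w in nhds (\<gamma> s). w \<in> ?U \<and> F s w = F t w" by eventually_elim simp
      show ?thesis
      proof
        assume "Good s"
        then have "\<forall>\<^sub>F w in nhds (\<gamma> s). w \<in> P \<longrightarrow> good s w" unfolding Good_def .
        with ev have "\<forall>\<^sub>F w in nhds (\<gamma> s). (w \<in> ?U \<and> F s w = F t w) \<and> (w \<in> P \<longrightarrow> good s w)"
          by eventually_elim simp
        then obtain O' where O': "open O'" "\<gamma> s \<in> O'" "\<And>w. w \<in> O' \<Longrightarrow> (w \<in> ?U \<and> F s w = F t w) \<and> (w \<in> P \<longrightarrow> good s w)"
          unfolding eventually_nhds by blast
        obtain w where w: "w \<in> O'" "w \<in> P" using open_meets_P[OF O'(1,2)] by blast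
        have "\<forall>\<^sub>F z in nhds w. F s z = F t z" unfolding eventually_nhds using O' w(1) by blast
        then have "good t w" using O'(3)[OF w(1)] w(2) good_cong by blast
        then show R using all[of w] O'(3)[OF w(1)] w(2) by blast
      next
        assume R
        have "\<forall>\<^sub>F w in nhds (\<gamma> s). \<forall>\<^sub>F z in nhds w. z \<in> ?U \<and> F s z = F t z"
          using ev by (simp add: eventually_eventually)
        then show "Good s" unfolding Good_def
        proof eventually_elim
          case (elim w)
          have "w \<in> ?U" using eventually_nhds_x_imp_x[OF elim] by simp
          moreover have "\<forall>\<^sub>F z in nhds w. F t z = F s z" using elim by eventually_elim simp
          ultimately show ?case using \<open>R\<close> good_cong unfolding R_def by blast
        qed
      qed
    qed
    show "\<exists>T. openin (top_of_set {0..1}) T \<and> t \<in> T \<and> (\<forall>x\<in>T. \<forall>y\<in>T. Good x \<longrightarrow> Good y)"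
    proof (intro exI[of _ "{0..1} \<inter> ball t (min \<delta> \<delta>')"] conjI ballI impI)
      show "openin (top_of_set {0..1}) ({0..1} \<inter> ball t (min \<delta> \<delta>'))" by (simp add: openin_open_Int)
      fix x y assume "x \<in> {0..1} \<inter> ball t (min \<delta> \<delta>')" "y \<in> {0..1} \<inter> ball t (min \<delta> \<delta>')" "Good x"
      then show "Good y" using equiv[of x] equiv[of y] by (auto simp: dist_commute)
    qed (use t \<delta>(1) \<delta>'(1) in auto)
  qed auto
  then have "z0 \<in> P \<longrightarrow> good 1 z0" unfolding Good_def g01 by (rule eventually_nhds_x_imp_x)
  then obtain N where N: "N \<in> Gr" "\<forall>\<^sub>F z in nhds z0. F 1 z = \<Psi> z ** N" using z0 unfolding good_def by blast
  have "\<Psi> z0 ** N = \<Psi> z0 ** M"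
    using eventually_nhds_x_imp_x[OF N(2)] eventually_nhds_x_imp_x[OF F(4)] unfolding g01 by simp
  moreover obtain V where "V ** \<Psi> z0 = mat 1" using inv[OF z0] unfolding invertible_left_inverse by blast
  ultimately have "N = M" by (metis matrix_mul_assoc matrix_mul_lid)
  then show "M \<in> Gr" using N(1) by simp
qed

lemma monodromy_group_eq:
  assumes "\<nexists>m::int. is_eigenvalue A1 (of_int m)" "z0 \<in> P"
  shows "monodromy_group lam z0 \<Psi> = Gr"
  using monodromy_group_subset_generate[OF invertible_Psi_matrix[OF assms(1)] assms(2)]
    generate_subset_monodromy_group[OF assms(2)] by blast

end

theorem mainTheorem4:
  fixes lam :: "'n::finite \<Rightarrow> complex" and A1 :: "complex^'n^'n" and \<eta> :: real
    and Psi Psing :: "'n \<Rightarrow> complex \<Rightarrow> complex^'n" and C :: "complex^'n^'n"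
  assumes "inj lam"
    and "admissible lam \<eta>"
    and "\<And>k. is_Psi lam A1 \<eta> k (Psi k)"
    and "\<And>k. is_Psi_sing lam A1 \<eta> k (Psi k) (Psing k)"
    and "is_connection_matrix lam \<eta> Psi Psing C"
  shows "((\<nexists>m::int. is_eigenvalue A1 (of_int m)) \<longrightarrow>
           is_fundamental_matrix lam A1 (cut_plane lam \<eta>) (Psi_matrix Psi) \<and>
           (\<forall>z0 \<in> cut_plane lam \<eta>.
              monodromy_group lam z0 (Psi_matrix Psi) = generate GL (range (monodromy_matrix A1 C)))) \<and>
         (invertible C \<longleftrightarrow> (\<nexists>m::int. is_eigenvalue A1 (of_int m)))"
proof -
  interpret distinguished lam A1 \<eta> Psi Psing C
    using assms by unfold_locales auto
  show ?thesis using fundamental_matrix monodromy_group_eq invertible_C_iff by blast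
qed

end
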